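(* Let $V\in L^1(\mathbb{R}_+)\cap L^2(\mathbb{R}_+)$ be real-valued. Let $\lambda_1\le\lambda_2\le\dots$ be the negative eigenvalues of the Schrödinger operator $-\frac{\mathrm{d}^2}{\mathrm{d}x^2}+V$ on $L^2(\mathbb{R}_+)$ with Dirichlet boundary condition $\varphi(0)=0$, and let $\varphi_j$ denote the eigenfunction to $\lambda_j$. Then $$\sum_{j\ge1}|\lambda_j|^{\frac32}\le\frac{3}{16}\int_0^\infty V(x)^2\,\mathrm{d}x-\frac34\sum_{j\ge1}\frac{|\varphi_j'(0)|^2}{\|\varphi_j\|^2}.$$
   Context: $\mathbb{R}_+=(0,\infty)$ and $\|\cdot\|$ is the norm of $L^2(\mathbb{R}_+)$. The operator $-\frac{\mathrm{d}^2}{\mathrm{d}x^2}+V$ with Dirichlet boundary condition is the self-adjoint operator acting as $\varphi\mapsto-\varphi''+V\varphi$ on those $\varphi\in L^2(\mathbb{R}_+)$ for which $\varphi,\varphi'$ are locally absolutely continuous on $[0,\infty)$, $-\varphi''+V\varphi\in L^2(\mathbb{R}_+)$ and $\varphi(0)=0$. Its negative spectrum consists of (simple) discrete eigenvalues, finitely or infinitely many, enumerated in increasing order starting with the lowest one. Each $\varphi_j$ is a nonzero eigenfunction, unique up to a scalar factor, so $|\varphi_j'(0)|^2/\|\varphi_j\|^2$ is well defined. Both sums run over the indices $j$ of the existing negative eigenvalues (an empty sum is $0$); their terms are non-negative and, a priori, the sums are understood as values in $[0,\infty]$, so that the inequality in particular includes that both are finite. *)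

theory Defs
  imports "HOL-Analysis.Analysis"
begin

abbreviation half_line :: "real measure" where
  "half_line \<equiv> lebesgue_on {0<..}"

text \<open>As usual, elements of L2 are represented by functions; equality of elements is equality
  almost everywhere. Values outside the half-line are irrelevant.\<close>

definition L2 :: "'a measure \<Rightarrow> ('a \<Rightarrow> 'b::{second_countable_topology, real_normed_vector}) set" where
  "L2 M = {f \<in> borel_measurable M. integrable M (\<lambda>x. (norm (f x))\<^sup>2)}"

definition L2_norm :: "'a measure \<Rightarrow> ('a \<Rightarrow> 'b::real_normed_vector) \<Rightarrow> real" where
  "L2_norm M f = sqrt (\<integral>x. (norm (f x))\<^sup>2 \<partial>M)"

text \<open>The epsilon-delta definition of absolute continuity. The set \<open>d\<close> ranges over the finite
  families of non-overlapping compact intervals \<open>k = {Inf k..Sup k}\<close> contained in \<open>S\<close>.\<close>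

definition absolutely_continuous_on :: "real set \<Rightarrow> (real \<Rightarrow> 'a::real_normed_vector) \<Rightarrow> bool" where
  "absolutely_continuous_on S f \<longleftrightarrow>
     (\<forall>\<epsilon>>0. \<exists>\<delta>>0. \<forall>d. d division_of \<Union>d \<and> \<Union>d \<subseteq> S \<and> (\<Sum>k\<in>d. Sup k - Inf k) < \<delta>
        \<longrightarrow> (\<Sum>k\<in>d. norm (f (Sup k) - f (Inf k))) < \<epsilon>)"

definition locally_AC :: "(real \<Rightarrow> 'a::real_normed_vector) \<Rightarrow> bool" where
  "locally_AC f \<longleftrightarrow> (\<forall>b\<ge>0. absolutely_continuous_on {0..b} f)"

text \<open>The derivative on \<open>{0..}\<close>: one-sided at \<open>0\<close>, two-sided elsewhere. It is meaningful only
  where \<open>f\<close> is differentiable; for the second derivative below this is almost everywhere,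
  since the first derivative is required to be locally absolutely continuous.\<close>

definition D :: "(real \<Rightarrow> complex) \<Rightarrow> real \<Rightarrow> complex" where
  "D f x = vector_derivative f (at x within {0..})"

definition schroedinger :: "(real \<Rightarrow> real) \<Rightarrow> (real \<Rightarrow> complex) \<Rightarrow> real \<Rightarrow> complex" where
  "schroedinger V \<phi> x = - D (D \<phi>) x + complex_of_real (V x) * \<phi> x"

definition dirichlet_domain :: "(real \<Rightarrow> real) \<Rightarrow> (real \<Rightarrow> complex) set" where
  "dirichlet_domain V = {\<phi> \<in> L2 half_line.
     (\<forall>x\<ge>0. \<phi> differentiable (at x within {0..})) \<and>
     locally_AC \<phi> \<and> locally_AC (D \<phi>) \<and>
     schroedinger V \<phi> \<in> L2 half_line \<and> \<phi> 0 = 0}"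

definition eigenfunction :: "(real \<Rightarrow> real) \<Rightarrow> real \<Rightarrow> (real \<Rightarrow> complex) \<Rightarrow> bool" where
  "eigenfunction V \<mu> \<phi> \<longleftrightarrow>
     \<phi> \<in> dirichlet_domain V \<and> \<not> (AE x in half_line. \<phi> x = 0) \<and>
     (AE x in half_line. schroedinger V \<phi> x = complex_of_real \<mu> * \<phi> x)"

definition negative_eigenvalues :: "(real \<Rightarrow> real) \<Rightarrow> real set" where
  "negative_eigenvalues V = {\<mu>. \<mu> < 0 \<and> (\<exists>\<phi>. eigenfunction V \<mu> \<phi>)}"

text \<open>The indices \<open>1, 2, \<dots>\<close> of a sequence with \<open>N\<close> terms, where \<open>N\<close> may be \<open>\<infinity>\<close>.\<close>

definition indices :: "enat \<Rightarrow> nat set" where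
  "indices N = {j. 1 \<le> j \<and> enat j \<le> N}"

end

theory Submission
  imports Defs
begin

text \<open>The proof removes the eigenvalues one after the other by double commutation. If \<open>u\<close> is a real
  eigenfunction to \<open>-k\<^sup>2\<close> with \<open>u 0 = 0\<close> and \<open>u' 0 = 1\<close>, and \<open>G x\<close> is the integral of \<open>u\<^sup>2\<close> over
  \<open>{x..}\<close>, then the potential \<open>W = V + 2 (u\<^sup>2 / G)'\<close> has the remaining eigenvalues, and their eigenfunctions
  can be chosen with the same derivative at \<open>0\<close> and the same norm as before. Moreover \<open>(W\<^sup>2 - V\<^sup>2) / 4\<close> is
  the derivative of an explicit expression in \<open>u\<close>, \<open>u'\<close> and \<open>G\<close> (\<open>flux\<close> below) which equals \<open>1 / G 0\<close> at \<open>0\<close> and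
  tends to \<open>-4 k\<^sup>3 / 3\<close> at infinity. Each step thus lowers the integral of the squared potential by
  exactly \<open>16 k\<^sup>3 / 3 + 4 / G 0\<close>, and that integral stays non-negative. The limit of the flux needs only
  that \<open>V\<close> is square integrable: comparing \<open>u\<^sup>2\<close>, \<open>u u'\<close> and \<open>u'\<^sup>2\<close> with the tail \<open>M\<close> of the integral of \<open>u'\<^sup>2 + k\<^sup>2 u\<^sup>2\<close>
  gives their limit ratios \<open>1/k\<close>, \<open>-1\<close> and \<open>k\<close>.\<close>

section \<open>Absolutely continuous functions and the fundamental theorem of calculus\<close>

text \<open>Single commutation would divide by \<open>u\<close>, which vanishes at 0 and, except for
  the lowest state, elsewhere too, so the new potential would be singular. Double commutation
  divides by \<open>G\<close>, which is positive on the whole half-line. Hence the eigenvalues may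
  be removed in any order, no oscillation theory enters, and finite sets of eigenvalues suffice
  because the sums have non-negative terms. The obstacle is regularity: the potential is controlled
  through integrals and not pointwise, so \<open>u'\<close> is merely absolutely continuous, and its
  decay and all limits at infinity must come from integral identities. Moreover
  \<open>D (D \<phi>)\<close> means something only where the derivative exists, so the eigenvalue
  equation becomes usable only after almost everywhere differentiability and the fundamental theorem
  have been drawn from the epsilon-delta definition. The constants come from the loss in one step:
  \<open>3/16\<close> times \<open>16/3 k^3 + 4 / G 0\<close> is \<open>k^3 + 3/4 / G 0\<close>, and
  with \<open>u' 0 = 1\<close> the number \<open>1 / G 0\<close> is the boundary ratio of the
  eigenfunction.\<close>

lemma absolutely_continuous_on_mono:
  assumes "absolutely_continuous_on T f" "S \<subseteq> T"
  shows "absolutely_continuous_on S f"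
  using assms unfolding absolutely_continuous_on_def by (meson order_trans)

lemma Inf_Sup_division:
  fixes d :: "real set set"
  assumes "d division_of df" "k \<in> d"
  shows "Inf k \<in> k" "Sup k \<in> k" "Inf k \<le> Sup k" "k = {Inf k..Sup k}"
proof -
  obtain a b where k: "k = cbox a b" and ne: "k \<noteq> {}"
    using division_ofD(3,4)[OF assms] by blast
  then have "a \<le> b" by auto
  then show "Inf k \<in> k" "Sup k \<in> k" "Inf k \<le> Sup k" "k = {Inf k..Sup k}"
    using k by auto
qed

text \<open>The closure properties of absolute continuity used here, from sums, products and
  reciprocals to real parts, all reduce to a pointwise bound of increments. Two majorants are
  allowed because sums and products have two parts to control.\<close>

lemma absolutely_continuous_on_dominated2:
  fixes f :: "real \<Rightarrow> 'a::real_normed_vector" and g :: "real \<Rightarrow> 'b::real_normed_vector"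
    and h :: "real \<Rightarrow> 'c::real_normed_vector"
  assumes f: "absolutely_continuous_on S f" and g: "absolutely_continuous_on S g"
    and dom: "\<And>x y. x \<in> S \<Longrightarrow> y \<in> S \<Longrightarrow> norm (h x - h y) \<le> K * (norm (f x - f y) + norm (g x - g y))"
  shows "absolutely_continuous_on S h"
  unfolding absolutely_continuous_on_def
proof (intro allI impI)
  fix \<epsilon> :: real assume "\<epsilon> > 0"
  define L where "L = \<bar>K\<bar> + 1"
  have L: "L > 0" "K \<le> L" by (auto simp: L_def)
  define e where "e = \<epsilon> / (2 * L)"
  have e: "e > 0" using L \<open>\<epsilon> > 0\<close> by (auto simp: e_def)
  obtain \<delta>1 where d1: "\<delta>1 > 0" "\<And>d. d division_of \<Union>d \<Longrightarrow> \<Union>d \<subseteq> S \<Longrightarrow> (\<Sum>k\<in>d. Sup k - Inf k) < \<delta>1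
        \<Longrightarrow> (\<Sum>k\<in>d. norm (f (Sup k) - f (Inf k))) < e"
    using f e unfolding absolutely_continuous_on_def by meson
  obtain \<delta>2 where d2: "\<delta>2 > 0" "\<And>d. d division_of \<Union>d \<Longrightarrow> \<Union>d \<subseteq> S \<Longrightarrow> (\<Sum>k\<in>d. Sup k - Inf k) < \<delta>2
        \<Longrightarrow> (\<Sum>k\<in>d. norm (g (Sup k) - g (Inf k))) < e"
    using g e unfolding absolutely_continuous_on_def by meson
  show "\<exists>\<delta>>0. \<forall>d. d division_of \<Union>d \<and> \<Union>d \<subseteq> S \<and> (\<Sum>k\<in>d. Sup k - Inf k) < \<delta> \<longrightarrow>
               (\<Sum>k\<in>d. norm (h (Sup k) - h (Inf k))) < \<epsilon>"
  proof (intro exI[of _ "min \<delta>1 \<delta>2"] conjI allI impI; (elim conjE)?)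
    show "min \<delta>1 \<delta>2 > 0" using d1 d2 by auto
    fix d :: "real set set"
    assume d: "d division_of \<Union>d" "\<Union>d \<subseteq> S" "(\<Sum>k\<in>d. Sup k - Inf k) < min \<delta>1 \<delta>2"
    have "norm (h (Sup k) - h (Inf k)) \<le> L * (norm (f (Sup k) - f (Inf k)) + norm (g (Sup k) - g (Inf k)))"
      if "k \<in> d" for k
    proof -
      have "Sup k \<in> S" "Inf k \<in> S" using Inf_Sup_division[OF d(1) that] d(2) that by blast+
      then have "norm (h (Sup k) - h (Inf k)) \<le> K * (norm (f (Sup k) - f (Inf k)) + norm (g (Sup k) - g (Inf k)))"
        by (rule dom)
      also have "\<dots> \<le> L * (norm (f (Sup k) - f (Inf k)) + norm (g (Sup k) - g (Inf k)))"
        using L by (intro mult_right_mono) auto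
      finally show ?thesis .
    qed
    then have "(\<Sum>k\<in>d. norm (h (Sup k) - h (Inf k))) \<le>
        (\<Sum>k\<in>d. L * (norm (f (Sup k) - f (Inf k)) + norm (g (Sup k) - g (Inf k))))"
      by (intro sum_mono)
    also have "\<dots> = L * ((\<Sum>k\<in>d. norm (f (Sup k) - f (Inf k))) + (\<Sum>k\<in>d. norm (g (Sup k) - g (Inf k))))"
      by (simp add: sum_distrib_left[symmetric] sum.distrib)
    also have "\<dots> < L * (e + e)"
      using d1(2)[OF d(1,2)] d2(2)[OF d(1,2)] d(3) L by (intro mult_strict_left_mono add_strict_mono) auto
    also have "\<dots> = \<epsilon>" using L by (simp add: e_def)
    finally show "(\<Sum>k\<in>d. norm (h (Sup k) - h (Inf k))) < \<epsilon>" .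
  qed
qed

lemma absolutely_continuous_on_dominated:
  fixes f :: "real \<Rightarrow> 'a::real_normed_vector" and h :: "real \<Rightarrow> 'c::real_normed_vector"
  assumes f: "absolutely_continuous_on S f"
    and dom: "\<And>x y. x \<in> S \<Longrightarrow> y \<in> S \<Longrightarrow> norm (h x - h y) \<le> K * norm (f x - f y)"
  shows "absolutely_continuous_on S h"
  by (rule absolutely_continuous_on_dominated2[OF f f, where K = "K/2"]) (use dom in auto)

lemma absolutely_continuous_on_ident: "absolutely_continuous_on S (\<lambda>x::real. x)"
  unfolding absolutely_continuous_on_def
proof (intro allI impI, rule exI, intro conjI allI impI; (elim conjE)?)
  fix e :: real and d :: "real set set"
  assume d: "d division_of \<Union>d" "(\<Sum>k\<in>d. Sup k - Inf k) < e"
  have "(\<Sum>k\<in>d. norm (Sup k - Inf k)) = (\<Sum>k\<in>d. Sup k - Inf k)"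
    by (intro sum.cong) (use Inf_Sup_division(3)[OF d(1)] in auto)
  then show "(\<Sum>k\<in>d. norm (Sup k - Inf k)) < e" using d by simp
qed

lemma division_of_single_interval:
  fixes x y :: real
  assumes "x \<le> y"
  shows "{{x..y}} division_of \<Union>{{x..y}}"
  using division_of_self[of x y] assms by simp

lemma absolutely_continuous_on_imp_continuous_on:
  fixes f :: "real \<Rightarrow> 'a::real_normed_vector"
  assumes f: "absolutely_continuous_on {a..b} f"
  shows "continuous_on {a..b} f"
  unfolding continuous_on_iff
proof (intro ballI allI impI)
  fix x e :: real assume x: "x \<in> {a..b}" and "e > 0"
  obtain \<delta> where \<delta>: "\<delta> > 0" "\<And>d. d division_of \<Union>d \<Longrightarrow> \<Union>d \<subseteq> {a..b} \<Longrightarrow> (\<Sum>k\<in>d. Sup k - Inf k) < \<delta>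
        \<Longrightarrow> (\<Sum>k\<in>d. norm (f (Sup k) - f (Inf k))) < e"
    using f \<open>e > 0\<close> unfolding absolutely_continuous_on_def by meson
  have *: "norm (f v - f u) < e" if "u \<le> v" "u \<in> {a..b}" "v \<in> {a..b}" "v - u < \<delta>" for u v
    using \<delta>(2)[OF division_of_single_interval[OF that(1)]] that by auto
  show "\<exists>d>0. \<forall>x'\<in>{a..b}. dist x' x < d \<longrightarrow> dist (f x') (f x) < e"
  proof (intro exI[of _ \<delta>] conjI ballI impI)
    fix x' assume "x' \<in> {a..b}" "dist x' x < \<delta>"
    then show "dist (f x') (f x) < e"
      using *[of x x'] *[of x' x] x by (cases "x \<le> x'") (auto simp: dist_norm norm_minus_commute)
  qed (use \<delta> in auto)
qed

lemma absolutely_continuous_on_add: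
  assumes "absolutely_continuous_on S f" "absolutely_continuous_on S g"
  shows "absolutely_continuous_on S (\<lambda>x. f x + g x)"
  by (rule absolutely_continuous_on_dominated2[OF assms, where K = 1])
     (metis add_diff_add norm_triangle_ineq mult_1)

lemma absolutely_continuous_on_mult:
  fixes f g :: "real \<Rightarrow> 'a::real_normed_algebra"
  assumes f: "absolutely_continuous_on {a..b} f" and g: "absolutely_continuous_on {a..b} g"
  shows "absolutely_continuous_on {a..b} (\<lambda>x. f x * g x)"
proof -
  obtain A where A: "\<And>x. x \<in> {a..b} \<Longrightarrow> norm (f x) \<le> A"
    using absolutely_continuous_on_imp_continuous_on[OF f]
    by (metis compact_Icc compact_continuous_image bounded_iff compact_imp_bounded image_eqI)
  obtain B where B: "\<And>x. x \<in> {a..b} \<Longrightarrow> norm (g x) \<le> B"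
    using absolutely_continuous_on_imp_continuous_on[OF g]
    by (metis compact_Icc compact_continuous_image bounded_iff compact_imp_bounded image_eqI)
  show ?thesis
  proof (rule absolutely_continuous_on_dominated2[OF f g, where K = "\<bar>A\<bar> + \<bar>B\<bar>"])
    fix x y assume xy: "x \<in> {a..b}" "y \<in> {a..b}"
    have "norm (f x * g x - f y * g y) = norm (f x * (g x - g y) + (f x - f y) * g y)"
      by (simp add: algebra_simps)
    also have "\<dots> \<le> norm (f x) * norm (g x - g y) + norm (f x - f y) * norm (g y)"
      by (meson add_mono norm_mult_ineq norm_triangle_le)
    also have "\<dots> \<le> \<bar>A\<bar> * norm (g x - g y) + norm (f x - f y) * \<bar>B\<bar>"
      using A[OF xy(1)] B[OF xy(2)] by (intro add_mono mult_mono) auto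
    also have "\<dots> \<le> (\<bar>A\<bar> + \<bar>B\<bar>) * (norm (f x - f y) + norm (g x - g y))"
      by (simp add: algebra_simps)
    finally show "norm (f x * g x - f y * g y) \<le> (\<bar>A\<bar> + \<bar>B\<bar>) * (norm (f x - f y) + norm (g x - g y))" .
  qed
qed

lemma absolutely_continuous_on_inverse:
  fixes f :: "real \<Rightarrow> real"
  assumes f: "absolutely_continuous_on {a..b} f" and nz: "\<And>x. x \<in> {a..b} \<Longrightarrow> f x > 0"
  shows "absolutely_continuous_on {a..b} (\<lambda>x. inverse (f x))"
proof -
  have "continuous_on {a..b} (\<lambda>x. inverse (f x))"
    using absolutely_continuous_on_imp_continuous_on[OF f] nz
    by (intro continuous_on_inverse) force+
  then obtain A where A: "\<And>x. x \<in> {a..b} \<Longrightarrow> norm (inverse (f x)) \<le> A"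
    by (metis compact_Icc compact_continuous_image bounded_iff compact_imp_bounded image_eqI)
  show ?thesis
  proof (rule absolutely_continuous_on_dominated[OF f, where K = "\<bar>A\<bar> * \<bar>A\<bar>"])
    fix x y assume xy: "x \<in> {a..b}" "y \<in> {a..b}"
    have "inverse (f x) - inverse (f y) = inverse (f x) * inverse (f y) * (f y - f x)"
      using nz[OF xy(1)] nz[OF xy(2)] by (simp add: field_simps)
    then have "norm (inverse (f x) - inverse (f y)) = norm (inverse (f x)) * norm (inverse (f y)) * norm (f y - f x)"
      by (simp add: abs_mult)
    also have "\<dots> \<le> \<bar>A\<bar> * \<bar>A\<bar> * norm (f x - f y)"
      using A[OF xy(1)] A[OF xy(2)] by (intro mult_mono) (auto simp: norm_minus_commute)
    finally show "norm (inverse (f x) - inverse (f y)) \<le> \<bar>A\<bar> * \<bar>A\<bar> * norm (f x - f y)" .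
  qed
qed

lemma absolutely_continuous_on_C1:
  fixes f :: "real \<Rightarrow> 'a::real_normed_vector"
  assumes der: "\<And>x. x \<in> {a..b} \<Longrightarrow> (f has_vector_derivative f' x) (at x within {a..b})"
    and cont: "continuous_on {a..b} f'"
  shows "absolutely_continuous_on {a..b} f"
proof -
  obtain B where B: "\<And>x. x \<in> {a..b} \<Longrightarrow> norm (f' x) \<le> B"
    using cont by (metis compact_Icc compact_continuous_image bounded_iff compact_imp_bounded image_eqI)
  show ?thesis
  proof (rule absolutely_continuous_on_dominated[OF absolutely_continuous_on_ident, where K = B])
    fix x y assume "x \<in> {a..b}" "y \<in> {a..b}"
    then show "norm (f x - f y) \<le> B * norm (x - y)"
      using differentiable_bound[of "{a..b}" f "\<lambda>x h. h *\<^sub>R f' x" B x y]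
        der B by (auto simp: has_vector_derivative_def onorm_scaleR_left onorm_id)
  qed
qed

lemma content_real_interval: "measure lborel k = Sup k - Inf k" if "d division_of df" "k \<in> d" for k :: "real set"
  using Inf_Sup_division[OF that] by (metis content_real)

lemma measure_division_interval:
  fixes k :: "real set"
  assumes "d division_of S" "k \<in> d"
  shows "measure lebesgue k = Sup k - Inf k"
proof -
  have "measure lebesgue {Inf k..Sup k} = Sup k - Inf k"
    using Inf_Sup_division(3)[OF assms] by simp
  then show ?thesis using Inf_Sup_division(4)[OF assms] by simp
qed

text \<open>A Henstock-Kurzweil argument, so integrability of \<open>g\<close> is part of the
  conclusion. At tags outside \<open>N\<close> differentiability makes the error of an interval at
  most \<open>c\<close> times its length; intervals with tags in \<open>N\<close> are squeezed into
  an open set of measure below \<open>\<delta>\<close>, where absolute continuity makes their total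
  increment small.\<close>

lemma fundamental_theorem_of_calculus_absolutely_continuous:
  fixes f :: "real \<Rightarrow> 'a::euclidean_space"
  assumes ab: "a \<le> b" and ac: "absolutely_continuous_on {a..b} f" and N: "negligible N"
    and der: "\<And>x. x \<in> {a..b} - N \<Longrightarrow> (f has_vector_derivative g x) (at x within {a..b})"
  shows "(g has_integral (f b - f a)) {a..b}"
proof -
  \<comment> \<open>With value 0 on \<open>N\<close>, a tag in \<open>N\<close> contributes only the
    increment of \<open>f\<close>.\<close>
  define h where "h x = (if x \<in> N then 0 else g x)" for x
  have "(h has_integral (f b - f a)) {a..b}"
    unfolding has_integral_real
  proof (intro allI impI)
    fix e :: real assume "e > 0"
    \<comment> \<open>The total error at tags outside \<open>N\<close> is at most
      \<open>c * (b - a) < e / 2\<close>; the summand 1 covers \<open>a = b\<close>.\<close>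
    define c where "c = e / (2 * (b - a + 1))"
    have c: "c > 0" "c * (b - a) < e / 2" using ab \<open>e > 0\<close> by (auto simp: c_def field_simps)
    obtain \<delta> where \<delta>: "\<delta> > 0" "\<And>d. d division_of \<Union>d \<Longrightarrow> \<Union>d \<subseteq> {a..b} \<Longrightarrow> (\<Sum>k\<in>d. Sup k - Inf k) < \<delta>
        \<Longrightarrow> (\<Sum>k\<in>d. norm (f (Sup k) - f (Inf k))) < e / 2"
      using ac half_gt_zero[OF \<open>e > 0\<close>] unfolding absolutely_continuous_on_def by meson
    obtain U where U: "open U" "N \<subseteq> U" "U \<in> lmeasurable" "emeasure lebesgue (U - N) < ennreal \<delta>"
    proof -
      have "N \<in> sets lebesgue" using N by (simp add: negligible_imp_sets)
      then obtain U where U: "open U" "N \<subseteq> U" "U - N \<in> lmeasurable" "emeasure lebesgue (U - N) < ennreal \<delta>"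
        using sets_lebesgue_outer_open[of N \<delta>] \<delta>(1) by blast
      moreover have "U \<in> lmeasurable"
        using U N by (metis Diff_partition fmeasurable.Un negligible_imp_measurable)
      ultimately show thesis using that by blast
    qed
    have mU: "measure lebesgue U < \<delta>"
    proof -
      have "emeasure lebesgue U = emeasure lebesgue (U - N)"
        using N U by (metis emeasure_Diff_null_set fmeasurableD negligible_iff_null_sets)
      then show ?thesis using U(4) U(3) \<delta>(1)
        by (metis emeasure_eq_measure2 ennreal_less_iff measure_nonneg)
    qed
    have "\<exists>r>0. ball x r \<subseteq> U" if "x \<in> N" for x
      using U that by (meson open_contains_ball subsetD)
    then obtain r1 where r1: "\<And>x. x \<in> N \<Longrightarrow> r1 x > 0 \<and> ball x (r1 x) \<subseteq> U" by metis
    have "\<exists>r>0. \<forall>y\<in>{a..b}. norm (y - x) < r \<longrightarrow> norm (f y - f x - (y - x) *\<^sub>R g x) \<le> c * norm (y - x)"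
      if "x \<in> {a..b} - N" for x
      using der[OF that] c(1) unfolding has_vector_derivative_def has_derivative_within_alt by meson
    then obtain r2 where r2: "\<And>x. x \<in> {a..b} - N \<Longrightarrow> r2 x > 0 \<and>
        (\<forall>y\<in>{a..b}. norm (y - x) < r2 x \<longrightarrow> norm (f y - f x - (y - x) *\<^sub>R g x) \<le> c * norm (y - x))" by metis
    define r where "r x = (if x \<in> N then r1 x else if x \<in> {a..b} then r2 x else 1)" for x
    have r: "r x > 0" for x using r1[of x] r2[of x] by (auto simp: r_def)
    show "\<exists>\<gamma>. gauge \<gamma> \<and> (\<forall>p. p tagged_division_of {a..b} \<and> \<gamma> fine p \<longrightarrow>
             norm ((\<Sum>(x,k)\<in>p. measure lborel k *\<^sub>R h x) - (f b - f a)) < e)"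
    proof (intro exI[of _ "\<lambda>x. ball x (r x)"] conjI allI impI gauge_ball_dependent r; (elim conjE)?)
      fix p assume p: "p tagged_division_of {a..b}" and fine: "(\<lambda>x. ball x (r x)) fine p"
      have fp: "finite p" using p by auto
      define df where "df k = f (Sup k) - f (Inf k)" for k :: "real set"
      have tel: "(\<Sum>(x,k)\<in>p. df k) = f b - f a"
        using additive_tagged_division_1[OF ab p, of f] by (simp add: df_def)
      have div: "snd ` p division_of {a..b}" by (rule division_of_tagged_division[OF p])
      have IS: "x \<in> k" "k \<subseteq> {a..b}" "k \<subseteq> ball x (r x)" "k = {Inf k..Sup k}" "Inf k \<in> k" "Sup k \<in> k"
               "measure lborel k = Sup k - Inf k" "Inf k \<le> Sup k" if "(x,k) \<in> p" for x k
      proof -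
        have k: "k \<in> snd ` p" using that by force
        show "x \<in> k" "k \<subseteq> {a..b}" using tagged_division_ofD(2,3)[OF p that] by auto
        show "k \<subseteq> ball x (r x)" using fine that by (meson fineD)
        show "k = {Inf k..Sup k}" "Inf k \<in> k" "Sup k \<in> k" "Inf k \<le> Sup k"
          using Inf_Sup_division[OF div k] by auto
        show "measure lborel k = Sup k - Inf k" by (rule content_real_interval[OF div k])
      qed
      define p1 where "p1 = {q \<in> p. fst q \<in> N}"
      have p1: "p1 \<subseteq> p" by (auto simp: p1_def)
      have p1d: "p1 tagged_division_of \<Union>(snd ` p1)"
        using p p1 by (meson tagged_division_ofD(1) tagged_division_of_def tagged_partial_division_of_Union_self tagged_partial_division_subset)
      have d1: "snd ` p1 division_of \<Union>(snd ` p1)" by (rule division_of_tagged_division[OF p1d])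
      have A: "(\<Sum>(x,k)\<in>p1. norm (df k)) < e / 2"
      proof -
        \<comment> \<open>Passing from a sum over tagged intervals to one over intervals requires
          degenerate boxes to contribute 0, including the empty one, where \<open>Inf\<close> and
          \<open>Sup\<close> say nothing.\<close>
        define m where "m k = (if k = {} then 0 else norm (df k))" for k
        have m: "m k = norm (df k)" if "k \<in> snd ` p1" for k
          using d1 that by (auto simp: m_def)
        have "(\<Sum>(x,k)\<in>p1. m k) = (\<Sum>k\<in>snd ` p1. m k)"
        proof (rule sum.over_tagged_division_lemma[OF p1d])
          fix u v :: real assume "box u v = {}"
          then have "v \<le> u" by auto
          then show "m (cbox u v) = 0"
            by (cases "u = v") (auto simp: m_def df_def)
        qed
        moreover have "(\<Sum>(x,k)\<in>p1. m k) = (\<Sum>(x,k)\<in>p1. norm (df k))"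
          by (intro sum.cong refl) (use m in force)
        ultimately have "(\<Sum>(x,k)\<in>p1. norm (df k)) = (\<Sum>k\<in>snd ` p1. norm (df k))"
          using m by (metis (mono_tags, lifting) sum.cong)
        also have "\<dots> < e / 2" unfolding df_def
        proof (rule \<delta>(2)[OF d1])
          show "\<Union>(snd ` p1) \<subseteq> {a..b}" using IS(2) p1 by fastforce
          have "(\<Sum>k\<in>snd ` p1. Sup k - Inf k) = (\<Sum>k\<in>snd ` p1. measure lebesgue k)"
            by (intro sum.cong refl) (metis measure_division_interval d1)
          also have "\<dots> = measure lebesgue (\<Union>(snd ` p1))"
            by (rule content_division[OF d1])
          also have "\<dots> \<le> measure lebesgue U"
          proof (rule measure_mono_fmeasurable[OF _ _ U(3)])
            show "\<Union>(snd ` p1) \<subseteq> U"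
            proof clarsimp
              fix y x k assume "(x,k) \<in> p1" "y \<in> k"
              then have "(x,k) \<in> p" "x \<in> N" by (auto simp: p1_def)
              then show "y \<in> U" using IS(3)[of x k] r1[of x] \<open>y \<in> k\<close> by (auto simp: r_def)
            qed
            show "\<Union>(snd ` p1) \<in> sets lebesgue"
              using d1 by (intro sets.finite_Union) (auto simp: division_of_def)
          qed
          finally show "(\<Sum>k\<in>snd ` p1. Sup k - Inf k) < \<delta>" using mU by simp
        qed
        finally show ?thesis .
      qed
      have B: "norm (measure lborel k *\<^sub>R h x - df k) \<le> (if x \<in> N then norm (df k) else c * measure lborel k)"
        if xk: "(x,k) \<in> p" for x k
      proof (cases "x \<in> N")
        case True then show ?thesis by (simp add: h_def)
      next
        case False
        note I = IS[OF xk]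
        have x: "x \<in> {a..b} - N" using False I by auto
        have r: "r x = r2 x" using x by (auto simp: r_def)
        have *: "norm (f y - f x - (y - x) *\<^sub>R g x) \<le> c * \<bar>y - x\<bar>" if "y \<in> k" for y
          using r2[OF x] that I(2,3) unfolding r[symmetric]
          by (metis dist_commute dist_norm mem_ball real_norm_def subsetD)
        \<comment> \<open>The tag lies between the endpoints, so the two errors measured from it add
          up to \<open>c\<close> times the length of \<open>k\<close>.\<close>
        have "measure lborel k *\<^sub>R h x - df k = (f (Inf k) - f x - (Inf k - x) *\<^sub>R g x) - (f (Sup k) - f x - (Sup k - x) *\<^sub>R g x)"
          using False by (simp add: h_def df_def I(7) algebra_simps)
        then have "norm (measure lborel k *\<^sub>R h x - df k) \<le> c * \<bar>Inf k - x\<bar> + c * \<bar>Sup k - x\<bar>"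
          using *[OF I(5)] *[OF I(6)] by (metis norm_triangle_le_diff add_mono)
        also have "\<dots> = c * measure lborel k"
        proof -
          have "Inf k \<le> x" "x \<le> Sup k" using I(1,4) by auto
          then show ?thesis by (simp add: I(7) algebra_simps)
        qed
        finally show ?thesis using False by simp
      qed
      have "norm ((\<Sum>(x,k)\<in>p. measure lborel k *\<^sub>R h x) - (f b - f a)) = norm (\<Sum>(x,k)\<in>p. measure lborel k *\<^sub>R h x - df k)"
        by (simp add: tel[symmetric] sum_subtractf[symmetric] case_prod_unfold)
      also have "\<dots> \<le> (\<Sum>(x,k)\<in>p. if x \<in> N then norm (df k) else c * measure lborel k)"
        using B by (intro sum_norm_le) auto
      also have "\<dots> \<le> (\<Sum>(x,k)\<in>p. (if x \<in> N then norm (df k) else 0) + c * measure lborel k)"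
        using c(1) by (intro sum_mono) auto
      also have "\<dots> = (\<Sum>(x,k)\<in>p1. norm (df k)) + c * (\<Sum>(x,k)\<in>p. measure lborel k)"
        using fp by (simp add: case_prod_unfold sum.distrib sum_distrib_left p1_def sum.inter_filter)
      also have "(\<Sum>(x,k)\<in>p. measure lborel k) = b - a"
        using additive_content_tagged_division[of p a b] p ab by simp
      finally show "norm ((\<Sum>(x,k)\<in>p. measure lborel k *\<^sub>R h x) - (f b - f a)) < e"
        using A c(2) by linarith
    qed
  qed
  then show ?thesis
    by (rule has_integral_spike[OF N, rotated]) (auto simp: h_def)
qed

section \<open>Almost everywhere differentiability\<close>

lemma division_increment_sum:
  fixes f :: "real \<Rightarrow> real"
  assumes d: "d division_of {a..b}" and "a \<le> b"
  shows "(\<Sum>k\<in>d. f (Sup k) - f (Inf k)) = f b - f a"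
proof -
  define g where "g k = (if k = {} then 0 else f (Sup k) - f (Inf k))" for k
  interpret operative_real plus 0 g
    by standard (auto simp: g_def)
  have "sum g d = g (cbox a b)"
    using division[of d a b] d by (simp add: sum_def)
  moreover have "sum g d = (\<Sum>k\<in>d. f (Sup k) - f (Inf k))"
    using d by (intro sum.cong) (auto simp: g_def)
  ultimately show ?thesis using \<open>a \<le> b\<close> by (simp add: g_def)
qed

text \<open>Completing the members of \<open>d2\<close> inside each \<open>i\<close> in
  \<open>d1\<close> to a division of \<open>i\<close> adds finitely many gap intervals. Their total
  length and total increment are the differences of those of \<open>d1\<close> and
  \<open>d2\<close>, so absolute continuity applies to the gaps. Disjointness of \<open>d1\<close>
  keeps the gaps of different \<open>i\<close> apart.\<close>

lemma absolutely_continuous_on_gaps: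
  fixes f :: "real \<Rightarrow> real"
  assumes \<delta>: "\<And>d. d division_of \<Union>d \<Longrightarrow> \<Union>d \<subseteq> S \<Longrightarrow> (\<Sum>k\<in>d. Sup k - Inf k) < \<delta>
        \<Longrightarrow> (\<Sum>k\<in>d. norm (f (Sup k) - f (Inf k))) < \<epsilon>"
    and d1: "d1 division_of \<Union>d1" "pairwise disjnt d1" "\<Union>d1 \<subseteq> S"
    and d2: "d2 division_of \<Union>d2" "\<And>j. j \<in> d2 \<Longrightarrow> \<exists>i\<in>d1. j \<subseteq> i"
    and len: "(\<Sum>k\<in>d1. Sup k - Inf k) - (\<Sum>k\<in>d2. Sup k - Inf k) < \<delta>"
  shows "\<bar>(\<Sum>k\<in>d1. f (Sup k) - f (Inf k)) - (\<Sum>k\<in>d2. f (Sup k) - f (Inf k))\<bar> < \<epsilon>"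
proof -
  define p where "p i = {j \<in> d2. j \<subseteq> i}" for i
  have fin: "finite d1" "finite d2" using d1 d2 by (auto simp: division_of_def)
  have pd: "p i division_of \<Union>(p i)" for i
    by (rule division_of_subset[OF d2(1)]) (auto simp: p_def)
  have "\<exists>r. p i \<subseteq> r \<and> r division_of i" if id1: "i \<in> d1" for i
  proof -
    obtain a b where "i = cbox a b" "i \<noteq> {}" using division_ofD(3,4)[OF d1(1) id1] by blast
    then have i: "{i} division_of i" using division_of_self by blast
    have pi: "\<Union>(p i) \<subseteq> i" by (auto simp: p_def)
    show ?thesis by (rule partial_division_extend[OF pd[of i] i pi]) (intro exI conjI)
  qed
  then obtain r where r: "\<And>i. i \<in> d1 \<Longrightarrow> p i \<subseteq> r i" "\<And>i. i \<in> d1 \<Longrightarrow> r i division_of i" by metis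
  define g where "g i = r i - p i" for i
  define d where "d = (\<Union>i\<in>d1. g i)"
  have fr: "finite (r i)" if "i \<in> d1" for i using r(2)[OF that] by auto
  have sub: "k \<subseteq> i" "k \<noteq> {}" "\<exists>a b. k = cbox a b" if "k \<in> r i" "i \<in> d1" for k i
    using division_ofD(2,3,4)[OF r(2)[OF that(2)] that(1)] by auto
  have disj: "i = i'" if "i \<in> d1" "i' \<in> d1" "k \<in> r i" "k' \<in> r i'" "k \<inter> k' \<noteq> {}" for i i' k k'
  proof (rule ccontr)
    assume "i \<noteq> i'"
    then have "i \<inter> i' = {}" using d1(2) that by (auto simp: pairwise_def disjnt_def)
    then show False using sub(1) that by blast
  qed
  have sumd2: "(\<Sum>k\<in>d2. h k) = (\<Sum>i\<in>d1. \<Sum>k\<in>p i. h k)" for h :: "real set \<Rightarrow> real"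
  proof -
    have d2eq: "d2 = (\<Union>i\<in>d1. p i)" using d2(2) by (auto simp: p_def)
    have "p i \<inter> p i' = {}" if i: "i \<in> d1" "i' \<in> d1" "i \<noteq> i'" for i i'
    proof (rule ccontr)
      assume "p i \<inter> p i' \<noteq> {}"
      then obtain k where "k \<in> p i" "k \<in> p i'" by auto
      then have "k \<in> r i" "k \<in> r i'" using r(1) i by auto
      then show False using disj[OF i(1,2), of k k] sub(2)[of k i] i by auto
    qed
    then show ?thesis unfolding d2eq
      by (intro sum.UNION_disjoint) (use fin in \<open>auto simp: p_def\<close>)
  qed
  have sumd: "(\<Sum>k\<in>d. h k) = (\<Sum>i\<in>d1. \<Sum>k\<in>g i. h k)" for h :: "real set \<Rightarrow> real"
  proof -
    have "g i \<inter> g i' = {}" if i: "i \<in> d1" "i' \<in> d1" "i \<noteq> i'" for i i'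
    proof (rule ccontr)
      assume "g i \<inter> g i' \<noteq> {}"
      then obtain k where "k \<in> r i" "k \<in> r i'" by (auto simp: g_def)
      then show False using disj[OF i(1,2), of k k] sub(2)[of k i] i by auto
    qed
    then show ?thesis unfolding d_def
      by (intro sum.UNION_disjoint) (use fin fr in \<open>auto simp: g_def\<close>)
  qed
  \<comment> \<open>Stated for arbitrary \<open>h\<close>: the identity function gives the total
    length of the gaps, \<open>f\<close> their total increment.\<close>
  have main: "(\<Sum>k\<in>d1. h (Sup k) - h (Inf k)) - (\<Sum>k\<in>d2. h (Sup k) - h (Inf k)) = (\<Sum>k\<in>d. h (Sup k) - h (Inf k))"
    for h :: "real \<Rightarrow> real"
  proof -
    have "h (Sup i) - h (Inf i) - (\<Sum>k\<in>p i. h (Sup k) - h (Inf k)) = (\<Sum>k\<in>g i. h (Sup k) - h (Inf k))"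
      if i: "i \<in> d1" for i
    proof -
      note I = Inf_Sup_division[OF d1(1) i]
      have "(\<Sum>k\<in>r i. h (Sup k) - h (Inf k)) = h (Sup i) - h (Inf i)"
        using r(2)[OF i] I(3,4) division_increment_sum by metis
      then show ?thesis unfolding g_def using sum_diff[OF fr[OF i] r(1)[OF i], of "\<lambda>k. h (Sup k) - h (Inf k)"] by simp
    qed
    then show ?thesis unfolding sumd sumd2 sum_subtractf[symmetric] by (intro sum.cong) auto
  qed
  have dd: "d division_of \<Union>d"
  proof (rule division_ofI)
    show "finite d" using fin fr by (auto simp: d_def g_def)
    show "K \<subseteq> \<Union>d" if "K \<in> d" for K using that by auto
    show "K \<noteq> {}" "\<exists>a b. K = cbox a b" if "K \<in> d" for K using that sub by (auto simp: d_def g_def)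
    show "interior K \<inter> interior K' = {}" if KK: "K \<in> d" "K' \<in> d" "K \<noteq> K'" for K K'
    proof -
      obtain i i' where i: "i \<in> d1" "K \<in> r i" "i' \<in> d1" "K' \<in> r i'" using KK by (auto simp: d_def g_def)
      show ?thesis
      proof (cases "K \<inter> K' = {}")
        case True then show ?thesis using interior_subset by blast
      next
        case False
        then have "i = i'" using disj i by blast
        then show ?thesis using division_ofD(5)[OF r(2)] i KK by blast
      qed
    qed
  qed auto
  have "\<Union>d \<subseteq> S" using sub(1) d1(3) by (fastforce simp: d_def g_def)
  moreover have "(\<Sum>k\<in>d. Sup k - Inf k) < \<delta>" using main[of "\<lambda>x. x"] len by simp
  ultimately have "(\<Sum>k\<in>d. norm (f (Sup k) - f (Inf k))) < \<epsilon>" using \<delta> dd by blast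
  then show ?thesis unfolding main using le_less_trans[OF sum_abs] by auto
qed

lemma disjoint_intervals_division:
  fixes d :: "real set set"
  assumes "finite d" "pairwise disjnt d" "\<And>k. k \<in> d \<Longrightarrow> \<exists>s t. s < t \<and> k = {s..t}"
  shows "d division_of \<Union>d"
proof (rule division_ofI)
  show "interior K \<inter> interior K' = {}" if "K \<in> d" "K' \<in> d" "K \<noteq> K'" for K K'
    using assms(2) that interior_subset unfolding pairwise_def disjnt_def by blast
  show "\<exists>a b. K = cbox a b" "K \<noteq> {}" if "K \<in> d" for K using assms(3)[OF that] by auto
qed (use assms in auto)

text \<open>Vitali's covering theorem yields countably many disjoint intervals that miss only a null
  set of \<open>E\<close>; finitely many of them already miss less than \<open>\<epsilon>\<close>,
  by continuity of the measure along the decreasing remainders \<open>A n\<close>.\<close>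

lemma Vitali_finite_intervals:
  fixes E U :: "real set"
  assumes E: "E \<in> lmeasurable" and U: "open U" "E \<subseteq> U" and "\<epsilon> > 0"
    and P: "\<And>x \<eta>. x \<in> E \<Longrightarrow> \<eta> > 0 \<Longrightarrow> \<exists>s t. s < x \<and> x < t \<and> t - s < \<eta> \<and> P s t"
  obtains d where "d division_of \<Union>d" "pairwise disjnt d" "\<And>k. k \<in> d \<Longrightarrow> P (Inf k) (Sup k) \<and> Inf k < Sup k"
    "\<Union>d \<subseteq> U" "measure lebesgue (E - \<Union>d) < \<epsilon>"
proof -
  define K where "K = {(s,t). s < t \<and> P s t \<and> {s..t} \<subseteq> U}"
  define a r where "a q = (fst q + snd q) / 2" and "r q = (snd q - fst q) / 2" for q :: "real \<times> real"
  have cb: "cball (a q) (r q) = {fst q..snd q}" for q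
    unfolding cball_eq_atLeastAtMost a_def r_def by (simp add: field_simps)
  have cov: "\<exists>i. i \<in> K \<and> x \<in> cball (a i) (r i) \<and> r i < \<eta>" if x: "x \<in> E" and \<eta>: "\<eta> > 0" for x \<eta>
  proof -
    obtain e where e: "e > 0" "ball x e \<subseteq> U" using U x by (meson open_contains_ball subsetD)
    obtain s t where st: "s < x" "x < t" "t - s < min e \<eta>" "P s t"
      using P[OF x, of "min e \<eta>"] e \<eta> by auto
    have "{s..t} \<subseteq> ball x e" using st by (auto simp: dist_real_def)
    then show ?thesis using st e \<eta> by (intro exI[of _ "(s,t)"]) (auto simp: K_def cb, auto simp: r_def)
  qed
  have r0: "r i > 0" if "i \<in> K" for i using that by (auto simp: K_def r_def)
  obtain C where C: "countable C" "C \<subseteq> K"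
     "pairwise (\<lambda>i j. disjnt (cball (a i) (r i)) (cball (a j) (r j))) C"
     "negligible (E - (\<Union>i \<in> C. cball (a i) (r i)))"
    by (rule Vitali_covering_theorem_cballs[of K r E a, OF r0 cov])
  define Cn where "Cn n = {i \<in> C. to_nat_on C i \<le> n}" for n
  have fC: "finite (Cn n)" for n
  proof -
    have "inj_on (to_nat_on C) (Cn n)" using inj_on_to_nat_on[OF C(1)] by (rule inj_on_subset) (auto simp: Cn_def)
    moreover have "to_nat_on C ` Cn n \<subseteq> {..n}" by (auto simp: Cn_def)
    ultimately show ?thesis by (meson finite_atMost finite_imageD finite_subset)
  qed
  define A where "A n = E - (\<Union>i\<in>Cn n. {fst i..snd i})" for n
  have "(\<lambda>n. measure lebesgue (A n)) \<longlonglongrightarrow> measure lebesgue (\<Inter>n. A n)"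
  proof (rule Lim_measure_decseq)
    show "range A \<subseteq> sets lebesgue" using E fC by (auto simp: A_def intro!: sets.Diff sets.finite_UN)
    show "decseq A" by (auto simp: A_def Cn_def decseq_def)
    show "emeasure lebesgue (A i) \<noteq> \<infinity>" for i
    proof -
      have "emeasure lebesgue (A i) \<le> emeasure lebesgue E"
        using E by (intro emeasure_mono) (auto simp: A_def)
      then show ?thesis using E by (auto simp: fmeasurable_def top_unique)
    qed
  qed
  moreover have "(\<Inter>n. A n) = E - (\<Union>i \<in> C. cball (a i) (r i))"
    by (auto simp: A_def Cn_def cb)
  ultimately have "(\<lambda>n. measure lebesgue (A n)) \<longlonglongrightarrow> 0"
    using C(4) by (simp add: negligible_iff_measure)
  then have "eventually (\<lambda>n. measure lebesgue (A n) < \<epsilon>) sequentially"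
    using \<open>\<epsilon> > 0\<close> by (simp add: order_tendsto_iff)
  then obtain n where n: "measure lebesgue (A n) < \<epsilon>" by (auto simp: eventually_sequentially)
  define d where "d = (\<lambda>i. {fst i..snd i}) ` Cn n"
  have st: "fst i < snd i" "P (fst i) (snd i)" "{fst i..snd i} \<subseteq> U" if "i \<in> Cn n" for i
    using that C(2) by (force simp: Cn_def K_def)+
  have disj: "pairwise disjnt d"
  proof (rule pairwiseI)
    fix k l assume "k \<in> d" "l \<in> d" "k \<noteq> l"
    then obtain i j where ij: "i \<in> Cn n" "j \<in> Cn n" "k = {fst i..snd i}" "l = {fst j..snd j}" by (auto simp: d_def)
    then have "i \<in> C" "j \<in> C" "i \<noteq> j" using \<open>k \<noteq> l\<close> by (auto simp: Cn_def)
    then show "disjnt k l" using C(3) ij(3,4) unfolding pairwise_def cb by blast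
  qed
  show thesis
  proof
    show "d division_of \<Union>d"
    proof (rule disjoint_intervals_division[OF _ disj])
      show "\<exists>s t. s < t \<and> k = {s..t}" if "k \<in> d" for k
        using that st by (force simp: d_def simp del: Icc_eq_Icc)
    qed (use fC in \<open>auto simp: d_def\<close>)
    show "P (Inf k) (Sup k) \<and> Inf k < Sup k" if "k \<in> d" for k
      using that st by (auto simp: d_def less_imp_le)
    show "\<Union>d \<subseteq> U" unfolding d_def by (rule Sup_least) (use st(3) in blast)
    show "measure lebesgue (E - \<Union>d) < \<epsilon>" using n by (simp add: A_def d_def)
  qed (rule disj)
qed

text \<open>The strict inequalities make the following sets countable intersections of open sets.\<close>

definition below_slopes :: "(real \<Rightarrow> real) \<Rightarrow> real \<Rightarrow> real \<Rightarrow> real \<Rightarrow> real set" where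
  "below_slopes f a b p = {x. \<forall>\<eta>>0. \<exists>s t. a < s \<and> s < x \<and> x < t \<and> t < b \<and> t - s < \<eta> \<and> f t - f s < p * (t - s)}"

definition above_slopes :: "(real \<Rightarrow> real) \<Rightarrow> real \<Rightarrow> real \<Rightarrow> real \<Rightarrow> real set" where
  "above_slopes f a b q = {x. \<forall>\<eta>>0. \<exists>s t. a < s \<and> s < x \<and> x < t \<and> t < b \<and> t - s < \<eta> \<and> f t - f s > q * (t - s)}"

lemma above_slopes_uminus: "above_slopes (\<lambda>x. - f x) a b q = below_slopes f a b (- q)"
  unfolding above_slopes_def below_slopes_def by (simp add: algebra_simps)

lemma slopes_subset: "below_slopes f a b p \<subseteq> {a<..<b}" "above_slopes f a b p \<subseteq> {a<..<b}"
proof -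
  show "below_slopes f a b p \<subseteq> {a<..<b}"
  proof
    fix x assume "x \<in> below_slopes f a b p"
    then obtain s t where "a < s \<and> s < x \<and> x < t \<and> t < b" unfolding below_slopes_def using zero_less_one by blast
    then show "x \<in> {a<..<b}" by auto
  qed
  show "above_slopes f a b p \<subseteq> {a<..<b}"
  proof
    fix x assume "x \<in> above_slopes f a b p"
    then obtain s t where "a < s \<and> s < x \<and> x < t \<and> t < b" unfolding above_slopes_def using zero_less_one by blast
    then show "x \<in> {a<..<b}" by auto
  qed
qed

lemma above_slopes_lmeasurable: "above_slopes f a b q \<in> lmeasurable"
proof -
  define W where "W n = (\<Union>(s,t)\<in>{(s,t). a < s \<and> t < b \<and> t - s < inverse (Suc n) \<and> f t - f s > q * (t - s)}. {s<..<t})" for n :: nat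
  have "above_slopes f a b q = (\<Inter>n. W n)"
  proof (intro equalityI subsetI)
    fix x assume x: "x \<in> above_slopes f a b q"
    show "x \<in> (\<Inter>n. W n)"
    proof clarify
      fix n
      have "inverse (real (Suc n)) > 0" by simp
      then obtain s t where "a < s" "s < x" "x < t" "t < b" "t - s < inverse (real (Suc n))" "f t - f s > q * (t - s)"
        using x unfolding above_slopes_def by blast
      then show "x \<in> W n" unfolding W_def by (intro UN_I[of "(s,t)"]) auto
    qed
  next
    fix x assume x: "x \<in> (\<Inter>n. W n)"
    show "x \<in> above_slopes f a b q" unfolding above_slopes_def
    proof clarify
      fix \<eta> :: real assume "\<eta> > 0"
      then obtain n where n: "inverse (real (Suc n)) < \<eta>" using reals_Archimedean by blast
      have "x \<in> W n" using x by blast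
      then obtain s t where "a < s" "s < x" "x < t" "t < b" "t - s < inverse (real (Suc n))" "f t - f s > q * (t - s)"
        unfolding W_def by auto
      then show "\<exists>s t. a < s \<and> s < x \<and> x < t \<and> t < b \<and> t - s < \<eta> \<and> q * (t - s) < f t - f s"
        using n by (intro exI[of _ s] exI[of _ t]) auto
    qed
  qed
  moreover have "open (W n)" for n unfolding W_def by auto
  ultimately have "above_slopes f a b q \<in> sets lebesgue" by auto
  moreover have "bounded {a<..<b}" using bounded_box[of a b] by simp
  ultimately show ?thesis
    using bounded_set_imp_lmeasurable[OF bounded_subset[OF _ slopes_subset(2)]] by metis
qed

lemma below_slopes_lmeasurable: "below_slopes f a b p \<in> lmeasurable"
  using above_slopes_lmeasurable[of "\<lambda>x. - f x" a b "- p"] by (simp add: above_slopes_uminus)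

section \<open>Exceptional slopes occur only on null sets\<close>

lemma lmeasurable_outer_open:
  assumes E: "E \<in> lmeasurable" "E \<subseteq> V" "open V" and e: "e > (0::real)"
  obtains U where "open U" "E \<subseteq> U" "U \<subseteq> V" "U \<in> lmeasurable" "measure lebesgue (U - E) < e"
proof -
  obtain U where U: "open U" "E \<subseteq> U" "U - E \<in> lmeasurable" "emeasure lebesgue (U - E) < ennreal e"
    using sets_lebesgue_outer_open[of E e] E e by (auto simp: fmeasurableD)
  have "measure lebesgue (U - E) < e"
    using U by (metis emeasure_eq_measure2 ennreal_less_iff measure_nonneg)
  moreover have UV: "U \<inter> V - E \<in> lmeasurable"
  proof (rule fmeasurableI2[OF U(3)])
    have "U \<inter> V \<in> sets lebesgue" using U(1) E(3) by auto
    then show "U \<inter> V - E \<in> sets lebesgue" using E(1) by (intro sets.Diff) (auto simp: fmeasurableD)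
  qed auto
  moreover have "measure lebesgue (U \<inter> V - E) \<le> measure lebesgue (U - E)"
    by (rule measure_mono_fmeasurable) (use UV U(3) in \<open>auto simp: fmeasurableD\<close>)
  moreover have "U \<inter> V \<in> lmeasurable"
  proof -
    have "U \<inter> V = (U \<inter> V - E) \<union> E" using U E by auto
    then show ?thesis using UV E(1) by (metis fmeasurable.Un)
  qed
  ultimately show thesis using U E by (intro that[of "U \<inter> V"]) auto
qed

text \<open>The classical argument for monotone functions compares two nested Vitali covers. Here absolute
  continuity takes the place of monotonicity: up to a set of small measure both covers fill \<open>E\<close>, so
  the total increments of \<open>f\<close> over them almost agree.\<close>

lemma negligible_below_above_slopes:
  fixes f :: "real \<Rightarrow> real"
  assumes ac: "absolutely_continuous_on {a..b} f" and "p < q"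
  shows "negligible (below_slopes f a b p \<inter> above_slopes f a b q)"
proof -
  define E where "E = below_slopes f a b p \<inter> above_slopes f a b q"
  define m where "m = measure lebesgue E"
  have E: "E \<in> lmeasurable"
    unfolding E_def by (intro fmeasurable.Int below_slopes_lmeasurable above_slopes_lmeasurable)
  have Eab: "E \<subseteq> {a<..<b}" using slopes_subset(1)[of f a b p] by (auto simp: E_def)
  have bound: "(q - p) * m \<le> (\<bar>p\<bar> + \<bar>q - p\<bar> + 1) * e" if "e > 0" for e
  proof -
    obtain \<delta>' where \<delta>': "\<delta>' > 0" "\<And>d. d division_of \<Union>d \<Longrightarrow> \<Union>d \<subseteq> {a..b} \<Longrightarrow> (\<Sum>k\<in>d. Sup k - Inf k) < \<delta>'
        \<Longrightarrow> (\<Sum>k\<in>d. norm (f (Sup k) - f (Inf k))) < e"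
      using ac \<open>e > 0\<close> unfolding absolutely_continuous_on_def by meson
    \<comment> \<open>As \<open>\<delta>\<close> is also at most \<open>e\<close>, the length defect
      \<open>l1 - l2\<close> serves twice: it permits the use of absolute continuity and it bounds
      \<open>p * (l1 - l2)\<close> by a multiple of \<open>e\<close>.\<close>
    define \<delta> where "\<delta> = min \<delta>' e"
    have \<delta>: "\<delta> > 0" "\<delta> \<le> \<delta>'" "\<delta> \<le> e" using \<delta>' \<open>e > 0\<close> by (auto simp: \<delta>_def)
    obtain U where U: "open U" "E \<subseteq> U" "U \<subseteq> {a<..<b}" "U \<in> lmeasurable" "measure lebesgue (U - E) < \<delta> / 4"
      using lmeasurable_outer_open[OF E Eab, of "\<delta> / 4"] \<delta> by auto
    obtain d1 where d1: "d1 division_of \<Union>d1" "pairwise disjnt d1"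
        "\<And>k. k \<in> d1 \<Longrightarrow> f (Sup k) - f (Inf k) < p * (Sup k - Inf k) \<and> Inf k < Sup k"
        "\<Union>d1 \<subseteq> U" "measure lebesgue (E - \<Union>d1) < \<delta> / 4"
    proof (rule Vitali_finite_intervals[OF E U(1,2), where \<epsilon> = "\<delta> / 4" and P = "\<lambda>s t. f t - f s < p * (t - s)"])
      show "\<exists>s t. s < x \<and> x < t \<and> t - s < \<eta> \<and> f t - f s < p * (t - s)" if "x \<in> E" "\<eta> > 0" for x \<eta>
        using that unfolding E_def below_slopes_def by blast
    qed (use \<delta> in auto)
    have fin1: "finite d1" using d1(1) by auto
    \<comment> \<open>The second cover needs an open set in which small intervals stay inside one
      member of \<open>d1\<close>, hence the interiors; the endpoints dropped here form a null
      set.\<close>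
    define W where "W = (\<Union>k\<in>d1. {Inf k<..<Sup k})"
    have oW: "open W" by (auto simp: W_def)
    have Wlm: "W \<in> sets lebesgue" using oW by auto
    have EW: "E \<inter> W \<in> lmeasurable" using E Wlm by (rule fmeasurable_Int_fmeasurable)
    obtain d2 where d2: "d2 division_of \<Union>d2" "pairwise disjnt d2"
        "\<And>k. k \<in> d2 \<Longrightarrow> (f (Sup k) - f (Inf k) > q * (Sup k - Inf k) \<and> (\<exists>i\<in>d1. {Inf k..Sup k} \<subseteq> i)) \<and> Inf k < Sup k"
        "\<Union>d2 \<subseteq> W" "measure lebesgue (E \<inter> W - \<Union>d2) < \<delta> / 4"
    proof (rule Vitali_finite_intervals[OF EW oW, where \<epsilon> = "\<delta> / 4"
          and P = "\<lambda>s t. f t - f s > q * (t - s) \<and> (\<exists>i\<in>d1. {s..t} \<subseteq> i)"])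
      show "\<exists>s t. s < x \<and> x < t \<and> t - s < \<eta> \<and> q * (t - s) < f t - f s \<and> (\<exists>i\<in>d1. {s..t} \<subseteq> i)"
        if x: "x \<in> E \<inter> W" and "\<eta> > 0" for x \<eta>
      proof -
        obtain k where k: "k \<in> d1" "Inf k < x" "x < Sup k" using x by (auto simp: W_def)
        define \<eta>' where "\<eta>' = min \<eta> (min (x - Inf k) (Sup k - x))"
        have "\<eta>' > 0" using k \<open>\<eta> > 0\<close> by (auto simp: \<eta>'_def)
        then obtain s t where st: "s < x" "x < t" "t - s < \<eta>'" "f t - f s > q * (t - s)"
          using x unfolding E_def above_slopes_def by blast
        have "{s..t} \<subseteq> {Inf k..Sup k}" using st by (auto simp: \<eta>'_def)
        then have "{s..t} \<subseteq> k" using Inf_Sup_division(4)[OF d1(1) k(1)] by simp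
        then show ?thesis using st k(1) by (auto simp: \<eta>'_def)
      qed
    qed (use \<delta> in auto)
    have fin2: "finite d2" using d2(1) by auto
    define l1 where "l1 = (\<Sum>k\<in>d1. Sup k - Inf k)"
    define l2 where "l2 = (\<Sum>k\<in>d2. Sup k - Inf k)"
    have lm: "\<Union>d1 \<in> lmeasurable" "\<Union>d2 \<in> lmeasurable"
      using d1(1) d2(1) lmeasurable_division by blast+
    have l1: "l1 = measure lebesgue (\<Union>d1)"
      unfolding l1_def content_division[OF d1(1), symmetric]
      by (intro sum.cong refl) (simp add: measure_division_interval[OF d1(1)])
    have l2: "l2 = measure lebesgue (\<Union>d2)"
      unfolding l2_def content_division[OF d2(1), symmetric]
      by (intro sum.cong refl) (simp add: measure_division_interval[OF d2(1)])
    have d2sub: "\<exists>i\<in>d1. j \<subseteq> i" if "j \<in> d2" for j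
      using d2(3)[OF that] Inf_Sup_division(4)[OF d2(1) that] by auto
    have d21: "\<Union>d2 \<subseteq> \<Union>d1" using d2sub by blast
    have null: "negligible (\<Union>d1 - W)"
    proof (rule negligible_subset)
      show "negligible (\<Union>k\<in>d1. {Inf k, Sup k})" using fin1 by auto
      show "\<Union>d1 - W \<subseteq> (\<Union>k\<in>d1. {Inf k, Sup k})"
      proof
        fix x assume "x \<in> \<Union>d1 - W"
        then obtain k where k: "k \<in> d1" "x \<in> k" "x \<notin> {Inf k<..<Sup k}" by (auto simp: W_def)
        then have "x \<in> {Inf k, Sup k}" using Inf_Sup_division(4)[OF d1(1) k(1)]
          by (metis atLeastAtMost_iff greaterThanLessThan_iff insert_iff order_le_less)
        then show "x \<in> (\<Union>k\<in>d1. {Inf k, Sup k})" using k(1) by blast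
      qed
    qed
    have cover: "E \<inter> \<Union>d1 - \<Union>d2 \<subseteq> (E \<inter> W - \<Union>d2) \<union> (\<Union>d1 - W)" by auto
    have mE1: "measure lebesgue (E \<inter> \<Union>d1 - \<Union>d2) < \<delta> / 4"
    proof -
      have "measure lebesgue (E \<inter> \<Union>d1 - \<Union>d2) \<le> measure lebesgue ((E \<inter> W - \<Union>d2) \<union> (\<Union>d1 - W))"
        by (rule measure_mono_fmeasurable[OF cover])
           (use E EW lm Wlm in \<open>auto simp: fmeasurableD intro!: fmeasurable.Un fmeasurable.Diff fmeasurable_Diff\<close>)
      also have "\<dots> \<le> measure lebesgue (E \<inter> W - \<Union>d2) + measure lebesgue (\<Union>d1 - W)"
        by (rule measure_Un_le) (use EW lm Wlm in \<open>auto simp: fmeasurableD\<close>)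
      also have "measure lebesgue (\<Union>d1 - W) = 0" using null by (simp add: negligible_iff_measure)
      finally show ?thesis using d2(5) by simp
    qed
    have len: "l1 - l2 < \<delta>"
    proof -
      have "l1 - l2 = measure lebesgue (\<Union>d1 - \<Union>d2)"
        unfolding l1 l2 by (rule measurable_measure_Diff[symmetric]) (use lm d21 in \<open>auto simp: fmeasurableD\<close>)
      also have "\<dots> \<le> measure lebesgue ((U - E) \<union> (E \<inter> \<Union>d1 - \<Union>d2))"
        by (rule measure_mono_fmeasurable)
           (use U E lm d1(4) in \<open>auto simp: fmeasurableD intro!: fmeasurable.Un fmeasurable.Diff fmeasurable.Int\<close>)
      also have "\<dots> \<le> measure lebesgue (U - E) + measure lebesgue (E \<inter> \<Union>d1 - \<Union>d2)"
        by (rule measure_Un_le) (use U E lm in \<open>auto simp: fmeasurableD\<close>)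
      finally show ?thesis using U(5) mE1 \<delta>(1) by simp
    qed
    have mle: "m \<le> \<delta> / 2 + l2"
    proof -
      have "m \<le> measure lebesgue ((E - \<Union>d1) \<union> ((E \<inter> \<Union>d1 - \<Union>d2) \<union> \<Union>d2))"
        unfolding m_def
        by (rule measure_mono_fmeasurable)
           (use E lm in \<open>auto simp: fmeasurableD intro!: fmeasurable.Un fmeasurable.Diff fmeasurable.Int\<close>)
      also have "\<dots> \<le> measure lebesgue (E - \<Union>d1) + measure lebesgue ((E \<inter> \<Union>d1 - \<Union>d2) \<union> \<Union>d2)"
        by (rule measure_Un_le) (use E lm in \<open>auto simp: fmeasurableD\<close>)
      also have "measure lebesgue ((E \<inter> \<Union>d1 - \<Union>d2) \<union> \<Union>d2) \<le> measure lebesgue (E \<inter> \<Union>d1 - \<Union>d2) + l2"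
        unfolding l2 by (rule measure_Un_le) (use E lm in \<open>auto simp: fmeasurableD\<close>)
      finally show ?thesis using d1(5) mE1 by simp
    qed
    have l20: "l2 \<ge> 0" by (simp add: l2)
    have l21: "l2 \<le> l1" unfolding l1 l2 by (rule measure_mono_fmeasurable[OF d21]) (use lm in \<open>auto simp: fmeasurableD\<close>)
    have gaps: "\<bar>(\<Sum>k\<in>d1. f (Sup k) - f (Inf k)) - (\<Sum>k\<in>d2. f (Sup k) - f (Inf k))\<bar> < e"
    proof (rule absolutely_continuous_on_gaps[of "{a..b}" \<delta>'])
      show "(\<Sum>k\<in>d1. Sup k - Inf k) - (\<Sum>k\<in>d2. Sup k - Inf k) < \<delta>'"
        using len \<delta> by (simp add: l1_def l2_def)
      show "\<Union>d1 \<subseteq> {a..b}" using d1(4) U(3) greaterThanLessThan_subseteq_atLeastAtMost_iff[of a b a b] by blast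
    qed (use d1 d2 d2sub \<delta>' in auto)
    have "(\<Sum>k\<in>d1. f (Sup k) - f (Inf k)) \<le> p * l1"
      unfolding l1_def sum_distrib_left by (intro sum_mono) (use d1(3) in force)
    moreover have "(\<Sum>k\<in>d2. f (Sup k) - f (Inf k)) \<ge> q * l2"
      unfolding l2_def sum_distrib_left by (intro sum_mono) (use d2(3) in force)
    \<comment> \<open>A rise of at least \<open>q * l2\<close> on \<open>d2\<close> and of at most
      \<open>p * l1\<close> on the almost equal set covered by \<open>d1\<close> forces
      \<open>l2\<close>, hence the measure of \<open>E\<close>, to be of order
      \<open>e\<close>.\<close>
    ultimately have "q * l2 - p * l1 < e" using gaps by linarith
    then have 1: "(q - p) * l2 < e + p * (l1 - l2)" by (simp add: algebra_simps)
    have 2: "p * (l1 - l2) \<le> \<bar>p\<bar> * e"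
      using len l21 \<delta>(3) by (intro mult_mono) auto
    have "(q - p) * m \<le> (q - p) * (\<delta> / 2 + l2)" using mle \<open>p < q\<close> by (intro mult_left_mono) auto
    also have "\<dots> = (q - p) * (\<delta> / 2) + (q - p) * l2" by (simp add: algebra_simps)
    also have "(q - p) * (\<delta> / 2) \<le> \<bar>q - p\<bar> * e" using \<delta> \<open>p < q\<close> by (intro mult_mono) auto
    finally show ?thesis using 1 2 by (simp add: algebra_simps)
  qed
  have "(q - p) * m \<le> 0"
  proof (rule field_le_epsilon)
    fix e :: real assume "e > 0"
    then show "(q - p) * m \<le> 0 + e"
      using bound[of "e / (\<bar>p\<bar> + \<bar>q - p\<bar> + 1)"] by (simp add: divide_pos_pos add_nonneg_pos)
  qed
  then have "m = 0" using \<open>p < q\<close> by (metis diff_gt_0_iff_gt m_def measure_nonneg mult_le_0_iff not_less order_antisym)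
  then show ?thesis using E by (simp add: negligible_iff_measure E_def m_def)
qed

text \<open>A Vitali cover by chords of slope above \<open>n\<close> has a total increment of at
  least \<open>n\<close> times its length, while absolute continuity keeps that increment below 1
  near any given point. So the length of the cover is below \<open>1 / n\<close>.\<close>

lemma negligible_all_above_slopes:
  fixes f :: "real \<Rightarrow> real"
  assumes ac: "absolutely_continuous_on {a..b} f"
  shows "negligible (\<Inter>n::nat. above_slopes f a b (real n))"
proof -
  define E where "E = (\<Inter>n::nat. above_slopes f a b (real n))"
  have Esub: "E \<subseteq> above_slopes f a b (real n)" for n by (auto simp: E_def)
  have "E \<in> sets lebesgue" unfolding E_def using above_slopes_lmeasurable by (auto simp: fmeasurableD)
  then have E: "E \<in> lmeasurable"
    using fmeasurableI2[OF above_slopes_lmeasurable Esub] by blast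
  have Eab: "E \<subseteq> {a<..<b}" using Esub[of 0] slopes_subset by blast
  obtain \<delta> where \<delta>: "\<delta> > 0" "\<And>d. d division_of \<Union>d \<Longrightarrow> \<Union>d \<subseteq> {a..b} \<Longrightarrow> (\<Sum>k\<in>d. Sup k - Inf k) < \<delta>
        \<Longrightarrow> (\<Sum>k\<in>d. norm (f (Sup k) - f (Inf k))) < 1"
    using ac zero_less_one unfolding absolutely_continuous_on_def by meson
  have "negligible E"
    unfolding locally_negligible_alt[of E]
  proof (intro ballI)
    fix x assume "x \<in> E"
    \<comment> \<open>Every disjoint family in \<open>V\<close> has total length at most
      \<open>2 * \<delta> / 3\<close>, so the increment bound applies to all of them at
      once.\<close>
    define V where "V = {x - \<delta>/3<..<x + \<delta>/3} \<inter> {a<..<b}"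
    have oV: "open V" by (auto simp: V_def)
    have EV: "E \<inter> V \<in> lmeasurable" using E oV by (intro fmeasurable_Int_fmeasurable) auto
    define m where "m = measure lebesgue (E \<inter> V)"
    have bound: "m < inverse (real n) + inverse (real n)" if "n > 0" for n
    proof -
      have in0: "inverse (real n) > 0" using that by simp
      obtain d where d: "d division_of \<Union>d" "pairwise disjnt d"
        "\<And>k. k \<in> d \<Longrightarrow> f (Sup k) - f (Inf k) > real n * (Sup k - Inf k) \<and> Inf k < Sup k"
        "\<Union>d \<subseteq> V" "measure lebesgue (E \<inter> V - \<Union>d) < inverse (real n)"
      proof (rule Vitali_finite_intervals[OF EV oV _ in0, where P = "\<lambda>s t. f t - f s > real n * (t - s)"])
        show "\<exists>s t. s < x \<and> x < t \<and> t - s < \<eta> \<and> f t - f s > real n * (t - s)" if "x \<in> E \<inter> V" "\<eta> > 0" for x \<eta>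
          using that Esub[of n] unfolding above_slopes_def by blast
      qed auto
      define l where "l = (\<Sum>k\<in>d. Sup k - Inf k)"
      have lm: "\<Union>d \<in> lmeasurable" using d(1) lmeasurable_division by blast
      have l: "l = measure lebesgue (\<Union>d)"
        unfolding l_def content_division[OF d(1), symmetric]
        by (intro sum.cong refl) (simp add: measure_division_interval[OF d(1)])
      also have "\<dots> \<le> measure lebesgue {x - \<delta>/3..x + \<delta>/3}"
        by (rule measure_mono_fmeasurable) (use d(4) lm in \<open>auto simp: V_def fmeasurableD lmeasurable_interval\<close>)
      finally have "l < \<delta>" using \<delta>(1) by simp
      then have "(\<Sum>k\<in>d. norm (f (Sup k) - f (Inf k))) < 1"
        using \<delta>(2)[OF d(1)] d(4) by (force simp: V_def l_def)
      moreover have "real n * l \<le> (\<Sum>k\<in>d. norm (f (Sup k) - f (Inf k)))"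
        unfolding l_def sum_distrib_left by (intro sum_mono) (use d(3) in force)
      ultimately have "real n * l < 1" by linarith
      then have "l < inverse (real n)" using that by (simp add: field_simps)
      moreover have "m \<le> measure lebesgue (E \<inter> V - \<Union>d) + l"
      proof -
        have "m \<le> measure lebesgue ((E \<inter> V - \<Union>d) \<union> \<Union>d)" unfolding m_def
          by (rule measure_mono_fmeasurable)
             (use EV lm in \<open>auto simp: fmeasurableD intro!: fmeasurable.Un fmeasurable.Diff\<close>)
        also have "\<dots> \<le> measure lebesgue (E \<inter> V - \<Union>d) + l"
          unfolding l by (rule measure_Un_le) (use EV lm in \<open>auto simp: fmeasurableD\<close>)
        finally show ?thesis .
      qed
      ultimately show ?thesis using d(5) by linarith
    qed
    have "(\<lambda>n. inverse (real n) + inverse (real n)) \<longlonglongrightarrow> 0 + 0"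
      by (intro tendsto_add lim_inverse_n)
    then have "m \<le> 0 + 0"
      by (rule LIMSEQ_le_const) (use bound in \<open>auto intro!: exI[of _ 1] less_imp_le\<close>)
    then have "m = 0" by (simp add: m_def order_antisym)
    then have "negligible (E \<inter> V)" using EV by (simp add: negligible_iff_measure m_def)
    moreover have "x \<in> V" using \<open>x \<in> E\<close> Eab \<delta>(1) by (auto simp: V_def)
    ultimately show "\<exists>U. openin (top_of_set E) U \<and> x \<in> U \<and> negligible U"
      using oV \<open>x \<in> E\<close> by (intro exI[of _ "E \<inter> V"]) auto
  qed
  then show ?thesis by (simp add: E_def)
qed

text \<open>\<open>L\<close> is the upper limit of the slopes of chords straddling \<open>x\<close>.
  The hypotheses make it finite and exclude a smaller lower limit, so these slopes converge to
  \<open>L\<close>. Continuity then lets one endpoint of the chord move into \<open>x\<close>, which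
  turns them into difference quotients at \<open>x\<close>.\<close>

lemma differentiable_if_slopes_converge:
  fixes f :: "real \<Rightarrow> real"
  assumes cont: "continuous_on {a..b} f" and x: "a < x" "x < b"
    and pq: "\<And>p q. p \<in> \<rat> \<Longrightarrow> q \<in> \<rat> \<Longrightarrow> p < q \<Longrightarrow> x \<notin> below_slopes f a b p \<inter> above_slopes f a b q"
    and up: "x \<notin> above_slopes f a b (real n)" and low: "x \<notin> below_slopes f a b (- real m)"
  shows "f differentiable (at x)"
proof -
  define Q where "Q = {q. x \<in> above_slopes f a b q}"
  have mono: "q' \<in> Q" if qQ: "q \<in> Q" "q' \<le> q" for q q'
    unfolding Q_def above_slopes_def mem_Collect_eq
  proof (intro allI impI)
    fix \<eta> :: real assume "\<eta> > 0"
    then obtain s t where st: "a < s" "s < x" "x < t" "t < b" "t - s < \<eta>" "f t - f s > q * (t - s)"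
      using qQ(1) unfolding Q_def above_slopes_def by blast
    have "q' * (t - s) \<le> q * (t - s)" using st qQ by (intro mult_right_mono) auto
    then have "q' * (t - s) < f t - f s" using st(6) by linarith
    then show "\<exists>s t. a < s \<and> s < x \<and> x < t \<and> t < b \<and> t - s < \<eta> \<and> q' * (t - s) < f t - f s"
      using st by blast
  qed
  have upb: "q < real n" if "q \<in> Q" for q
    using mono[OF that, of "real n"] up by (force simp: Q_def)
  \<comment> \<open>Near \<open>x\<close> all straddling slopes are at least
    \<open>- real m\<close>, hence strictly above \<open>- real m - 1\<close>. This makes
    \<open>Q\<close> non-empty and its supremum meaningful.\<close>
  have ne: "- real m - 1 \<in> Q"
    unfolding Q_def above_slopes_def mem_Collect_eq
  proof (intro allI impI)
    fix \<eta>' :: real assume "\<eta>' > 0"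
    obtain \<eta> where \<eta>: "\<eta> > 0" "\<And>s t. a < s \<Longrightarrow> s < x \<Longrightarrow> x < t \<Longrightarrow> t < b \<Longrightarrow> t - s < \<eta> \<Longrightarrow> \<not> f t - f s < - real m * (t - s)"
      using low unfolding below_slopes_def by blast
    define h where "h = min (min \<eta> \<eta>') (min (x - a) (b - x)) / 3"
    have h: "h > 0" "h + h < \<eta>" "h + h < \<eta>'" "h < x - a" "h < b - x"
      using \<eta>(1) \<open>\<eta>' > 0\<close> x by (auto simp: h_def min_def)
    have "\<not> f (x + h) - f (x - h) < - real m * ((x + h) - (x - h))"
      by (rule \<eta>(2)) (use h in auto)
    then have "(- real m - 1) * ((x + h) - (x - h)) < f (x + h) - f (x - h)"
      using h(1) by (simp add: algebra_simps)
    then show "\<exists>s t. a < s \<and> s < x \<and> x < t \<and> t < b \<and> t - s < \<eta>' \<and> (- real m - 1) * (t - s) < f t - f s"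
      using h by (intro exI[of _ "x - h"] exI[of _ "x + h"]) auto
  qed
  define L where "L = Sup Q"
  have bdd: "bdd_above Q" using upb by (meson bdd_above.I less_imp_le)
  have "(f has_derivative (\<lambda>h. h * L)) (at x)"
    unfolding has_derivative_at_alt
  proof (intro conjI allI impI)
    show "bounded_linear (\<lambda>h. h * L)" by (rule bounded_linear_mult_left)
    fix e :: real assume "e > 0"
    have "L + e \<notin> Q" using cSup_upper[OF _ bdd] \<open>e > 0\<close> by (force simp: L_def)
    then obtain \<eta>1 where \<eta>1: "\<eta>1 > 0" "\<And>s t. a < s \<Longrightarrow> s < x \<Longrightarrow> x < t \<Longrightarrow> t < b \<Longrightarrow> t - s < \<eta>1 \<Longrightarrow> \<not> f t - f s > (L + e) * (t - s)"
      unfolding Q_def above_slopes_def by blast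
    \<comment> \<open>Since \<open>pq\<close> speaks of rational slopes only, two rationals are
      inserted between \<open>L - e\<close> and \<open>L\<close>.\<close>
    have "x \<notin> below_slopes f a b (L - e)"
    proof
      assume xb: "x \<in> below_slopes f a b (L - e)"
      obtain p where p: "p \<in> \<rat>" "L - e < p" "p < L" using Rats_dense_in_real[of "L - e" L] \<open>e > 0\<close> by auto
      obtain q where q: "q \<in> \<rat>" "p < q" "q < L" using Rats_dense_in_real[OF p(3)] by auto
      obtain q' where "q' \<in> Q" "q < q'" using less_cSup_iff[OF _ bdd] ne q(3) unfolding L_def by blast
      then have "x \<in> above_slopes f a b q" using mono[of q' q] by (auto simp: Q_def)
      moreover have "x \<in> below_slopes f a b p"
        unfolding below_slopes_def mem_Collect_eq
      proof (intro allI impI)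
        fix \<eta> :: real assume "\<eta> > 0"
        then obtain s t where st: "a < s" "s < x" "x < t" "t < b" "t - s < \<eta>" "f t - f s < (L - e) * (t - s)"
          using xb unfolding below_slopes_def by blast
        have "(L - e) * (t - s) \<le> p * (t - s)" using st p by (intro mult_right_mono) auto
        then have "f t - f s < p * (t - s)" using st(6) by linarith
        then show "\<exists>s t. a < s \<and> s < x \<and> x < t \<and> t < b \<and> t - s < \<eta> \<and> f t - f s < p * (t - s)"
          using st by blast
      qed
      ultimately show False using pq[OF p(1) q(1,2)] by blast
    qed
    then obtain \<eta>2 where \<eta>2: "\<eta>2 > 0" "\<And>s t. a < s \<Longrightarrow> s < x \<Longrightarrow> x < t \<Longrightarrow> t < b \<Longrightarrow> t - s < \<eta>2 \<Longrightarrow> \<not> f t - f s < (L - e) * (t - s)"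
      unfolding below_slopes_def by blast
    define d where "d = min (min \<eta>1 \<eta>2) (min (x - a) (b - x)) / 2"
    have d: "d > 0" "d + d \<le> \<eta>1" "d + d \<le> \<eta>2" "d < x - a" "d < b - x"
      using \<eta>1(1) \<eta>2(1) x by (auto simp: d_def min_def)
    have slope: "\<bar>f t - f s - (t - s) * L\<bar> \<le> e * (t - s)" if "x - d < s" "s < x" "x < t" "t < x + d" for s t
    proof -
      have "\<not> f t - f s > (L + e) * (t - s)" "\<not> f t - f s < (L - e) * (t - s)"
        by (rule \<eta>1(2) \<eta>2(2); use that d in auto)+
      then show ?thesis by (simp add: abs_le_iff algebra_simps)
    qed
    have contx: "isCont f x" using cont x by (metis continuous_on_interior interior_atLeastAtMost_real greaterThanLessThan_iff)
    show "\<exists>d>0. \<forall>y. norm (y - x) < d \<longrightarrow> norm (f y - f x - (y - x) * L) \<le> e * norm (y - x)"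
    proof (intro exI[of _ d] conjI allI impI)
      fix y assume y: "norm (y - x) < d"
      consider "y = x" | "x < y" | "y < x" by linarith
      then show "norm (f y - f x - (y - x) * L) \<le> e * norm (y - x)"
      proof cases
        case 2
        have "((\<lambda>s. \<bar>f y - f s - (y - s) * L\<bar>) \<longlongrightarrow> \<bar>f y - f x - (y - x) * L\<bar>) (at_left x)"
          using contx by (intro tendsto_intros) (auto simp: isCont_def filterlim_at_split)
        moreover have "((\<lambda>s. e * (y - s)) \<longlongrightarrow> e * (y - x)) (at_left x)" by (intro tendsto_intros)
        moreover have "eventually (\<lambda>s. s \<in> {x - d<..<x}) (at_left x)"
          using d(1) by (intro eventually_at_leftI[of "x - d"]) auto
        then have "eventually (\<lambda>s. \<bar>f y - f s - (y - s) * L\<bar> \<le> e * (y - s)) (at_left x)"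
          by eventually_elim (use slope y 2 in auto)
        ultimately have "\<bar>f y - f x - (y - x) * L\<bar> \<le> e * (y - x)"
          by (intro tendsto_le[OF _ _ _]) auto
        then show ?thesis using 2 by simp
      next
        case 3
        have "((\<lambda>t. \<bar>f t - f y - (t - y) * L\<bar>) \<longlongrightarrow> \<bar>f x - f y - (x - y) * L\<bar>) (at_right x)"
          using contx by (intro tendsto_intros) (auto simp: isCont_def filterlim_at_split)
        moreover have "((\<lambda>t. e * (t - y)) \<longlongrightarrow> e * (x - y)) (at_right x)" by (intro tendsto_intros)
        moreover have "eventually (\<lambda>t. t \<in> {x<..<x + d}) (at_right x)"
          using d(1) by (intro eventually_at_rightI[of x "x + d"]) auto
        then have "eventually (\<lambda>t. \<bar>f t - f y - (t - y) * L\<bar> \<le> e * (t - y)) (at_right x)"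
          by eventually_elim (use slope y 3 in auto)
        ultimately have "\<bar>f x - f y - (x - y) * L\<bar> \<le> e * (x - y)"
          by (intro tendsto_le[OF _ _ _]) auto
        moreover have "f y - f x - (y - x) * L = - (f x - f y - (x - y) * L)" by (simp add: algebra_simps)
        moreover have "\<bar>y - x\<bar> = x - y" using 3 by simp
        ultimately show ?thesis by (simp only: real_norm_def abs_minus_cancel)
      qed simp
    qed (rule d)
  qed
  then show ?thesis unfolding differentiable_def by blast
qed

lemma absolutely_continuous_on_AE_differentiable:
  fixes f :: "real \<Rightarrow> real"
  assumes ac: "absolutely_continuous_on {a..b} f"
  obtains N where "negligible N" "\<And>x. x \<in> {a<..<b} - N \<Longrightarrow> f differentiable (at x)"
proof -
  \<comment> \<open>The three sets are the ways in which straddling slopes can fail to converge to a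
    finite limit: oscillation, upper limit \<open>\<infinity>\<close>, lower limit
    \<open>-\<infinity>\<close>. Rational \<open>p\<close> and \<open>q\<close> keep the union
    \<open>N1\<close> countable.\<close>
  define N1 where "N1 = (\<Union>(p,q)\<in>{(p,q). p \<in> \<rat> \<and> q \<in> \<rat> \<and> p < q}. below_slopes f a b p \<inter> above_slopes f a b q)"
  define N2 where "N2 = (\<Inter>n::nat. above_slopes f a b (real n))"
  define N3 where "N3 = (\<Inter>n::nat. below_slopes f a b (- real n))"
  have "countable {(p,q). p \<in> \<rat> \<and> q \<in> \<rat> \<and> p < (q::real)}"
    by (rule countable_subset[of _ "\<rat> \<times> \<rat>"]) (auto simp: countable_rat)
  then have "negligible N1" unfolding N1_def
    using negligible_below_above_slopes[OF ac] by (intro negligible_countable_Union) auto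
  moreover have "negligible N2" unfolding N2_def by (rule negligible_all_above_slopes[OF ac])
  moreover have "negligible N3"
  proof -
    have "absolutely_continuous_on {a..b} (\<lambda>x. - f x)"
      by (rule absolutely_continuous_on_dominated[OF ac, where K = 1]) (simp add: abs_minus_commute)
    from negligible_all_above_slopes[OF this] show ?thesis by (simp add: N3_def above_slopes_uminus)
  qed
  ultimately have "negligible (N1 \<union> N2 \<union> N3)" by simp
  moreover have "f differentiable (at x)" if x: "x \<in> {a<..<b} - (N1 \<union> N2 \<union> N3)" for x
  proof -
    obtain n where n: "x \<notin> above_slopes f a b (real n)" using x by (auto simp: N2_def)
    obtain m where m: "x \<notin> below_slopes f a b (- real m)" using x by (auto simp: N3_def)
    show ?thesis
    proof (rule differentiable_if_slopes_converge[OF absolutely_continuous_on_imp_continuous_on[OF ac] _ _ _ n m])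
      show "x \<notin> below_slopes f a b p \<inter> above_slopes f a b q" if "p \<in> \<rat>" "q \<in> \<rat>" "p < q" for p q
        using x that unfolding N1_def by blast
    qed (use x in auto)
  qed
  ultimately show thesis by (rule that)
qed

section \<open>Calculus of locally absolutely continuous functions\<close>

text \<open>A locally absolutely continuous function paired with a version of its almost everywhere
  derivative. One notion thus serves for \<open>u' = p\<close>, which holds at all interior points,
  and for the equation for \<open>p'\<close>, which holds almost everywhere; nothing is asserted
  about the derivative at 0.\<close>

definition ac_deriv :: "(real \<Rightarrow> real) \<Rightarrow> (real \<Rightarrow> real) \<Rightarrow> bool" where
  "ac_deriv f g \<longleftrightarrow> locally_AC f \<and>
     (\<exists>N. negligible N \<and> (\<forall>x. 0 < x \<and> x \<notin> N \<longrightarrow> (f has_real_derivative g x) (at x)))"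

lemma ac_derivI:
  assumes "locally_AC f" "negligible N" "\<And>x. 0 < x \<Longrightarrow> x \<notin> N \<Longrightarrow> (f has_real_derivative g x) (at x)"
  shows "ac_deriv f g"
  using assms unfolding ac_deriv_def by blast

lemma ac_derivE:
  assumes "ac_deriv f g"
  obtains N where "locally_AC f" "negligible N" "\<And>x. 0 < x \<Longrightarrow> x \<notin> N \<Longrightarrow> (f has_real_derivative g x) (at x)"
  using assms unfolding ac_deriv_def by blast

lemma ac_deriv_cong:
  assumes "ac_deriv f g" "\<And>x. 0 < x \<Longrightarrow> g x = h x"
  shows "ac_deriv f h"
  using assms unfolding ac_deriv_def by metis

lemma ac_deriv_FTC:
  assumes "ac_deriv f g" "0 \<le> a" "a \<le> b"
  shows "(g has_integral (f b - f a)) {a..b}"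
proof -
  obtain N where N: "locally_AC f" "negligible N" "\<And>x. 0 < x \<Longrightarrow> x \<notin> N \<Longrightarrow> (f has_real_derivative g x) (at x)"
    using ac_derivE[OF assms(1)] by blast
  show ?thesis
  \<comment> \<open>No derivative is known at 0, so 0 joins the exceptional set.\<close>
  proof (rule fundamental_theorem_of_calculus_absolutely_continuous[OF assms(3), where N = "insert 0 N"])
    show "absolutely_continuous_on {a..b} f"
    proof (rule absolutely_continuous_on_mono[of "{0..b}"])
      have "0 \<le> b" using assms(2,3) by linarith
      then show "absolutely_continuous_on {0..b} f" using N(1) by (simp add: locally_AC_def)
    qed (use assms(2) in auto)
    show "(f has_vector_derivative g x) (at x within {a..b})" if "x \<in> {a..b} - insert 0 N" for x
      using N(3)[of x] that assms by (auto simp: has_real_derivative_iff_has_vector_derivative has_vector_derivative_at_within)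
  qed (use N in auto)
qed

lemma ac_deriv_continuous_on:
  assumes "ac_deriv f g"
  shows "continuous_on {0..} f"
  unfolding continuous_on_eq_continuous_within
proof
  fix x :: real assume x: "x \<in> {0..}"
  have "continuous_on {0..x + 1} f"
    using assms x by (intro absolutely_continuous_on_imp_continuous_on) (auto simp: ac_deriv_def locally_AC_def)
  then have "continuous (at x within {0..x + 1}) f" using x by (auto simp: continuous_on_eq_continuous_within)
  moreover have "at x within {0..x + 1} = at x within {0..}"
    by (rule at_within_nhd[of x "{..<x + 1}"]) auto
  ultimately show "continuous (at x within {0..}) f" by simp
qed

lemma ac_deriv_const: "ac_deriv (\<lambda>x. c) (\<lambda>x. 0)"
  by (rule ac_derivI[where N = "{}"])
     (auto simp: locally_AC_def intro: absolutely_continuous_on_dominated[OF absolutely_continuous_on_ident, where K = 0])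

lemma ac_deriv_add:
  assumes "ac_deriv f f'" "ac_deriv g g'"
  shows "ac_deriv (\<lambda>x. f x + g x) (\<lambda>x. f' x + g' x)"
proof -
  obtain N where N: "locally_AC f" "negligible N" "\<And>x. 0 < x \<Longrightarrow> x \<notin> N \<Longrightarrow> (f has_real_derivative f' x) (at x)"
    using ac_derivE[OF assms(1)] by blast
  obtain M where M: "locally_AC g" "negligible M" "\<And>x. 0 < x \<Longrightarrow> x \<notin> M \<Longrightarrow> (g has_real_derivative g' x) (at x)"
    using ac_derivE[OF assms(2)] by blast
  show ?thesis
    by (rule ac_derivI[where N = "N \<union> M"])
       (use N M in \<open>auto simp: locally_AC_def intro: absolutely_continuous_on_add DERIV_add\<close>)
qed

lemma ac_deriv_mult:
  assumes "ac_deriv f f'" "ac_deriv g g'"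
  shows "ac_deriv (\<lambda>x. f x * g x) (\<lambda>x. f' x * g x + f x * g' x)"
proof -
  obtain N where N: "locally_AC f" "negligible N" "\<And>x. 0 < x \<Longrightarrow> x \<notin> N \<Longrightarrow> (f has_real_derivative f' x) (at x)"
    using ac_derivE[OF assms(1)] by blast
  obtain M where M: "locally_AC g" "negligible M" "\<And>x. 0 < x \<Longrightarrow> x \<notin> M \<Longrightarrow> (g has_real_derivative g' x) (at x)"
    using ac_derivE[OF assms(2)] by blast
  show ?thesis
  proof (rule ac_derivI[where N = "N \<union> M"])
    show "locally_AC (\<lambda>x. f x * g x)" using N M by (auto simp: locally_AC_def intro: absolutely_continuous_on_mult)
    show "((\<lambda>x. f x * g x) has_real_derivative f' x * g x + f x * g' x) (at x)" if "0 < x" "x \<notin> N \<union> M" for x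
      using DERIV_mult[OF N(3)[of x] M(3)[of x]] that by (simp add: algebra_simps)
  qed (use N M in auto)
qed

lemma ac_deriv_inverse:
  assumes "ac_deriv f f'" and pos: "\<And>x. 0 \<le> x \<Longrightarrow> f x > 0"
  shows "ac_deriv (\<lambda>x. inverse (f x)) (\<lambda>x. - f' x * (inverse (f x))\<^sup>2)"
proof -
  obtain N where N: "locally_AC f" "negligible N" "\<And>x. 0 < x \<Longrightarrow> x \<notin> N \<Longrightarrow> (f has_real_derivative f' x) (at x)"
    using ac_derivE[OF assms(1)] by blast
  show ?thesis
  proof (rule ac_derivI[where N = N])
    show "locally_AC (\<lambda>x. inverse (f x))"
      unfolding locally_AC_def
    proof (intro allI impI)
      fix b :: real assume "0 \<le> b"
      then have "absolutely_continuous_on {0..b} f" using N(1) by (simp add: locally_AC_def)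
      then show "absolutely_continuous_on {0..b} (\<lambda>x. inverse (f x))"
        by (rule absolutely_continuous_on_inverse) (simp add: pos)
    qed
    show "((\<lambda>x. inverse (f x)) has_real_derivative - f' x * (inverse (f x))\<^sup>2) (at x)" if "0 < x" "x \<notin> N" for x
    proof -
      have "f x \<noteq> 0" using pos[of x] that by simp
      from DERIV_inverse'[OF N(3)[OF that] this]
      show ?thesis by (simp only: power2_eq_square mult_ac minus_mult_left)
    qed
  qed (use N in auto)
qed

lemma ac_deriv_cmult:
  assumes "ac_deriv f f'"
  shows "ac_deriv (\<lambda>x. c * f x) (\<lambda>x. c * f' x)"
  using ac_deriv_mult[OF ac_deriv_const[of c] assms] by simp

lemma ac_deriv_diff:
  assumes "ac_deriv f f'" "ac_deriv g g'"
  shows "ac_deriv (\<lambda>x. f x - g x) (\<lambda>x. f' x - g' x)"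
  using ac_deriv_add[OF assms(1) ac_deriv_cmult[OF assms(2), of "-1"]] by simp

lemma ac_deriv_power2:
  assumes "ac_deriv f f'"
  shows "ac_deriv (\<lambda>x. (f x)\<^sup>2) (\<lambda>x. 2 * f x * f' x)"
  by (rule ac_deriv_cong[OF ac_deriv_mult[OF assms assms, folded power2_eq_square]]) simp

lemma ac_deriv_C1:
  assumes der: "\<And>x. 0 \<le> x \<Longrightarrow> (f has_real_derivative f' x) (at x within {0..})"
    and cont: "continuous_on {0..} f'"
  shows "ac_deriv f f'"
proof (rule ac_derivI[where N = "{}"])
  show "locally_AC f" unfolding locally_AC_def
  proof (intro allI impI absolutely_continuous_on_C1)
    show "(f has_vector_derivative f' x) (at x within {0..b})" if "x \<in> {0..b}" for x b
      using der[of x] that by (auto simp: has_real_derivative_iff_has_vector_derivative intro: has_vector_derivative_within_subset)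
    show "continuous_on {0..b} f'" for b by (rule continuous_on_subset[OF cont]) auto
  qed
  show "(f has_real_derivative f' x) (at x)" if "0 < x" for x
  proof -
    have "at x within {0..} = at x" using that by (intro at_within_interior) auto
    then show ?thesis using der[of x] that by simp
  qed
qed auto

section \<open>Improper integrals of non-negative functions\<close>

lemma mono_bounded_tendsto_at_top:
  fixes f :: "real \<Rightarrow> real"
  assumes mono: "\<And>x y. a \<le> x \<Longrightarrow> x \<le> y \<Longrightarrow> f x \<le> f y" and bdd: "\<And>x. a \<le> x \<Longrightarrow> f x \<le> B"
  obtains l where "(f \<longlongrightarrow> l) at_top" "\<And>x. a \<le> x \<Longrightarrow> f x \<le> l" "l \<le> B"
proof
  let ?l = "Sup (f ` {a..})"
  have bd: "bdd_above (f ` {a..})" using bdd by (auto intro!: bdd_aboveI)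
  show le: "f x \<le> ?l" if "a \<le> x" for x using that bd by (auto intro: cSup_upper)
  show "?l \<le> B" using bdd by (intro cSup_least) auto
  show "(f \<longlongrightarrow> ?l) at_top"
  proof (rule order_tendstoI)
    fix c assume "c < ?l"
    then obtain x where x: "x \<ge> a" "c < f x" using less_cSup_iff[OF _ bd] by auto
    then show "eventually (\<lambda>y. c < f y) at_top"
      using mono[of x] by (intro eventually_at_top_linorderI[of x]) force
  next
    fix c assume "c > ?l"
    then show "eventually (\<lambda>y. f y < c) at_top"
      using le by (intro eventually_at_top_linorderI[of a]) (auto intro: le_less_trans)
  qed
qed

lemma nonneg_integrable_on_atLeast_subset:
  fixes g :: "real \<Rightarrow> real"
  assumes g: "g integrable_on {a..}" and nn: "\<And>x. a \<le> x \<Longrightarrow> g x \<ge> 0" and "a \<le> x"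
  shows "g integrable_on {x..}" "g integrable_on {x..y}"
proof -
  have "g absolutely_integrable_on {a..}" using g nn by (intro nonnegative_absolutely_integrable_1) auto
  then have "g absolutely_integrable_on {x..}" "g absolutely_integrable_on {x..y}"
    using \<open>a \<le> x\<close> by (auto elim!: set_integrable_subset)
  then show "g integrable_on {x..}" "g integrable_on {x..y}"
    using absolutely_integrable_on_def by blast+
qed

lemma integral_atLeast_split:
  fixes g :: "real \<Rightarrow> real"
  assumes g: "g integrable_on {a..}" and nn: "\<And>x. a \<le> x \<Longrightarrow> g x \<ge> 0" and "a \<le> x" "x \<le> y"
  shows "integral {x..} g = integral {x..y} g + integral {y..} g"
proof -
  have "{x..y} \<union> {y..} = {x..}" "{x..y} \<inter> {y..} = {y}" using assms by auto
  moreover have "integral ({x..y} \<union> {y..}) g = integral {x..y} g + integral {y..} g"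
    using assms \<open>{x..y} \<inter> {y..} = {y}\<close>
    by (intro integral_Un nonneg_integrable_on_atLeast_subset[OF g nn]) auto
  ultimately show ?thesis by simp
qed

lemma integral_atLeast_nonneg:
  fixes g :: "real \<Rightarrow> real"
  assumes g: "g integrable_on {a..}" and nn: "\<And>x. a \<le> x \<Longrightarrow> g x \<ge> 0" and "a \<le> x"
  shows "integral {x..} g \<ge> 0" "integral {x..y} g \<ge> 0"
  using assms nonneg_integrable_on_atLeast_subset[OF g nn] by (auto intro!: integral_nonneg)

lemma nonneg_bounded_imp_integrable_on_atLeast:
  fixes g :: "real \<Rightarrow> real"
  assumes int: "\<And>y. a \<le> y \<Longrightarrow> g integrable_on {a..y}" and nn: "\<And>x. a \<le> x \<Longrightarrow> g x \<ge> 0"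
    and bdd: "\<And>y. a \<le> y \<Longrightarrow> integral {a..y} g \<le> B"
  shows "g integrable_on {a..}" "((\<lambda>y. integral {a..y} g) \<longlongrightarrow> integral {a..} g) at_top"
proof -
  have int': "g integrable_on {a..y}" for y using int[of y] by (cases "a \<le> y") auto
  have mono: "integral {a..x} g \<le> integral {a..y} g" if "a \<le> x" "x \<le> y" for x y
    using that int' nn by (intro integral_subset_le) auto
  obtain l where l: "((\<lambda>y. integral {a..y} g) \<longlongrightarrow> l) at_top"
    by (rule mono_bounded_tendsto_at_top[OF mono bdd])
  have "(g has_integral l) {a..}" by (rule has_integral_to_inf[OF int' l nn])
  then show "g integrable_on {a..}" "((\<lambda>y. integral {a..y} g) \<longlongrightarrow> integral {a..} g) at_top"
    using l by (auto simp: has_integral_iff)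
qed

lemma integral_atLeast_tendsto_0:
  fixes g :: "real \<Rightarrow> real"
  assumes g: "g integrable_on {a..}" and nn: "\<And>x. a \<le> x \<Longrightarrow> g x \<ge> 0"
  shows "((\<lambda>x. integral {x..} g) \<longlongrightarrow> 0) at_top"
proof -
  have "((\<lambda>y. integral {a..y} g) \<longlongrightarrow> integral {a..} g) at_top"
  proof (rule nonneg_bounded_imp_integrable_on_atLeast)
    show "integral {a..y} g \<le> integral {a..} g" if "a \<le> y" for y
      using integral_atLeast_split[OF g nn order_refl that] integral_atLeast_nonneg[OF g nn that] by simp
  qed (use nonneg_integrable_on_atLeast_subset[OF g nn] nn in auto)
  then have "((\<lambda>y. integral {a..} g - integral {a..y} g) \<longlongrightarrow> integral {a..} g - integral {a..} g) at_top"
    by (intro tendsto_intros)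
  moreover have "eventually (\<lambda>y. integral {a..} g - integral {a..y} g = integral {y..} g) at_top"
    using integral_atLeast_split[OF g nn order_refl] by (intro eventually_at_top_linorderI[of a]) auto
  ultimately show ?thesis by (simp add: tendsto_cong)
qed

lemma ac_deriv_increment_bound:
  assumes f: "ac_deriv f h" and g: "g integrable_on {x..y}" and le: "\<And>t. x \<le> t \<Longrightarrow> t \<le> y \<Longrightarrow> \<bar>h t\<bar> \<le> g t"
    and "0 \<le> x" "x \<le> y"
  shows "\<bar>f y - f x\<bar> \<le> integral {x..y} g"
proof -
  have h: "(h has_integral (f y - f x)) {x..y}" using ac_deriv_FTC[OF f] assms by auto
  have "norm (integral {x..y} h) \<le> integral {x..y} g"
    using h g le by (intro integral_norm_bound_integral) (auto simp: has_integral_iff)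
  then show ?thesis using h by (simp add: has_integral_iff)
qed

text \<open>The right end in \<open>ac_deriv_increment_bound\<close> goes to infinity, where
  \<open>f\<close> vanishes. The asymptotics of bound states rest on this estimate.\<close>

lemma ac_deriv_tail_bound:
  assumes f: "ac_deriv f h" and g: "g integrable_on {x..}" and le: "\<And>t. x \<le> t \<Longrightarrow> \<bar>h t\<bar> \<le> g t"
    and "0 \<le> x" and lim: "(f \<longlongrightarrow> 0) at_top"
  shows "\<bar>f x\<bar> \<le> integral {x..} g"
proof -
  have nn: "g t \<ge> 0" if "x \<le> t" for t using le[OF that] by linarith
  have "((\<lambda>y. \<bar>f y - f x\<bar>) \<longlongrightarrow> \<bar>0 - f x\<bar>) at_top" using lim by (intro tendsto_intros)
  moreover have "eventually (\<lambda>y. \<bar>f y - f x\<bar> \<le> integral {x..} g) at_top"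
  proof (rule eventually_at_top_linorderI[of x])
    fix y assume y: "x \<le> y"
    have "\<bar>f y - f x\<bar> \<le> integral {x..y} g"
      by (rule ac_deriv_increment_bound[OF f nonneg_integrable_on_atLeast_subset(2)[OF g nn]]) (use le y assms in auto)
    also have "\<dots> \<le> integral {x..} g"
      using integral_atLeast_split[OF g nn order_refl y] integral_atLeast_nonneg[OF g nn y] by simp
    finally show "\<bar>f y - f x\<bar> \<le> integral {x..} g" .
  qed
  ultimately have "\<bar>0 - f x\<bar> \<le> integral {x..} g" by (intro tendsto_upperbound) auto
  then show ?thesis by simp
qed

lemma ac_deriv_convergent_at_top:
  assumes f: "ac_deriv f h" and g: "g integrable_on {0..}" and le: "\<And>t. 0 \<le> t \<Longrightarrow> \<bar>h t\<bar> \<le> g t"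
  obtains l where "(f \<longlongrightarrow> l) at_top"
proof -
  have nn: "g t \<ge> 0" if "0 \<le> t" for t using le[OF that] by linarith
  note gint = nonneg_integrable_on_atLeast_subset(2)[OF g nn]
  have sub: "integral {0..} g = integral {0..y} g + integral {y..} g" "integral {y..} g \<ge> 0" if "0 \<le> y" for y
    by (rule integral_atLeast_split[OF g nn order_refl that], assumption)
       (rule integral_atLeast_nonneg(1)[OF g nn that], assumption)
  \<comment> \<open>Adding the integral of the majorant makes the function monotone, so boundedness
    alone gives convergence.\<close>
  define q where "q y = f y + integral {0..y} g" for y
  have inc: "\<bar>f y - f x\<bar> \<le> integral {x..y} g" if "0 \<le> x" "x \<le> y" for x y
    by (rule ac_deriv_increment_bound[OF f gint]) (use le that in auto)
  have comb: "integral {0..y} g = integral {0..x} g + integral {x..y} g" if "0 \<le> x" "x \<le> y" for x y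
    using Henstock_Kurzweil_Integration.integral_combine[of 0 x y g] that gint[of 0 y] by auto
  have mono: "q x \<le> q y" if "0 \<le> x" "x \<le> y" for x y
    using inc[OF that] comb[OF that] by (auto simp: q_def)
  have bdd: "q x \<le> f 0 + 2 * integral {0..} g" if "0 \<le> x" for x
    using inc[OF order_refl that] sub[OF that] by (auto simp: q_def)
  obtain l where l: "(q \<longlongrightarrow> l) at_top"
    by (rule mono_bounded_tendsto_at_top[OF mono bdd])
  have "((\<lambda>y. q y - (integral {0..} g - integral {y..} g)) \<longlongrightarrow> l - (integral {0..} g - 0)) at_top"
    by (intro tendsto_intros l integral_atLeast_tendsto_0[OF g nn])
  moreover have "eventually (\<lambda>y. q y - (integral {0..} g - integral {y..} g) = f y) at_top"
    using sub(1) by (intro eventually_at_top_linorderI[of 0]) (auto simp: q_def)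
  ultimately show thesis using that by (simp add: tendsto_cong)
qed

lemma integrable_on_atLeast_lower_bound:
  fixes g :: "real \<Rightarrow> real"
  assumes g: "g integrable_on {0..}" and nn: "\<And>x. 0 \<le> x \<Longrightarrow> g x \<ge> 0"
    and c: "c > 0" "eventually (\<lambda>x. g x \<ge> c) at_top"
  shows False
proof -
  obtain x0 where x0: "\<And>x. x0 \<le> x \<Longrightarrow> c \<le> g x" using c(2) by (auto simp: eventually_at_top_linorder)
  define x where "x = max 0 x0"
  define y where "y = x + (integral {0..} g + 1) / c"
  have I: "integral {0..} g \<ge> 0" using integral_atLeast_nonneg[OF g nn, of 0] by simp
  have xy: "0 \<le> x" "x0 \<le> x" "x \<le> y" using c(1) I by (auto simp: x_def y_def)
  have "integral {x..y} (\<lambda>t. c) \<le> integral {x..y} g"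
    using x0 xy nonneg_integrable_on_atLeast_subset(2)[OF g nn, of x y] by (intro integral_le) auto
  also have "\<dots> \<le> integral {x..} g"
    using integral_atLeast_split[OF g nn xy(1,3)] integral_atLeast_nonneg(1)[OF g nn, of y] xy by auto
  also have "\<dots> \<le> integral {0..} g"
    using integral_atLeast_split[OF g nn order_refl xy(1)] integral_atLeast_nonneg(2)[OF g nn, of 0 x] by auto
  finally show False using xy c(1) by (simp add: y_def)
qed

lemma integrable_tendsto_imp_0:
  fixes g :: "real \<Rightarrow> real"
  assumes g: "g integrable_on {0..}" and nn: "\<And>x. 0 \<le> x \<Longrightarrow> g x \<ge> 0" and l: "(g \<longlongrightarrow> l) at_top"
  shows "l = 0"
proof (rule ccontr)
  assume "l \<noteq> 0"
  moreover have "l \<ge> 0" using l nn by (intro tendsto_lowerbound[OF l] eventually_at_top_linorderI[of 0]) auto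
  ultimately have "l > 0" by simp
  then have "eventually (\<lambda>x. g x > l / 2) at_top" using l by (intro order_tendstoD(1)) auto
  then have "eventually (\<lambda>x. g x \<ge> l / 2) at_top" by (rule eventually_mono) simp
  then show False using integrable_on_atLeast_lower_bound[OF g nn, of "l / 2"] \<open>l > 0\<close> by simp
qed

text \<open>On an interval where the integral of \<open>g\<close> is below \<open>1/2\<close> and
  \<open>E\<close> vanishes at one end, the maximum of \<open>E\<close> is at most half of itself,
  hence 0. Uniform continuity gives a common length for such intervals, and the zero spreads from
  \<open>x0\<close> in both directions by steps of half that length.\<close>

lemma ac_deriv_Gronwall_unique:
  assumes E: "ac_deriv E h" and nn: "\<And>x. 0 \<le> x \<Longrightarrow> E x \<ge> 0"
    and g: "\<And>b. 0 \<le> b \<Longrightarrow> g integrable_on {0..b}" and le: "\<And>x. 0 \<le> x \<Longrightarrow> \<bar>h x\<bar> \<le> g x * E x"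
    and gnn: "\<And>x. 0 \<le> x \<Longrightarrow> g x \<ge> 0"
    and x0: "0 \<le> x0" "E x0 = 0" and x: "0 \<le> x"
  shows "E x = 0"
proof -
  define b where "b = max x0 x"
  have b: "0 \<le> b" "x0 \<le> b" "x \<le> b" using x0 x by (auto simp: b_def)
  have "uniformly_continuous_on {0..b} (\<lambda>y. integral {0..y} g)"
    using indefinite_integral_continuous_1[OF g[OF b(1)]] compact_uniformly_continuous by blast
  then obtain d where d: "d > 0" "\<And>y z. y \<in> {0..b} \<Longrightarrow> z \<in> {0..b} \<Longrightarrow> dist z y < d \<Longrightarrow>
      dist (integral {0..z} g) (integral {0..y} g) < 1/2"
    unfolding uniformly_continuous_on_def using half_gt_zero[OF zero_less_one] by blast
  have small: "integral {s..t} g < 1/2" if "0 \<le> s" "s \<le> t" "t \<le> b" "t - s < d" for s t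
  proof -
    have "integral {0..s} g + integral {s..t} g = integral {0..t} g"
      using that g[of t] by (intro Henstock_Kurzweil_Integration.integral_combine) auto
    moreover have "dist (integral {0..t} g) (integral {0..s} g) < 1/2"
      using d(2)[of s t] that by (auto simp: dist_real_def)
    ultimately show ?thesis unfolding dist_real_def by linarith
  qed
  have step: "\<forall>y\<in>{s..t}. E y = 0" if st: "0 \<le> s" "s \<le> t" "t \<le> b" "t - s < d" and z: "z = s \<or> z = t" "E z = 0" for s t z
  proof -
    have "continuous_on {s..t} E" by (rule continuous_on_subset[OF ac_deriv_continuous_on[OF E]]) (use st in auto)
    then obtain m where m: "m \<in> {s..t}" "\<And>y. y \<in> {s..t} \<Longrightarrow> E y \<le> E m"
      using continuous_attains_sup[of "{s..t}" E] st by auto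
    have gst: "g integrable_on {s'..t'}" if "0 \<le> s'" "t' \<le> b" for s' t'
      using integrable_subinterval_real[OF g[OF b(1)], of s' t'] that by auto
    have inc: "\<bar>E t' - E s'\<bar> \<le> E m / 2" if st': "s \<le> s'" "s' \<le> t'" "t' \<le> t" for s' t'
    proof -
      have "\<bar>E t' - E s'\<bar> \<le> integral {s'..t'} (\<lambda>y. E m * g y)"
      proof (rule ac_deriv_increment_bound[OF E])
        show "\<bar>h y\<bar> \<le> E m * g y" if "s' \<le> y" "y \<le> t'" for y
        proof -
          have "\<bar>h y\<bar> \<le> g y * E y" using le[of y] that st st' by auto
          also have "\<dots> \<le> g y * E m" using m(2)[of y] gnn[of y] that st st' by (intro mult_left_mono) auto
          finally show ?thesis by (simp add: mult.commute)
        qed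
      qed (use gst st st' in \<open>auto intro!: integrable_on_mult_right\<close>)
      also have "\<dots> = E m * integral {s'..t'} g" by simp
      also have "\<dots> \<le> E m * (1/2)"
        using small[of s' t'] st st' nn[of m] m(1) by (intro mult_left_mono) auto
      finally show ?thesis by simp
    qed
    have "\<bar>E m - E z\<bar> \<le> E m / 2"
    proof (cases "z = s")
      case True then show ?thesis using inc[of s m] m(1) by auto
    next
      case False then show ?thesis using inc[of m t] m(1) z by (auto simp: abs_minus_commute)
    qed
    then have "E m \<le> 0" using z by auto
    then show ?thesis using m(2) nn st by (metis atLeastAtMost_iff order_antisym order_trans)
  qed
  have main: "\<forall>y\<in>{0..b}. \<bar>y - x0\<bar> \<le> real n * (d / 2) \<longrightarrow> E y = 0" for n
  proof (induction n)
    case 0 then show ?case using x0 by auto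
  next
    case (Suc n)
    show ?case
    proof (intro ballI impI)
      fix y assume y: "y \<in> {0..b}" "\<bar>y - x0\<bar> \<le> real (Suc n) * (d / 2)"
      \<comment> \<open>The point \<open>z\<close> divides the segment from \<open>x0\<close> to
        \<open>y\<close> so that it is within \<open>real n * (d / 2)\<close> of \<open>x0\<close>
        and within \<open>d / 2\<close> of \<open>y\<close>, on whichever side of \<open>x0\<close>
        the point \<open>y\<close> lies.\<close>
      define r where "r = real n / real (Suc n)"
      have r: "0 \<le> r" "r \<le> 1" "r * real (Suc n) = real n" "(1 - r) * real (Suc n) = 1" by (auto simp: r_def field_simps)
      define z where "z = x0 + r * (y - x0)"
      have zb: "z \<in> {0..b}"
      proof -
        have "z = (1 - r) * x0 + r * y" by (simp add: z_def algebra_simps)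
        moreover have "(1 - r) * x0 + r * y \<le> (1 - r) * b + r * b" using r b y by (intro add_mono mult_left_mono) auto
        moreover have "(1 - r) * x0 + r * y \<ge> 0" using r x0 y by (intro add_nonneg_nonneg mult_nonneg_nonneg) auto
        ultimately show ?thesis by (simp add: algebra_simps)
      qed
      have "\<bar>z - x0\<bar> = r * \<bar>y - x0\<bar>" using r by (simp add: z_def abs_mult)
      also have "\<dots> \<le> r * (real (Suc n) * (d / 2))" using r y by (intro mult_left_mono) auto
      also have "\<dots> = real n * (d / 2)" using r(3) by (metis mult.assoc)
      finally have Ez: "E z = 0" using Suc zb by auto
      have "\<bar>y - z\<bar> = (1 - r) * \<bar>y - x0\<bar>"
      proof -
        have "y - z = (1 - r) * (y - x0)" by (simp add: z_def algebra_simps)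
        then show ?thesis using r by (simp add: abs_mult)
      qed
      also have "\<dots> \<le> (1 - r) * (real (Suc n) * (d / 2))" using r y by (intro mult_left_mono) auto
      also have "\<dots> = d / 2" using r(4) by (metis mult.assoc mult_1)
      finally have "\<bar>y - z\<bar> < d" using d(1) by simp
      then show "E y = 0"
        using step[of z y z] step[of y z z] Ez zb y(1) by (cases "z \<le> y") auto
    qed
  qed
  obtain n where "real n > \<bar>x - x0\<bar> / (d / 2)" using reals_Archimedean2 by blast
  then have "\<bar>x - x0\<bar> \<le> real n * (d / 2)" using d(1) by (simp add: field_simps)
  then show ?thesis using main[of n] x b by auto
qed

section \<open>Double commutation\<close>

lemma ac_deriv_tail_integral:
  fixes g :: "real \<Rightarrow> real"
  assumes g: "g integrable_on {0..}" and nn: "\<And>x. 0 \<le> x \<Longrightarrow> g x \<ge> 0" and cont: "continuous_on {0..} g"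
  shows "ac_deriv (\<lambda>x. integral {x..} g) (\<lambda>x. - g x)"
proof (rule ac_deriv_C1)
  fix x :: real assume x: "0 \<le> x"
  have "continuous_on {0..x + 1} g" by (rule continuous_on_subset[OF cont]) auto
  then have "((\<lambda>y. integral {0..y} g) has_real_derivative g x) (at x within {0..x + 1})"
    by (rule integral_has_real_derivative) (use x in auto)
  moreover have "at x within {0..x + 1} = at x within {0..}"
    by (rule at_within_nhd[of x "{..<x + 1}"]) auto
  ultimately have "((\<lambda>y. integral {0..y} g) has_real_derivative g x) (at x within {0..})" by simp
  then have "((\<lambda>y. integral {0..} g - integral {0..y} g) has_real_derivative - g x) (at x within {0..})"
    using DERIV_diff[OF DERIV_const] by fastforce
  then show "((\<lambda>y. integral {y..} g) has_real_derivative - g x) (at x within {0..})"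
  proof (rule has_field_derivative_transform_within[OF _ zero_less_one])
    show "integral {0..} g - integral {0..y} g = integral {y..} g" if "y \<in> {0..}" for y
    proof -
      have "integral {0..} g = integral {0..y} g + integral {y..} g"
        by (rule integral_atLeast_split[OF g nn]) (use that in auto)
      then show ?thesis by simp
    qed
  qed (use x in auto)
qed (use cont in \<open>auto intro: continuous_intros\<close>)

lemma two_mult_le_squares: "\<bar>2 * a * b\<bar> \<le> a\<^sup>2 + b\<^sup>2" for a b :: real
  using sum_squares_bound[of a b] sum_squares_bound[of a "- b"] by (auto simp: abs_le_iff)

text \<open>Gronwall for \<open>u^2 + p^2\<close>, whose derivative is
  \<open>2 u p (1 + V + c)\<close>. The bound \<open>|V| \<le> 1 + V^2\<close> provides a locally
  integrable coefficient.\<close>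

lemma schroedinger_unique:
  assumes V2: "(\<lambda>x. (V x)\<^sup>2) integrable_on {0..}"
    and u: "ac_deriv u p" and p: "ac_deriv p (\<lambda>x. (V x + c) * u x)"
    and x: "0 \<le> x" "u x = 0" "p x = 0" and y: "0 \<le> y"
  shows "u y = 0 \<and> p y = 0"
proof -
  have E0: "(u x)\<^sup>2 + (p x)\<^sup>2 = 0" using x by simp
  have E: "ac_deriv (\<lambda>x. (u x)\<^sup>2 + (p x)\<^sup>2) (\<lambda>x. 2 * u x * p x + 2 * p x * ((V x + c) * u x))"
    by (rule ac_deriv_add[OF ac_deriv_power2[OF u] ac_deriv_power2[OF p]])
  have "(u y)\<^sup>2 + (p y)\<^sup>2 = 0"
  proof (rule ac_deriv_Gronwall_unique[OF E _ _ _ _ x(1) E0 y, where g = "\<lambda>x. 2 + \<bar>c\<bar> + (V x)\<^sup>2"])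
    show "(\<lambda>x. 2 + \<bar>c\<bar> + (V x)\<^sup>2) integrable_on {0..b}" for b
      by (intro integrable_add integrable_const_ivl nonneg_integrable_on_atLeast_subset(2)[OF V2]) auto
    show "\<bar>2 * u t * p t + 2 * p t * ((V t + c) * u t)\<bar> \<le> (2 + \<bar>c\<bar> + (V t)\<^sup>2) * ((u t)\<^sup>2 + (p t)\<^sup>2)" for t
    proof -
      have "2 * u t * p t + 2 * p t * ((V t + c) * u t) = (2 * u t * p t) * (1 + V t + c)"
        by (simp add: algebra_simps)
      then have "\<bar>2 * u t * p t + 2 * p t * ((V t + c) * u t)\<bar> = \<bar>2 * u t * p t\<bar> * \<bar>1 + V t + c\<bar>"
        by (simp only: abs_mult)
      also have "\<dots> \<le> ((u t)\<^sup>2 + (p t)\<^sup>2) * (2 + \<bar>c\<bar> + (V t)\<^sup>2)"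
      proof (rule mult_mono[OF two_mult_le_squares])
        have "\<bar>V t\<bar> \<le> 1 + (V t)\<^sup>2"
          using two_mult_le_squares[of "V t" 1] by (simp add: abs_mult)
        then show "\<bar>1 + V t + c\<bar> \<le> 2 + \<bar>c\<bar> + (V t)\<^sup>2" by linarith
      qed auto
      finally show ?thesis by (simp add: mult.commute)
    qed
  qed auto
  then show ?thesis by (simp add: sum_power2_eq_zero_iff)
qed

lemma weighted_two_mult_le_squares:
  fixes a b \<theta> :: real
  assumes "\<theta> > 0" shows "\<bar>2 * a * b\<bar> \<le> \<theta> * a\<^sup>2 + b\<^sup>2 / \<theta>"
proof -
  have "\<bar>2 * (\<theta> * a) * b\<bar> \<le> (\<theta> * a)\<^sup>2 + b\<^sup>2" by (rule two_mult_le_squares)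
  moreover have "\<bar>2 * (\<theta> * a) * b\<bar> = \<theta> * \<bar>2 * a * b\<bar>" using assms by (simp add: abs_mult)
  ultimately have "\<theta> * \<bar>2 * a * b\<bar> \<le> \<theta> * (\<theta> * a\<^sup>2 + b\<^sup>2 / \<theta>)"
    using assms by (simp add: algebra_simps power2_eq_square)
  then show ?thesis using assms by simp
qed

text \<open>The eigenvalue is \<open>-k\<^sup>2\<close>, and \<open>p\<close> is \<open>u'\<close>.\<close>

locale bound_state =
  fixes V :: "real \<Rightarrow> real" and k :: real and u p :: "real \<Rightarrow> real"
  assumes V2: "(\<lambda>x. (V x)\<^sup>2) integrable_on {0..}" and k: "k > 0"
    and u: "ac_deriv u p" and p: "ac_deriv p (\<lambda>x. (V x + k\<^sup>2) * u x)"
    and u0: "u 0 = 0" and p0: "p 0 = 1"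
    and u2: "(\<lambda>x. (u x)\<^sup>2) integrable_on {0..}"
begin

section \<open>Decay of a bound state at infinity\<close>

lemma cont: "continuous_on {0..} u" "continuous_on {0..} p"
  by (rule ac_deriv_continuous_on[OF u], rule ac_deriv_continuous_on[OF p])

lemma cont_sub: "0 \<le> x \<Longrightarrow> continuous_on {x..y} u" "0 \<le> x \<Longrightarrow> continuous_on {x..y} p"
  using continuous_on_subset[OF cont(1)] continuous_on_subset[OF cont(2)] by auto

lemma V2_sub: "0 \<le> x \<Longrightarrow> (\<lambda>x. (V x)\<^sup>2) integrable_on {x..y}" "0 \<le> x \<Longrightarrow> (\<lambda>x. (V x)\<^sup>2) integrable_on {x..}"
  using nonneg_integrable_on_atLeast_subset[OF V2] by auto

lemma u_square: "ac_deriv (\<lambda>x. (u x)\<^sup>2) (\<lambda>x. 2 * u x * p x)"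
  by (rule ac_deriv_power2[OF u])

lemma state_nonzero:
  assumes "0 \<le> x" shows "u x \<noteq> 0 \<or> p x \<noteq> 0"
  using schroedinger_unique[OF V2 u p assms _ _ order_refl] p0 by auto

text \<open>If the integral \<open>N\<close> of \<open>p^2\<close> grew too large,
  \<open>u p\<close> would stay above 1, and \<open>u^2\<close>, whose derivative is
  \<open>2 u p\<close>, would grow at least linearly, against its integrability. The lower bound on
  \<open>u p\<close> comes from \<open>(u p)' = p^2 + V u^2 + k^2 u^2\<close>, where
  \<open>V u^2\<close> is absorbed because \<open>u^2\<close> is bounded by the integral of
  \<open>u^2 + p^2\<close>.\<close>

lemma p2: "(\<lambda>x. (p x)\<^sup>2) integrable_on {0..}"
proof -
  define U where "U = integral {0..} (\<lambda>x. (u x)\<^sup>2)"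
  define v0 where "v0 = integral {0..} (\<lambda>x. (V x)\<^sup>2)"
  define N where "N R = integral {0..R} (\<lambda>x. (p x)\<^sup>2)" for R
  \<comment> \<open>With this \<open>a\<close> the splitting
    \<open>|V| \<le> V^2 / (2 a) + a / 2\<close> charges at most \<open>Q / 4\<close>, which takes a
    quarter of \<open>N R\<close>, to the \<open>V^2\<close> part; \<open>C\<close> collects the
    contributions of \<open>U\<close>.\<close>
  define a where "a = 2 * (v0 + 1)"
  define C where "C = U / 4 + (v0 + 1) * U"
  have U: "U \<ge> 0" "integral {0..R} (\<lambda>x. (u x)\<^sup>2) \<le> U" if "0 \<le> R" for R
    using integral_atLeast_split[OF u2 _ order_refl that] integral_atLeast_nonneg(1)[OF u2 _ that]
      integral_atLeast_nonneg(1)[OF u2 _ order_refl] by (auto simp: U_def)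
  have v0: "v0 \<ge> 0" "integral {0..R} (\<lambda>x. (V x)\<^sup>2) \<le> v0" if "0 \<le> R" for R
    using integral_atLeast_split[OF V2 _ order_refl that] integral_atLeast_nonneg(1)[OF V2 _ that]
      integral_atLeast_nonneg(1)[OF V2 _ order_refl] by (auto simp: v0_def)
  have a: "a > 0" using v0(1)[of 0] by (simp add: a_def)
  have up: "ac_deriv (\<lambda>x. u x * p x) (\<lambda>x. p x * p x + u x * ((V x + k\<^sup>2) * u x))"
    by (rule ac_deriv_mult[OF u p])
  have lower: "u R * p R \<ge> 3/4 * N R - C" if R: "0 \<le> R" for R
  proof -
    have iu: "(\<lambda>x. (u x)\<^sup>2) integrable_on {0..R}" and ip: "(\<lambda>x. (p x)\<^sup>2) integrable_on {0..R}"
      by (auto intro!: integrable_continuous_interval continuous_intros cont_sub)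
    define Q where "Q = integral {0..R} (\<lambda>x. (u x)\<^sup>2 + (p x)\<^sup>2)"
    have Q: "Q \<le> U + N R" using U(2)[OF R] iu ip by (simp add: Q_def N_def integral_add)
    have uQ: "(u t)\<^sup>2 \<le> Q" if t: "0 \<le> t" "t \<le> R" for t
    proof -
      have "\<bar>(u t)\<^sup>2 - (u 0)\<^sup>2\<bar> \<le> integral {0..t} (\<lambda>x. (u x)\<^sup>2 + (p x)\<^sup>2)"
      proof (rule ac_deriv_increment_bound[OF u_square])
        show "\<bar>2 * u s * p s\<bar> \<le> (u s)\<^sup>2 + (p s)\<^sup>2" for s
          by (rule two_mult_le_squares)
      qed (use t in \<open>auto intro!: integrable_continuous_interval continuous_intros cont_sub\<close>)
      also have "\<dots> \<le> Q" unfolding Q_def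
        by (rule integral_subset_le) (use t in \<open>auto intro!: integrable_continuous_interval continuous_intros cont_sub\<close>)
      finally show ?thesis using u0 by simp
    qed
    define L where "L x = (p x)\<^sup>2 - (Q / (2 * a) * (V x)\<^sup>2 + a / 2 * (u x)\<^sup>2)" for x
    have "(L has_integral (N R - (Q / (2 * a) * integral {0..R} (\<lambda>x. (V x)\<^sup>2) + a / 2 * integral {0..R} (\<lambda>x. (u x)\<^sup>2)))) {0..R}"
      unfolding L_def N_def
      by (intro has_integral_diff has_integral_add has_integral_mult_right integrable_integral iu ip V2_sub) auto
    moreover have "((\<lambda>x. p x * p x + u x * ((V x + k\<^sup>2) * u x)) has_integral (u R * p R - u 0 * p 0)) {0..R}"
      by (rule ac_deriv_FTC[OF up order_refl R])
    ultimately have "N R - (Q / (2 * a) * integral {0..R} (\<lambda>x. (V x)\<^sup>2) + a / 2 * integral {0..R} (\<lambda>x. (u x)\<^sup>2)) \<le> u R * p R - u 0 * p 0"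
    proof (rule has_integral_le)
      fix t assume t: "t \<in> {0..R}"
      have "2 * a * \<bar>V t\<bar> \<le> (V t)\<^sup>2 + a\<^sup>2" using sum_squares_bound[of "\<bar>V t\<bar>" a] by (simp add: mult_ac)
      then have "\<bar>V t\<bar> \<le> (V t)\<^sup>2 / (2 * a) + a / 2" using a by (simp add: field_simps power2_eq_square)
      then have "\<bar>V t\<bar> * (u t)\<^sup>2 \<le> ((V t)\<^sup>2 / (2 * a) + a / 2) * (u t)\<^sup>2" by (intro mult_right_mono) auto
      also have "\<dots> = (V t)\<^sup>2 / (2 * a) * (u t)\<^sup>2 + a / 2 * (u t)\<^sup>2" by (simp add: algebra_simps)
      also have "\<dots> \<le> (V t)\<^sup>2 / (2 * a) * Q + a / 2 * (u t)\<^sup>2"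
        using uQ[of t] t a by (intro add_mono mult_left_mono) auto
      finally have 1: "\<bar>V t\<bar> * (u t)\<^sup>2 \<le> Q / (2 * a) * (V t)\<^sup>2 + a / 2 * (u t)\<^sup>2" by (simp add: mult.commute)
      have "- (\<bar>V t\<bar> * (u t)\<^sup>2) \<le> V t * (u t)\<^sup>2"
        using mult_right_mono[of "- \<bar>V t\<bar>" "V t" "(u t)\<^sup>2"] by simp
      moreover have "p t * p t + u t * ((V t + k\<^sup>2) * u t) = (p t)\<^sup>2 + V t * (u t)\<^sup>2 + k\<^sup>2 * (u t)\<^sup>2"
        by (simp add: power2_eq_square algebra_simps)
      moreover have "k\<^sup>2 * (u t)\<^sup>2 \<ge> 0" by simp
      ultimately show "L t \<le> p t * p t + u t * ((V t + k\<^sup>2) * u t)" using 1 unfolding L_def by linarith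
    qed
    moreover have "Q / (2 * a) * integral {0..R} (\<lambda>x. (V x)\<^sup>2) \<le> Q / 4"
    proof -
      have "Q \<ge> 0" using uQ[of 0] R u0 by auto
      then have "Q / (2 * a) * integral {0..R} (\<lambda>x. (V x)\<^sup>2) \<le> Q / (2 * a) * (a / 2)"
        using v0[OF R] a by (intro mult_left_mono) (auto simp: a_def)
      then show ?thesis using a by simp
    qed
    moreover have "a / 2 * integral {0..R} (\<lambda>x. (u x)\<^sup>2) \<le> (v0 + 1) * U"
    proof -
      have "a / 2 = v0 + 1" by (simp add: a_def)
      moreover have "a / 2 * integral {0..R} (\<lambda>x. (u x)\<^sup>2) \<le> a / 2 * U"
        by (rule mult_left_mono[OF U(2)[OF R]]) (use a in simp)
      ultimately show ?thesis by (simp only:)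
    qed
    moreover have "u 0 * p 0 = 0" by (simp add: u0)
    ultimately show ?thesis using Q unfolding C_def by linarith
  qed
  have Nmono: "N x \<le> N y" if "0 \<le> x" "x \<le> y" for x y unfolding N_def
    by (rule integral_subset_le) (use that in \<open>auto intro!: integrable_continuous_interval continuous_intros cont_sub\<close>)
  \<comment> \<open>At this threshold the lower bound \<open>3/4 * N R - C\<close> equals 1.\<close>
  have bdd: "N R \<le> 4/3 * (C + 1)" if "0 \<le> R" for R
  proof (rule ccontr)
    assume "\<not> N R \<le> 4/3 * (C + 1)"
    then have up1: "u x * p x \<ge> 1" if "R \<le> x" for x
      using lower[of x] Nmono[OF \<open>0 \<le> R\<close> that] that \<open>0 \<le> R\<close> by auto
    have "(u x)\<^sup>2 \<ge> 1" if x: "R + 1 \<le> x" for x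
    proof -
      have I2: "((\<lambda>t. 2 * u t * p t) has_integral ((u x)\<^sup>2 - (u R)\<^sup>2)) {R..x}"
        by (rule ac_deriv_FTC[OF u_square]) (use x \<open>0 \<le> R\<close> in auto)
      have I1: "((\<lambda>t. 1) has_integral (x - R)) {R..x}"
        using has_integral_const_real[of "1::real" R x] x by simp
      have "x - R \<le> (u x)\<^sup>2 - (u R)\<^sup>2"
        by (rule has_integral_le[OF I1 I2]) (use up1 in force)
      then show ?thesis using x zero_le_power2[of "u R"] by linarith
    qed
    then show False
      using integrable_on_atLeast_lower_bound[OF u2, of 1] eventually_at_top_linorderI[of "R + 1" "\<lambda>x. 1 \<le> (u x)\<^sup>2"] by auto
  qed
  show ?thesis
    by (rule nonneg_bounded_imp_integrable_on_atLeast(1)[OF _ _ bdd[unfolded N_def]])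
       (auto intro!: integrable_continuous_interval continuous_intros cont_sub)
qed

lemma u2p2: "(\<lambda>x. (u x)\<^sup>2 + (p x)\<^sup>2) integrable_on {0..}"
  by (intro integrable_add u2 p2)

lemma u_square_tendsto: "((\<lambda>x. (u x)\<^sup>2) \<longlongrightarrow> 0) at_top"
proof -
  obtain l where l: "((\<lambda>x. (u x)\<^sup>2) \<longlongrightarrow> l) at_top"
    by (rule ac_deriv_convergent_at_top[OF u_square u2p2 two_mult_le_squares])
  then show ?thesis using integrable_tendsto_imp_0[OF u2 _ l] by simp
qed

text \<open>Since \<open>u\<close> is bounded, \<open>(V u)^2\<close> is dominated by a multiple of
  \<open>V^2\<close>, so the derivative of \<open>p^2\<close> has an integrable majorant and
  \<open>p^2\<close> converges.\<close>

lemma p_square_tendsto: "((\<lambda>x. (p x)\<^sup>2) \<longlongrightarrow> 0) at_top"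
proof -
  define Q where "Q = integral {0..} (\<lambda>x. (u x)\<^sup>2 + (p x)\<^sup>2)"
  have uQ: "(u t)\<^sup>2 \<le> Q" if t: "0 \<le> t" for t
  proof -
    have "\<bar>(u t)\<^sup>2\<bar> \<le> integral {t..} (\<lambda>x. (u x)\<^sup>2 + (p x)\<^sup>2)"
      by (rule ac_deriv_tail_bound[OF u_square _ two_mult_le_squares t u_square_tendsto])
         (rule nonneg_integrable_on_atLeast_subset(1)[OF u2p2 _ t], simp)
    also have "\<dots> \<le> Q"
      using integral_atLeast_split[OF u2p2 _ order_refl t] integral_atLeast_nonneg(2)[OF u2p2 _ order_refl, of t] by (simp add: Q_def)
    finally show ?thesis by simp
  qed
  obtain l where l: "((\<lambda>x. (p x)\<^sup>2) \<longlongrightarrow> l) at_top"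
  proof (rule ac_deriv_convergent_at_top[OF ac_deriv_power2[OF p], where g = "\<lambda>x. k\<^sup>2 * ((u x)\<^sup>2 + (p x)\<^sup>2) + (Q * (V x)\<^sup>2 + (p x)\<^sup>2)"])
    show "(\<lambda>x. k\<^sup>2 * ((u x)\<^sup>2 + (p x)\<^sup>2) + (Q * (V x)\<^sup>2 + (p x)\<^sup>2)) integrable_on {0..}"
      by (intro integrable_add integrable_on_mult_right u2 p2 V2)
    fix t :: real assume t: "0 \<le> t"
    have "\<bar>2 * p t * ((V t + k\<^sup>2) * u t)\<bar> = \<bar>k\<^sup>2 * (2 * u t * p t) + 2 * (V t * u t) * p t\<bar>"
      by (simp add: algebra_simps)
    also have "\<dots> \<le> \<bar>k\<^sup>2 * (2 * u t * p t)\<bar> + \<bar>2 * (V t * u t) * p t\<bar>" by (rule abs_triangle_ineq)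
    also have "\<bar>k\<^sup>2 * (2 * u t * p t)\<bar> \<le> k\<^sup>2 * ((u t)\<^sup>2 + (p t)\<^sup>2)"
      using mult_left_mono[OF two_mult_le_squares[of "u t" "p t"], of "k\<^sup>2"] by (simp add: abs_mult)
    also have "\<bar>2 * (V t * u t) * p t\<bar> \<le> (V t * u t)\<^sup>2 + (p t)\<^sup>2"
      by (rule two_mult_le_squares)
    also have "(V t * u t)\<^sup>2 \<le> Q * (V t)\<^sup>2"
      using mult_right_mono[OF uQ[OF t], of "(V t)\<^sup>2"] by (simp add: power_mult_distrib mult.commute)
    finally show "\<bar>2 * p t * ((V t + k\<^sup>2) * u t)\<bar> \<le> k\<^sup>2 * ((u t)\<^sup>2 + (p t)\<^sup>2) + (Q * (V t)\<^sup>2 + (p t)\<^sup>2)"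
      by simp
  qed
  then show ?thesis using integrable_tendsto_imp_0[OF p2 _ l] by simp
qed

lemma tendsto_0: "(u \<longlongrightarrow> 0) at_top" "(p \<longlongrightarrow> 0) at_top"
  using u_square_tendsto p_square_tendsto by (simp_all add: power_tendsto_0_iff)

section \<open>Limit ratios relative to the energy tail\<close>

definition energy :: "real \<Rightarrow> real" where "energy t = (p t)\<^sup>2 + k\<^sup>2 * (u t)\<^sup>2"

text \<open>The energy vanishes only where both \<open>u\<close> and \<open>p\<close> do, so
  positivity of \<open>M\<close> follows from uniqueness at once, and \<open>M\<close> controls
  \<open>u^2\<close>, \<open>u p\<close> and \<open>p^2\<close> together. It is therefore the
  yardstick, and \<open>G\<close> is compared with it afterwards.\<close>

definition M :: "real \<Rightarrow> real" where "M x = integral {x..} energy"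

definition G :: "real \<Rightarrow> real" where "G x = integral {x..} (\<lambda>t. (u t)\<^sup>2)"

lemma energy_nonneg: "energy t \<ge> 0"
  by (simp add: energy_def)

lemma energy_integrable: "energy integrable_on {0..}"
  unfolding energy_def[abs_def] by (intro integrable_add integrable_on_mult_right u2 p2)

lemma cont_energy: "continuous_on {0..} energy"
  unfolding energy_def[abs_def] by (intro continuous_intros cont)

lemma energy_sub: "0 \<le> x \<Longrightarrow> energy integrable_on {x..}"
  using nonneg_integrable_on_atLeast_subset(1)[OF energy_integrable energy_nonneg] by auto

lemma M_deriv: "ac_deriv M (\<lambda>x. - energy x)"
  unfolding M_def[abs_def] by (rule ac_deriv_tail_integral[OF energy_integrable energy_nonneg cont_energy])

lemma G_deriv: "ac_deriv G (\<lambda>x. - (u x)\<^sup>2)"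
  unfolding G_def[abs_def] by (rule ac_deriv_tail_integral[OF u2]) (auto intro: continuous_intros cont)

lemma M_tendsto: "(M \<longlongrightarrow> 0) at_top"
  unfolding M_def[abs_def] by (rule integral_atLeast_tendsto_0[OF energy_integrable energy_nonneg])

lemma G_tendsto: "(G \<longlongrightarrow> 0) at_top"
  unfolding G_def[abs_def] by (rule integral_atLeast_tendsto_0[OF u2]) simp

lemma M_antimono: "0 \<le> x \<Longrightarrow> x \<le> y \<Longrightarrow> M y \<le> M x"
  using integral_atLeast_split[OF energy_integrable energy_nonneg, of x y]
    integral_atLeast_nonneg(2)[OF energy_integrable energy_nonneg, of x y] by (auto simp: M_def)

lemma G_antimono: "0 \<le> x \<Longrightarrow> x \<le> y \<Longrightarrow> G y \<le> G x"
  using integral_atLeast_split[OF u2, of x y] integral_atLeast_nonneg(2)[OF u2, of x y] by (auto simp: G_def)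

lemma M_pos:
  assumes x: "0 \<le> x" shows "M x > 0"
proof -
  have "M x \<ge> 0" unfolding M_def by (rule integral_atLeast_nonneg(1)[OF energy_integrable energy_nonneg x])
  moreover have "M x \<noteq> 0"
  proof
    assume "M x = 0"
    then have "integral {x..x + 1} energy = 0"
      using integral_atLeast_split[OF energy_integrable energy_nonneg x, of "x + 1"]
        integral_atLeast_nonneg(2)[OF energy_integrable energy_nonneg, of x "x + 1"]
        integral_atLeast_nonneg(1)[OF energy_integrable energy_nonneg, of "x + 1"] x by (auto simp: M_def)
    moreover have "continuous_on {x..x + 1} energy" by (rule continuous_on_subset[OF cont_energy]) (use x in auto)
    ultimately have "\<forall>t\<in>{x..x + 1}. energy t = 0"
      using integral_eq_0_iff[of x "x + 1" energy] energy_nonneg by auto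
    then have "energy x = 0" by simp
    then show False using state_nonzero[OF x] k by (simp add: energy_def add_nonneg_eq_0_iff)
  qed
  ultimately show ?thesis by simp
qed

text \<open>This follows from \<open>2 |u p| \<le> energy / k\<close>. The bound is uniform in
  \<open>t\<close>, so on the tail from \<open>x\<close> the square of \<open>V u\<close> can be
  charged to \<open>M x\<close> times \<open>V^2\<close>.\<close>

lemma u_square_le_M:
  assumes x: "0 \<le> x" and t: "x \<le> t" shows "(u t)\<^sup>2 \<le> M x / k"
proof -
  have t0: "0 \<le> t" using x t by simp
  have "\<bar>(u t)\<^sup>2\<bar> \<le> integral {t..} (\<lambda>s. (1/k) * energy s)"
  proof (rule ac_deriv_tail_bound[OF u_square _ _ t0 u_square_tendsto])
    show "(\<lambda>s. 1 / k * energy s) integrable_on {t..}" by (intro integrable_on_mult_right energy_sub t0)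
    show "\<bar>2 * u s * p s\<bar> \<le> 1 / k * energy s" for s
    proof -
      have "\<bar>2 * (k * u s) * p s\<bar> \<le> (k * u s)\<^sup>2 + (p s)\<^sup>2"
        by (rule two_mult_le_squares)
      moreover have "\<bar>2 * (k * u s) * p s\<bar> = k * \<bar>2 * u s * p s\<bar>" using k by (simp add: abs_mult)
      ultimately have "k * \<bar>2 * u s * p s\<bar> \<le> energy s" by (simp add: energy_def power_mult_distrib)
      then show ?thesis using k by (simp add: field_simps)
    qed
  qed
  also have "\<dots> = M t / k" by (simp add: M_def)
  also have "\<dots> \<le> M x / k" using M_antimono[OF x t] k by (simp add: divide_right_mono)
  finally show ?thesis by simp
qed

text \<open>The order of choices matters: first \<open>\<theta>\<close> large to make
  \<open>c2 / \<theta>\<close> small, then \<open>x\<close> large, since for fixed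
  \<open>\<theta>\<close> the tail of the integral of \<open>V^2\<close> tends to 0. In this way
  square integrability of \<open>V\<close> yields errors that are small compared with
  \<open>M\<close>.\<close>

lemma relatively_small:
  assumes c: "c1 \<ge> 0" "c2 \<ge> 0"
    and bound: "\<And>\<theta> x. \<theta> > 0 \<Longrightarrow> 0 \<le> x \<Longrightarrow> \<bar>f x\<bar> \<le> (c1 * \<theta> * integral {x..} (\<lambda>x. (V x)\<^sup>2) + c2 / \<theta>) * M x"
  shows "((\<lambda>x. f x / M x) \<longlongrightarrow> 0) at_top"
proof (rule tendstoI)
  fix e :: real assume e: "e > 0"
  \<comment> \<open>This gives \<open>c2 / \<theta> < e / 2\<close>; the summand 1 keeps
    \<open>\<theta>\<close> positive when \<open>c2 = 0\<close>.\<close>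
  define \<theta> where "\<theta> = 2 * (c2 + 1) / e"
  have \<theta>: "\<theta> > 0" using e c by (simp add: \<theta>_def)
  have c2: "c2 / \<theta> < e / 2" using e c by (simp add: \<theta>_def field_simps)
  have "((\<lambda>x. c1 * \<theta> * integral {x..} (\<lambda>x. (V x)\<^sup>2)) \<longlongrightarrow> c1 * \<theta> * 0) at_top"
    by (intro tendsto_intros integral_atLeast_tendsto_0[OF V2]) simp
  then have "eventually (\<lambda>x. c1 * \<theta> * integral {x..} (\<lambda>x. (V x)\<^sup>2) < e / 2) at_top"
    using e by (intro order_tendstoD(2)[of _ "c1 * \<theta> * 0"]) auto
  then show "eventually (\<lambda>x. dist (f x / M x) 0 < e) at_top"
    using eventually_ge_at_top[of 0]
  proof eventually_elim
    case (elim x)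
    have "\<bar>f x\<bar> \<le> (c1 * \<theta> * integral {x..} (\<lambda>x. (V x)\<^sup>2) + c2 / \<theta>) * M x"
      using bound \<theta> elim by blast
    also have "\<dots> < e * M x"
    proof (rule mult_strict_right_mono)
      show "c1 * \<theta> * integral {x..} (\<lambda>x. (V x)\<^sup>2) + c2 / \<theta> < e" using elim(1) c2 by linarith
    qed (use M_pos elim in auto)
    finally show ?case using M_pos[of x] elim by (simp add: field_simps)
  qed
qed

lemma V_u_bound:
  assumes "0 \<le> x" "x \<le> t"
  shows "(V t)\<^sup>2 * (u t)\<^sup>2 \<le> M x / k * (V t)\<^sup>2"
  using mult_right_mono[OF u_square_le_M[OF assms], of "(V t)\<^sup>2"] by (simp add: mult.commute)

lemma tail_majorant:
  assumes "\<theta> > 0" "0 \<le> x"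
  shows "(\<lambda>t. \<theta> * (M x / k) * (V t)\<^sup>2 + c * energy t) integrable_on {x..}"
    "integral {x..} (\<lambda>t. \<theta> * (M x / k) * (V t)\<^sup>2 + c * energy t) = \<theta> * (M x / k) * integral {x..} (\<lambda>t. (V t)\<^sup>2) + c * M x"
proof -
  have i: "(\<lambda>t. \<theta> * (M x / k) * (V t)\<^sup>2) integrable_on {x..}" "(\<lambda>t. c * energy t) integrable_on {x..}"
    by (intro integrable_on_mult_right V2_sub energy_sub assms)+
  show "(\<lambda>t. \<theta> * (M x / k) * (V t)\<^sup>2 + c * energy t) integrable_on {x..}"
    by (rule integrable_add[OF i])
  show "integral {x..} (\<lambda>t. \<theta> * (M x / k) * (V t)\<^sup>2 + c * energy t) = \<theta> * (M x / k) * integral {x..} (\<lambda>t. (V t)\<^sup>2) + c * M x"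
    unfolding integral_add[OF i] by (simp add: M_def)
qed

text \<open>In the derivative of \<open>u p + M\<close> the energy cancels and only
  \<open>V u^2\<close> is left, which the weighted inequality shows to be negligible against
  \<open>M\<close>.\<close>

lemma up_over_M: "((\<lambda>x. u x * p x / M x) \<longlongrightarrow> -1) at_top"
proof -
  have f: "ac_deriv (\<lambda>x. u x * p x + M x) (\<lambda>x. V x * (u x)\<^sup>2)"
    by (rule ac_deriv_cong[OF ac_deriv_add[OF ac_deriv_mult[OF u p] M_deriv]])
       (simp add: energy_def power2_eq_square algebra_simps)
  have lim: "((\<lambda>x. u x * p x + M x) \<longlongrightarrow> 0) at_top"
    using tendsto_add[OF tendsto_mult[OF tendsto_0] M_tendsto] by simp
  have "((\<lambda>x. (u x * p x + M x) / M x) \<longlongrightarrow> 0) at_top"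
  proof (rule relatively_small)
    fix \<theta> x :: real assume \<theta>: "\<theta> > 0" and x: "0 \<le> x"
    have "\<bar>u x * p x + M x\<bar> \<le> integral {x..} (\<lambda>t. \<theta> * (M x / k) * (V t)\<^sup>2 + 1 / (\<theta> * k\<^sup>2) * energy t)"
    proof (rule ac_deriv_tail_bound[OF f tail_majorant(1)[OF \<theta> x] _ x lim])
      fix t assume t: "x \<le> t"
      have "2 * (V t * u t) * u t = 2 * (V t * (u t)\<^sup>2)" by (simp add: power2_eq_square)
      then have "\<bar>V t * (u t)\<^sup>2\<bar> \<le> \<bar>2 * (V t * u t) * u t\<bar>" by linarith
      also have "\<dots> \<le> \<theta> * (V t * u t)\<^sup>2 + (u t)\<^sup>2 / \<theta>" by (rule weighted_two_mult_le_squares[OF \<theta>])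
      also have "\<theta> * (V t * u t)\<^sup>2 \<le> \<theta> * (M x / k) * (V t)\<^sup>2"
        using mult_left_mono[OF V_u_bound[OF x t], of \<theta>] \<theta> by (simp add: power_mult_distrib mult.assoc)
      also have "(u t)\<^sup>2 / \<theta> \<le> 1 / (\<theta> * k\<^sup>2) * energy t"
        using \<theta> k by (simp add: energy_def field_simps)
      finally show "\<bar>V t * (u t)\<^sup>2\<bar> \<le> \<theta> * (M x / k) * (V t)\<^sup>2 + 1 / (\<theta> * k\<^sup>2) * energy t" by simp
    qed
    then show "\<bar>u x * p x + M x\<bar> \<le> (1 / k * \<theta> * integral {x..} (\<lambda>x. (V x)\<^sup>2) + 1 / k\<^sup>2 / \<theta>) * M x"
      unfolding tail_majorant(2)[OF \<theta> x] by (simp add: algebra_simps)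
  qed (use k in auto)
  then have "((\<lambda>x. (u x * p x + M x) / M x - 1) \<longlongrightarrow> 0 - 1) at_top" by (intro tendsto_intros)
  moreover have "eventually (\<lambda>x. (u x * p x + M x) / M x - 1 = u x * p x / M x) at_top"
  proof (rule eventually_at_top_linorderI[of 0])
    fix x :: real assume "0 \<le> x"
    then show "(u x * p x + M x) / M x - 1 = u x * p x / M x" using M_pos[of x] by (simp add: add_divide_distrib)
  qed
  ultimately show ?thesis by (simp add: tendsto_cong)
qed

text \<open>For \<open>V = 0\<close> the numerator is a conserved quantity, so its derivative
  \<open>2 V u p\<close> contains nothing but the perturbation.\<close>

lemma excess_over_M: "((\<lambda>x. ((p x)\<^sup>2 - k\<^sup>2 * (u x)\<^sup>2) / M x) \<longlongrightarrow> 0) at_top"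
proof -
  have f: "ac_deriv (\<lambda>x. (p x)\<^sup>2 - k\<^sup>2 * (u x)\<^sup>2) (\<lambda>x. 2 * (V x * u x) * p x)"
    by (rule ac_deriv_cong[OF ac_deriv_diff[OF ac_deriv_power2[OF p] ac_deriv_cmult[OF u_square, of "k\<^sup>2"]]])
       (simp add: power2_eq_square algebra_simps)
  have lim: "((\<lambda>x. (p x)\<^sup>2 - k\<^sup>2 * (u x)\<^sup>2) \<longlongrightarrow> 0) at_top"
    using tendsto_diff[OF p_square_tendsto tendsto_mult_left[OF u_square_tendsto, of "k\<^sup>2"]] by simp
  show ?thesis
  proof (rule relatively_small)
    fix \<theta> x :: real assume \<theta>: "\<theta> > 0" and x: "0 \<le> x"
    have "\<bar>(p x)\<^sup>2 - k\<^sup>2 * (u x)\<^sup>2\<bar> \<le> integral {x..} (\<lambda>t. \<theta> * (M x / k) * (V t)\<^sup>2 + 1 / \<theta> * energy t)"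
    proof (rule ac_deriv_tail_bound[OF f tail_majorant(1)[OF \<theta> x] _ x lim])
      fix t assume t: "x \<le> t"
      have "\<bar>2 * (V t * u t) * p t\<bar> \<le> \<theta> * (V t * u t)\<^sup>2 + (p t)\<^sup>2 / \<theta>" by (rule weighted_two_mult_le_squares[OF \<theta>])
      also have "\<theta> * (V t * u t)\<^sup>2 \<le> \<theta> * (M x / k) * (V t)\<^sup>2"
        using mult_left_mono[OF V_u_bound[OF x t], of \<theta>] \<theta> by (simp add: power_mult_distrib mult.assoc)
      also have "(p t)\<^sup>2 / \<theta> \<le> 1 / \<theta> * energy t"
        using \<theta> by (simp add: energy_def field_simps)
      finally show "\<bar>2 * (V t * u t) * p t\<bar> \<le> \<theta> * (M x / k) * (V t)\<^sup>2 + 1 / \<theta> * energy t" by simp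
    qed
    then show "\<bar>(p x)\<^sup>2 - k\<^sup>2 * (u x)\<^sup>2\<bar> \<le> (1 / k * \<theta> * integral {x..} (\<lambda>x. (V x)\<^sup>2) + 1 / \<theta>) * M x"
      unfolding tail_majorant(2)[OF \<theta> x] by (simp add: algebra_simps)
  qed (use k in auto)
qed

text \<open>The identity \<open>energy^2 = (p^2 - k^2 u^2)^2 + 4 k^2 (u p)^2\<close> recovers this
  ratio from the two already known; \<open>energy \<ge> 0\<close> fixes the sign of the
  root.\<close>

lemma energy_over_M: "((\<lambda>x. energy x / M x) \<longlongrightarrow> 2 * k) at_top"
proof -
  have "((\<lambda>x. sqrt ((((p x)\<^sup>2 - k\<^sup>2 * (u x)\<^sup>2) / M x)\<^sup>2 + 4 * k\<^sup>2 * (u x * p x / M x)\<^sup>2)) \<longlongrightarrow> sqrt (0\<^sup>2 + 4 * k\<^sup>2 * (-1)\<^sup>2)) at_top"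
    by (intro tendsto_intros excess_over_M up_over_M)
  moreover have "sqrt (0\<^sup>2 + 4 * k\<^sup>2 * (-1)\<^sup>2) = 2 * k" using k by (simp add: real_sqrt_mult)
  moreover have "eventually (\<lambda>x. sqrt ((((p x)\<^sup>2 - k\<^sup>2 * (u x)\<^sup>2) / M x)\<^sup>2 + 4 * k\<^sup>2 * (u x * p x / M x)\<^sup>2) = energy x / M x) at_top"
  proof (rule eventually_at_top_linorderI[of 0])
    fix x :: real assume x: "0 \<le> x"
    have "(((p x)\<^sup>2 - k\<^sup>2 * (u x)\<^sup>2) / M x)\<^sup>2 + 4 * k\<^sup>2 * (u x * p x / M x)\<^sup>2
        = (((p x)\<^sup>2 - k\<^sup>2 * (u x)\<^sup>2)\<^sup>2 + 4 * k\<^sup>2 * (u x * p x)\<^sup>2) / (M x)\<^sup>2"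
      by (simp add: power_divide add_divide_distrib)
    also have "((p x)\<^sup>2 - k\<^sup>2 * (u x)\<^sup>2)\<^sup>2 + 4 * k\<^sup>2 * (u x * p x)\<^sup>2 = (energy x)\<^sup>2"
      by (simp add: energy_def power2_eq_square algebra_simps)
    finally have "(((p x)\<^sup>2 - k\<^sup>2 * (u x)\<^sup>2) / M x)\<^sup>2 + 4 * k\<^sup>2 * (u x * p x / M x)\<^sup>2 = (energy x / M x)\<^sup>2"
      by (simp add: power_divide)
    then show "sqrt ((((p x)\<^sup>2 - k\<^sup>2 * (u x)\<^sup>2) / M x)\<^sup>2 + 4 * k\<^sup>2 * (u x * p x / M x)\<^sup>2) = energy x / M x"
      using energy_nonneg[of x] M_pos[OF x] by simp
  qed
  ultimately show ?thesis by (simp add: tendsto_cong)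
qed

lemma u_square_over_M: "((\<lambda>x. (u x)\<^sup>2 / M x) \<longlongrightarrow> 1 / k) at_top"
proof -
  have "((\<lambda>x. (energy x / M x - ((p x)\<^sup>2 - k\<^sup>2 * (u x)\<^sup>2) / M x) / (2 * k\<^sup>2)) \<longlongrightarrow> (2 * k - 0) / (2 * k\<^sup>2)) at_top"
    using k by (intro tendsto_intros excess_over_M energy_over_M) auto
  moreover have "(energy x / M x - ((p x)\<^sup>2 - k\<^sup>2 * (u x)\<^sup>2) / M x) / (2 * k\<^sup>2) = (u x)\<^sup>2 / M x" for x
    using k by (simp add: energy_def diff_divide_distrib[symmetric])
  ultimately show ?thesis using k by (simp add: power2_eq_square)
qed

lemma p_square_over_M: "((\<lambda>x. (p x)\<^sup>2 / M x) \<longlongrightarrow> k) at_top"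
proof -
  have "((\<lambda>x. (energy x / M x + ((p x)\<^sup>2 - k\<^sup>2 * (u x)\<^sup>2) / M x) / 2) \<longlongrightarrow> (2 * k + 0) / 2) at_top"
    by (intro tendsto_intros excess_over_M energy_over_M) auto
  moreover have "(energy x / M x + ((p x)\<^sup>2 - k\<^sup>2 * (u x)\<^sup>2) / M x) / 2 = (p x)\<^sup>2 / M x" for x
    by (simp add: energy_def add_divide_distrib[symmetric])
  ultimately show ?thesis by simp
qed

text \<open>The derivative of \<open>M - 2 k^2 G\<close> is minus the excess
  \<open>p^2 - k^2 u^2\<close>, which is eventually at most \<open>e\<close> times the energy.
  Integrating over the tail bounds the difference by \<open>e * M x\<close>.\<close>

lemma G_over_M: "((\<lambda>x. G x / M x) \<longlongrightarrow> 1 / (2 * k\<^sup>2)) at_top"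
proof -
  have f: "ac_deriv (\<lambda>x. M x - 2 * k\<^sup>2 * G x) (\<lambda>x. - ((p x)\<^sup>2 - k\<^sup>2 * (u x)\<^sup>2))"
    by (rule ac_deriv_cong[OF ac_deriv_diff[OF M_deriv ac_deriv_cmult[OF G_deriv]]])
       (simp add: energy_def)
  have flim: "((\<lambda>x. M x - 2 * k\<^sup>2 * G x) \<longlongrightarrow> 0) at_top"
    using tendsto_diff[OF M_tendsto tendsto_mult_left[OF G_tendsto, of "2 * k\<^sup>2"]] by simp
  have ratio: "((\<lambda>x. ((p x)\<^sup>2 - k\<^sup>2 * (u x)\<^sup>2) / M x / (energy x / M x)) \<longlongrightarrow> 0 / (2 * k)) at_top"
    using k by (intro tendsto_intros excess_over_M energy_over_M) auto
  have "((\<lambda>x. (M x - 2 * k\<^sup>2 * G x) / M x) \<longlongrightarrow> 0) at_top"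
  proof (rule tendstoI)
    fix e' :: real assume "e' > 0"
    define e where "e = e' / 2"
    have e: "e > 0" "e < e'" using \<open>e' > 0\<close> by (auto simp: e_def)
    have "eventually (\<lambda>x. dist (((p x)\<^sup>2 - k\<^sup>2 * (u x)\<^sup>2) / M x / (energy x / M x)) (0 / (2 * k)) < e) at_top"
      using tendstoD[OF ratio e(1)] .
    moreover have "eventually (\<lambda>x. energy x / M x > 0) at_top"
      using order_tendstoD(1)[OF energy_over_M, of 0] k by simp
    ultimately have "eventually (\<lambda>x. \<bar>(p x)\<^sup>2 - k\<^sup>2 * (u x)\<^sup>2\<bar> \<le> e * energy x) at_top"
      using eventually_ge_at_top[of 0]
    proof eventually_elim
      case (elim x)
      have M: "M x > 0" using M_pos elim by blast
      then have en: "energy x > 0" using elim by (simp add: zero_less_divide_iff)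
      have "\<bar>(p x)\<^sup>2 - k\<^sup>2 * (u x)\<^sup>2\<bar> / energy x < e" using elim(1) M en by (simp add: abs_divide)
      then show ?case using en by (simp add: field_simps)
    qed
    then obtain x0 where x0: "\<And>x. x0 \<le> x \<Longrightarrow> \<bar>(p x)\<^sup>2 - k\<^sup>2 * (u x)\<^sup>2\<bar> \<le> e * energy x"
      by (auto simp: eventually_at_top_linorder)
    show "eventually (\<lambda>x. dist ((M x - 2 * k\<^sup>2 * G x) / M x) 0 < e') at_top"
    proof (rule eventually_at_top_linorderI[of "max 0 x0"])
      fix x assume "max 0 x0 \<le> x"
      then have x: "0 \<le> x" "x0 \<le> x" by auto
      have "\<bar>M x - 2 * k\<^sup>2 * G x\<bar> \<le> integral {x..} (\<lambda>t. e * energy t)"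
        by (rule ac_deriv_tail_bound[OF f _ _ x(1) flim])
           (use x x0 in \<open>auto intro!: integrable_on_mult_right energy_sub simp: abs_minus_commute\<close>)
      also have "\<dots> = e * M x" by (simp add: M_def)
      also have "\<dots> < e' * M x" using e M_pos[OF x(1)] by simp
      finally show "dist ((M x - 2 * k\<^sup>2 * G x) / M x) 0 < e'" using M_pos[OF x(1)] by (simp add: field_simps)
    qed
  qed
  then have "((\<lambda>x. (1 - (M x - 2 * k\<^sup>2 * G x) / M x) / (2 * k\<^sup>2)) \<longlongrightarrow> (1 - 0) / (2 * k\<^sup>2)) at_top"
    using k by (intro tendsto_intros) auto
  moreover have "eventually (\<lambda>x. (1 - (M x - 2 * k\<^sup>2 * G x) / M x) / (2 * k\<^sup>2) = G x / M x) at_top"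
  proof (rule eventually_at_top_linorderI[of 0])
    fix x :: real assume "0 \<le> x"
    then show "(1 - (M x - 2 * k\<^sup>2 * G x) / M x) / (2 * k\<^sup>2) = G x / M x"
      using M_pos[of x] k by (simp add: diff_divide_distrib)
  qed
  ultimately show ?thesis by (simp add: tendsto_cong)
qed

text \<open>Far out, positivity is read off from the limit of \<open>G / M\<close>; monotonicity of
  \<open>G\<close> carries it back to every \<open>x\<close>.\<close>

lemma G_pos:
  assumes x: "0 \<le> x" shows "G x > 0"
proof -
  have "eventually (\<lambda>y. G y / M y > 0) at_top"
    using order_tendstoD(1)[OF G_over_M, of 0] k by simp
  then obtain y0 where y0: "\<And>y. y0 \<le> y \<Longrightarrow> G y / M y > 0" by (auto simp: eventually_at_top_linorder)
  define y where "y = max x y0"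
  have "M y > 0" using x by (intro M_pos) (simp add: y_def)
  then have "G y > 0" using y0[of y] by (simp add: y_def zero_less_divide_iff)
  then show ?thesis using G_antimono[OF x, of y] by (simp add: y_def)
qed

section \<open>The transformed potential and the integral of its square\<close>

definition H :: "real \<Rightarrow> real" where "H x = inverse (G x)"

lemma H_deriv: "ac_deriv H (\<lambda>x. (u x)\<^sup>2 * (H x)\<^sup>2)"
  using ac_deriv_inverse[OF G_deriv G_pos] unfolding H_def[abs_def] by simp

lemma over_G_limits:
  "((\<lambda>x. (u x)\<^sup>2 * H x) \<longlongrightarrow> 2 * k) at_top"
  "((\<lambda>x. u x * p x * H x) \<longlongrightarrow> - 2 * k\<^sup>2) at_top"
  "((\<lambda>x. (p x)\<^sup>2 * H x) \<longlongrightarrow> 2 * k ^ 3) at_top"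
proof -
  have *: "((\<lambda>x. f x * H x) \<longlongrightarrow> c / (1 / (2 * k\<^sup>2))) at_top" if "((\<lambda>x. f x / M x) \<longlongrightarrow> c) at_top" for f c
  proof -
    have "((\<lambda>x. (f x / M x) / (G x / M x)) \<longlongrightarrow> c / (1 / (2 * k\<^sup>2))) at_top"
      using k by (intro tendsto_divide that G_over_M) auto
    moreover have "eventually (\<lambda>x. (f x / M x) / (G x / M x) = f x * H x) at_top"
    proof (rule eventually_at_top_linorderI[of 0])
      fix x :: real assume "0 \<le> x"
      then show "(f x / M x) / (G x / M x) = f x * H x"
        using M_pos[of x] by (simp add: H_def divide_inverse)
    qed
    ultimately show ?thesis by (simp add: tendsto_cong)
  qed
  show "((\<lambda>x. (u x)\<^sup>2 * H x) \<longlongrightarrow> 2 * k) at_top"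
    using *[OF u_square_over_M] k by (simp add: power2_eq_square)
  show "((\<lambda>x. u x * p x * H x) \<longlongrightarrow> - 2 * k\<^sup>2) at_top"
    using *[OF up_over_M] by simp
  show "((\<lambda>x. (p x)\<^sup>2 * H x) \<longlongrightarrow> 2 * k ^ 3) at_top"
    using *[OF p_square_over_M] by (simp add: power2_eq_square power3_eq_cube mult_ac)
qed

text \<open>This is \<open>V - 2 (log G)''\<close>, the double commutation formula, with the
  derivative of \<open>u^2 H\<close> written out so that it has a value at every point.\<close>

definition W :: "real \<Rightarrow> real" where
  "W x = V x + 2 * (2 * u x * p x * H x + ((u x)\<^sup>2 * H x)\<^sup>2)"

text \<open>With \<open>F = u^2 H\<close>, \<open>a = u p H\<close> and \<open>b = p^2 H\<close> one
  has \<open>F' = 2 a + F^2\<close>, \<open>b F = a^2\<close> and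
  \<open>(W^2 - V^2) / 4 = V F' + F'^2\<close>. Differentiating \<open>b + a F\<close> gives
  \<open>(V + k^2) F' + 4 a^2 + 2 a F^2\<close>; the summand \<open>F^3 / 3\<close> completes the
  square of \<open>F'\<close>, and the last one removes \<open>k^2 F'\<close>.\<close>

definition flux :: "real \<Rightarrow> real" where
  "flux x = (p x)\<^sup>2 * H x + (u x * p x * H x) * ((u x)\<^sup>2 * H x) + ((u x)\<^sup>2 * H x) ^ 3 / 3 - k\<^sup>2 * ((u x)\<^sup>2 * H x)"

lemma flux_deriv: "ac_deriv flux (\<lambda>x. ((W x)\<^sup>2 - (V x)\<^sup>2) / 4)"
proof -
  note F = ac_deriv_mult[OF u_square H_deriv]
  note a = ac_deriv_mult[OF ac_deriv_mult[OF u p] H_deriv]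
  note b = ac_deriv_mult[OF ac_deriv_power2[OF p] H_deriv]
  note F3 = ac_deriv_cmult[OF ac_deriv_mult[OF F ac_deriv_power2[OF F]], of "1 / 3"]
  note D = ac_deriv_diff[OF ac_deriv_add[OF ac_deriv_add[OF b ac_deriv_mult[OF a F]] F3] ac_deriv_cmult[OF F, of "k\<^sup>2"]]
  have flux: "flux = (\<lambda>x. (p x)\<^sup>2 * H x + u x * p x * H x * ((u x)\<^sup>2 * H x) + 1 / 3 * ((u x)\<^sup>2 * H x * ((u x)\<^sup>2 * H x)\<^sup>2)
      - k\<^sup>2 * ((u x)\<^sup>2 * H x))"
    by (rule ext) (simp add: flux_def power3_eq_cube power2_eq_square mult.assoc)
  show ?thesis unfolding flux
    by (rule ac_deriv_cong[OF D]) (simp add: W_def power2_eq_square field_simps)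
qed

lemma flux_0: "flux 0 = H 0"
  by (simp add: flux_def u0 p0)

lemma flux_limit: "(flux \<longlongrightarrow> - (4 / 3) * k ^ 3) at_top"
proof -
  have "(flux \<longlongrightarrow> 2 * k ^ 3 + (- 2 * k\<^sup>2) * (2 * k) + (2 * k) ^ 3 / 3 - k\<^sup>2 * (2 * k)) at_top"
    unfolding flux_def[abs_def] by (intro tendsto_intros over_G_limits) auto
  moreover have "2 * k ^ 3 + (- 2 * k\<^sup>2) * (2 * k) + (2 * k) ^ 3 / 3 - k\<^sup>2 * (2 * k) = - (4 / 3) * k ^ 3"
    by (simp add: power2_eq_square power3_eq_cube)
  ultimately show ?thesis by simp
qed

lemma W_square:
  "((\<lambda>x. (W x)\<^sup>2) has_integral (integral {0..} (\<lambda>x. (V x)\<^sup>2) - 16 / 3 * k ^ 3 - 4 * H 0)) {0..}"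
proof (rule has_integral_to_inf)
  have I: "((\<lambda>x. (W x)\<^sup>2) has_integral (integral {0..y} (\<lambda>x. (V x)\<^sup>2) + 4 * (flux y - flux 0))) {0..y}" if "0 \<le> y" for y
  proof -
    have "((\<lambda>x. (V x)\<^sup>2 + 4 * (((W x)\<^sup>2 - (V x)\<^sup>2) / 4)) has_integral (integral {0..y} (\<lambda>x. (V x)\<^sup>2) + 4 * (flux y - flux 0))) {0..y}"
      by (intro has_integral_add has_integral_mult_right integrable_integral V2_sub ac_deriv_FTC[OF flux_deriv] that) auto
    moreover have "(V x)\<^sup>2 + 4 * (((W x)\<^sup>2 - (V x)\<^sup>2) / 4) = (W x)\<^sup>2" for x by (simp add: field_simps)
    ultimately show ?thesis by (simp only:)
  qed
  show "(\<lambda>x. (W x)\<^sup>2) integrable_on {0..y}" for y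
    using I[of y] by (cases "0 \<le> y") (auto simp: has_integral_iff)
  have "((\<lambda>y. integral {0..} (\<lambda>x. (V x)\<^sup>2) - integral {y..} (\<lambda>x. (V x)\<^sup>2) + 4 * (flux y - flux 0))
      \<longlongrightarrow> integral {0..} (\<lambda>x. (V x)\<^sup>2) - 0 + 4 * (- (4 / 3) * k ^ 3 - flux 0)) at_top"
    by (intro tendsto_intros integral_atLeast_tendsto_0[OF V2] flux_limit) simp
  moreover have "eventually (\<lambda>y. integral {0..} (\<lambda>x. (V x)\<^sup>2) - integral {y..} (\<lambda>x. (V x)\<^sup>2) + 4 * (flux y - flux 0)
      = integral {0..y} (\<lambda>x. (W x)\<^sup>2)) at_top"
  proof (rule eventually_at_top_linorderI[of 0])
    fix y :: real assume y: "0 \<le> y"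
    show "integral {0..} (\<lambda>x. (V x)\<^sup>2) - integral {y..} (\<lambda>x. (V x)\<^sup>2) + 4 * (flux y - flux 0) = integral {0..y} (\<lambda>x. (W x)\<^sup>2)"
      using I[OF y] integral_atLeast_split[OF V2 _ order_refl y] by (simp add: has_integral_iff)
  qed
  ultimately have "((\<lambda>y. integral {0..y} (\<lambda>x. (W x)\<^sup>2)) \<longlongrightarrow>
      integral {0..} (\<lambda>x. (V x)\<^sup>2) - 0 + 4 * (- (4 / 3) * k ^ 3 - flux 0)) at_top"
    by (rule Lim_transform_eventually)
  then show "((\<lambda>y. integral {0..y} (\<lambda>x. (W x)\<^sup>2)) \<longlongrightarrow> integral {0..} (\<lambda>x. (V x)\<^sup>2) - 16 / 3 * k ^ 3 - 4 * H 0) at_top"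
    by (simp add: flux_0 algebra_simps)
qed auto

end

section \<open>Effect of the transformation on the other bound states\<close>

locale two_bound_states = s: bound_state V k u p + t: bound_state V \<kappa> v q
  for V :: "real \<Rightarrow> real" and k \<kappa> :: real and u p v q :: "real \<Rightarrow> real" +
  assumes distinct: "k \<noteq> \<kappa>"
begin

text \<open>This multiple of the Wronskian is the integral of \<open>u v\<close> over \<open>{x..}\<close>; defined in this way its value
  at \<open>0\<close> is visibly \<open>0\<close>, which is the orthogonality of \<open>u\<close> and \<open>v\<close>.\<close>

definition g :: "real \<Rightarrow> real" where "g x = 1 / (k\<^sup>2 - \<kappa>\<^sup>2) * (u x * q x - p x * v x)"

text \<open>The double commutation transform of \<open>v\<close>. With \<open>u\<close> in place of
  \<open>v\<close> and \<open>G\<close> in place of \<open>g\<close> the formula would give 0, which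
  is how the state \<open>u\<close> disappears. The function \<open>q'\<close> below is the
  derivative of \<open>v'\<close> with those of \<open>H\<close> and \<open>g\<close>
  inserted.\<close>

definition v' :: "real \<Rightarrow> real" where "v' x = v x - u x * s.H x * g x"

definition q' :: "real \<Rightarrow> real" where
  "q' x = q x - (p x * s.H x + u x * ((u x)\<^sup>2 * (s.H x)\<^sup>2)) * g x + (u x)\<^sup>2 * s.H x * v x"

lemma squares_distinct: "k\<^sup>2 - \<kappa>\<^sup>2 \<noteq> 0"
  using distinct s.k t.k by (simp add: power2_eq_iff)

lemma g_eq: "(k\<^sup>2 - \<kappa>\<^sup>2) * g x = u x * q x - p x * v x"
  using squares_distinct by (simp add: g_def)

lemma g_deriv: "ac_deriv g (\<lambda>x. - (u x * v x))"
proof -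
  have "ac_deriv g (\<lambda>x. 1 / (k\<^sup>2 - \<kappa>\<^sup>2) * (p x * q x + u x * ((V x + \<kappa>\<^sup>2) * v x) - ((V x + k\<^sup>2) * u x * v x + p x * q x)))"
    unfolding g_def[abs_def]
    by (intro ac_deriv_cmult ac_deriv_diff ac_deriv_mult s.u s.p t.u t.p)
  then show ?thesis
  proof (rule ac_deriv_cong)
    fix x
    have "p x * q x + u x * ((V x + \<kappa>\<^sup>2) * v x) - ((V x + k\<^sup>2) * u x * v x + p x * q x) = (k\<^sup>2 - \<kappa>\<^sup>2) * - (u x * v x)"
      by (simp add: algebra_simps)
    then show "1 / (k\<^sup>2 - \<kappa>\<^sup>2) * (p x * q x + u x * ((V x + \<kappa>\<^sup>2) * v x) - ((V x + k\<^sup>2) * u x * v x + p x * q x)) = - (u x * v x)"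
      using squares_distinct by simp
  qed
qed

lemma v'_deriv: "ac_deriv v' q'"
  unfolding v'_def[abs_def]
  by (rule ac_deriv_cong[OF ac_deriv_diff[OF t.u ac_deriv_mult[OF ac_deriv_mult[OF s.u s.H_deriv] g_deriv]]])
     (simp add: q'_def power2_eq_square algebra_simps)

lemma q'_deriv: "ac_deriv q' (\<lambda>x. (s.W x + \<kappa>\<^sup>2) * v' x)"
proof -
  note pH = ac_deriv_mult[OF s.p s.H_deriv]
  note uu = ac_deriv_mult[OF s.u ac_deriv_mult[OF s.u_square ac_deriv_power2[OF s.H_deriv]]]
  note D = ac_deriv_add[OF ac_deriv_diff[OF t.p ac_deriv_mult[OF ac_deriv_add[OF pH uu] g_deriv]]
      ac_deriv_mult[OF ac_deriv_mult[OF s.u_square s.H_deriv] t.u]]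
  show ?thesis unfolding q'_def[abs_def]
  proof (rule ac_deriv_cong[OF D], goal_cases)
    case (1 x)
    \<comment> \<open>Abstracting the squares leaves a polynomial identity; the Wronskian relation
      \<open>e\<close> is the only fact about the two states that it needs.\<close>
    define K where "K = k\<^sup>2"
    define L where "L = \<kappa>\<^sup>2"
    have e: "u x * q x - p x * v x = (K - L) * g x" using g_eq[of x] by (simp add: K_def L_def)
    then show ?case
      unfolding s.W_def v'_def K_def[symmetric] L_def[symmetric] by algebra
  qed
qed

text \<open>The Wronskian form of \<open>g\<close> makes \<open>g^2 H\<close> a combination of the
  three convergent quotients of \<open>over_G_limits\<close> with \<open>q^2\<close>,
  \<open>v q\<close> and \<open>v^2\<close>, which tend to 0. This disposes of the boundary term at
  infinity in the norm of \<open>v'\<close>.\<close>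

lemma g_square_H_tendsto: "((\<lambda>x. (g x)\<^sup>2 * s.H x) \<longlongrightarrow> 0) at_top"
proof -
  have "((\<lambda>x. (1 / (k\<^sup>2 - \<kappa>\<^sup>2))\<^sup>2 * (((u x)\<^sup>2 * s.H x) * (q x)\<^sup>2 - 2 * ((u x * p x * s.H x) * (v x * q x)) + ((p x)\<^sup>2 * s.H x) * (v x)\<^sup>2))
     \<longlongrightarrow> (1 / (k\<^sup>2 - \<kappa>\<^sup>2))\<^sup>2 * ((2 * k) * 0 - 2 * ((- 2 * k\<^sup>2) * (0 * 0)) + (2 * k ^ 3) * 0)) at_top"
    by (intro tendsto_intros s.over_G_limits t.u_square_tendsto t.p_square_tendsto t.tendsto_0)
  moreover have "(1 / (k\<^sup>2 - \<kappa>\<^sup>2))\<^sup>2 * (((u x)\<^sup>2 * s.H x) * (q x)\<^sup>2 - 2 * ((u x * p x * s.H x) * (v x * q x)) + ((p x)\<^sup>2 * s.H x) * (v x)\<^sup>2)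
      = (g x)\<^sup>2 * s.H x" for x
  proof -
    have "((u x)\<^sup>2 * s.H x) * (q x)\<^sup>2 - 2 * ((u x * p x * s.H x) * (v x * q x)) + ((p x)\<^sup>2 * s.H x) * (v x)\<^sup>2
      = (u x * q x - p x * v x)\<^sup>2 * s.H x"
      by (simp add: power2_eq_square algebra_simps)
    then show ?thesis by (simp only: g_def power_mult_distrib mult.assoc)
  qed
  ultimately show ?thesis by simp
qed

text \<open>The difference \<open>v'^2 - v^2\<close> is the derivative of \<open>g^2 H\<close>,
  which vanishes at 0 by orthogonality and in the limit at infinity.\<close>

lemma v'_square: "((\<lambda>x. (v' x)\<^sup>2) has_integral integral {0..} (\<lambda>x. (v x)\<^sup>2)) {0..}"
proof (rule has_integral_to_inf)
  have D: "ac_deriv (\<lambda>x. (g x)\<^sup>2 * s.H x) (\<lambda>x. (v' x)\<^sup>2 - (v x)\<^sup>2)"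
    by (rule ac_deriv_cong[OF ac_deriv_mult[OF ac_deriv_power2[OF g_deriv] s.H_deriv]])
       (simp add: v'_def power2_eq_square algebra_simps)
  have g0: "g 0 = 0" by (simp add: g_def s.u0 t.u0)
  have v2: "(\<lambda>x. (v x)\<^sup>2) integrable_on {0..y}" for y
    using nonneg_integrable_on_atLeast_subset(2)[OF t.u2] by auto
  have I: "((\<lambda>x. (v' x)\<^sup>2) has_integral (integral {0..y} (\<lambda>x. (v x)\<^sup>2) + (g y)\<^sup>2 * s.H y)) {0..y}" if "0 \<le> y" for y
    using has_integral_add[OF integrable_integral[OF v2[of y]] ac_deriv_FTC[OF D order_refl that]] g0 by simp
  show "(\<lambda>x. (v' x)\<^sup>2) integrable_on {0..y}" for y
    using I[of y] by (cases "0 \<le> y") (auto simp: has_integral_iff)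
  have "((\<lambda>y. integral {0..} (\<lambda>x. (v x)\<^sup>2) - integral {y..} (\<lambda>x. (v x)\<^sup>2) + (g y)\<^sup>2 * s.H y)
      \<longlongrightarrow> integral {0..} (\<lambda>x. (v x)\<^sup>2) - 0 + 0) at_top"
    by (intro tendsto_intros integral_atLeast_tendsto_0[OF t.u2] g_square_H_tendsto) simp
  moreover have "eventually (\<lambda>y. integral {0..} (\<lambda>x. (v x)\<^sup>2) - integral {y..} (\<lambda>x. (v x)\<^sup>2) + (g y)\<^sup>2 * s.H y
      = integral {0..y} (\<lambda>x. (v' x)\<^sup>2)) at_top"
  proof (rule eventually_at_top_linorderI[of 0])
    fix y :: real assume y: "0 \<le> y"
    show "integral {0..} (\<lambda>x. (v x)\<^sup>2) - integral {y..} (\<lambda>x. (v x)\<^sup>2) + (g y)\<^sup>2 * s.H y = integral {0..y} (\<lambda>x. (v' x)\<^sup>2)"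
      using I[OF y] integral_atLeast_split[OF t.u2 _ order_refl y] by (simp add: has_integral_iff)
  qed
  ultimately show "((\<lambda>y. integral {0..y} (\<lambda>x. (v' x)\<^sup>2)) \<longlongrightarrow> integral {0..} (\<lambda>x. (v x)\<^sup>2)) at_top"
    by (simp add: tendsto_cong)
qed auto

lemma transformed_bound_state: "bound_state s.W \<kappa> v' q'"
proof
  show "(\<lambda>x. (s.W x)\<^sup>2) integrable_on {0..}" "(\<lambda>x. (v' x)\<^sup>2) integrable_on {0..}"
    using s.W_square v'_square by (auto simp: has_integral_iff)
  show "v' 0 = 0" "q' 0 = 1"
    by (simp_all add: v'_def q'_def g_def s.u0 t.u0 t.p0)
qed (rule t.k v'_deriv q'_deriv)+

end

text \<open>The induction generalises over potential and states because, once state \<open>i\<close>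
  is removed, its hypothesis is applied to \<open>W\<close> and the transformed states. Each removal
  is an exact balance; the inequality arises only at the end, where the square integral of the last
  potential is discarded.\<close>

lemma bound_states_inequality:
  assumes "finite S" "inj_on \<kappa> S" "\<And>j. j \<in> S \<Longrightarrow> bound_state V (\<kappa> j) (v j) (q j)"
    and "(\<lambda>x. (V x)\<^sup>2) integrable_on {0..}"
  shows "(\<Sum>j\<in>S. \<kappa> j ^ 3 + 3/4 * inverse (integral {0..} (\<lambda>x. (v j x)\<^sup>2))) \<le> 3/16 * integral {0..} (\<lambda>x. (V x)\<^sup>2)"
  using assms
proof (induction S arbitrary: V v q rule: finite_induct)
  case empty
  then show ?case by (simp add: integral_nonneg)
next
  case (insert i S)
  interpret s: bound_state V "\<kappa> i" "v i" "q i" using insert.prems by simp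
  have st: "two_bound_states V (\<kappa> i) (\<kappa> j) (v i) (q i) (v j) (q j)" if "j \<in> S" for j
  proof -
    have "\<kappa> i \<noteq> \<kappa> j" using insert.prems(1) insert.hyps(2) that by auto
    moreover have "bound_state V (\<kappa> j) (v j) (q j)" using insert.prems(2) that by simp
    ultimately show ?thesis
      by (intro two_bound_states.intro two_bound_states_axioms.intro s.bound_state_axioms)
  qed
  define v' where "v' j = two_bound_states.v' (\<kappa> i) (\<kappa> j) (v i) (q i) (v j) (q j)" for j
  define q' where "q' j = two_bound_states.q' (\<kappa> i) (\<kappa> j) (v i) (q i) (v j) (q j)" for j
  have v'2: "integral {0..} (\<lambda>x. (v' j x)\<^sup>2) = integral {0..} (\<lambda>x. (v j x)\<^sup>2)" if "j \<in> S" for j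
    using two_bound_states.v'_square[OF st[OF that]] by (simp add: v'_def has_integral_iff)
  have "(\<Sum>j\<in>S. \<kappa> j ^ 3 + 3/4 * inverse (integral {0..} (\<lambda>x. (v' j x)\<^sup>2))) \<le> 3/16 * integral {0..} (\<lambda>x. (s.W x)\<^sup>2)"
  proof (rule insert.IH)
    show "bound_state s.W (\<kappa> j) (v' j) (q' j)" if "j \<in> S" for j
      using two_bound_states.transformed_bound_state[OF st[OF that]] by (simp add: v'_def q'_def)
    show "(\<lambda>x. (s.W x)\<^sup>2) integrable_on {0..}" using s.W_square by (auto simp: has_integral_iff)
    show "inj_on \<kappa> S" using insert.prems(1) by simp
  qed
  also have "integral {0..} (\<lambda>x. (s.W x)\<^sup>2) = integral {0..} (\<lambda>x. (V x)\<^sup>2) - 16 / 3 * \<kappa> i ^ 3 - 4 * inverse (integral {0..} (\<lambda>x. (v i x)\<^sup>2))"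
    using s.W_square by (simp add: has_integral_iff s.H_def s.G_def)
  finally show ?case using insert.hyps by (simp add: v'2 algebra_simps)
qed

section \<open>The Dirichlet eigenvalues\<close>

lemma at_within_atLeast_interior: "0 < x \<Longrightarrow> at x within {0..} = at (x::real)"
  by (rule at_within_interior) auto

text \<open>\<open>D f\<close> carries information only where the derivative exists, so this gives
  the second derivative in \<open>schroedinger\<close> its meaning. The real result is applied to
  both components on \<open>{0..real n}\<close> for every \<open>n\<close>, and the countably many
  null sets are united.\<close>

lemma locally_AC_AE_differentiable:
  fixes f :: "real \<Rightarrow> complex"
  assumes "locally_AC f"
  obtains N where "negligible N" "\<And>x. 0 < x \<Longrightarrow> x \<notin> N \<Longrightarrow> (f has_vector_derivative D f x) (at x)"
proof -
  have ac: "absolutely_continuous_on {0..real n} f" for n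
    using assms by (simp add: locally_AC_def)
  have re: "absolutely_continuous_on {0..real n} (\<lambda>x. Re (f x))" for n
    by (rule absolutely_continuous_on_dominated[OF ac, where K = 1])
       (metis abs_Re_le_cmod minus_complex.simps(1) mult_1 real_norm_def)
  have "\<exists>N. negligible N \<and> (\<forall>x\<in>{0<..<real n} - N. (\<lambda>x. Re (f x)) differentiable (at x))" for n
    by (rule absolutely_continuous_on_AE_differentiable[OF re[of n]]) blast
  then obtain R where R: "\<And>n. negligible (R n)" "\<And>n x. x \<in> {0<..<real n} - R n \<Longrightarrow> (\<lambda>x. Re (f x)) differentiable (at x)"
    by metis
  have im: "absolutely_continuous_on {0..real n} (\<lambda>x. Im (f x))" for n
    by (rule absolutely_continuous_on_dominated[OF ac, where K = 1])
       (metis abs_Im_le_cmod minus_complex.simps(2) mult_1 real_norm_def)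
  have "\<exists>N. negligible N \<and> (\<forall>x\<in>{0<..<real n} - N. (\<lambda>x. Im (f x)) differentiable (at x))" for n
    by (rule absolutely_continuous_on_AE_differentiable[OF im[of n]]) blast
  then obtain I where I: "\<And>n. negligible (I n)" "\<And>n x. x \<in> {0<..<real n} - I n \<Longrightarrow> (\<lambda>x. Im (f x)) differentiable (at x)"
    by metis
  show thesis
  proof
    show "negligible (\<Union>n. R n \<union> I n)" using R(1) I(1) by (intro negligible_Union_nat) auto
    fix x assume x: "0 < x" "x \<notin> (\<Union>n. R n \<union> I n)"
    obtain n where "x < real n" using reals_Archimedean2 by blast
    then obtain a b where "((\<lambda>x. Re (f x)) has_real_derivative a) (at x)" "((\<lambda>x. Im (f x)) has_real_derivative b) (at x)"
      using R(2)[of x n] I(2)[of x n] x by (auto simp: real_differentiable_def)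
    then have "(f has_vector_derivative Complex a b) (at x)"
      by (simp add: has_vector_derivative_complex_iff)
    then show "(f has_vector_derivative D f x) (at x)"
      unfolding D_def at_within_atLeast_interior[OF x(1)] by (metis vector_derivative_at)
  qed
qed

text \<open>The equation is linear with real coefficients, so it passes to the real part of any
  complex multiple. The choices 1 and \<open>\<i>\<close> of \<open>w\<close> give the components of
  \<open>\<phi>\<close> up to sign, and the inverse of \<open>D \<phi> 0\<close> gives the
  normalised state.\<close>

lemma eigenfunction_real_part:
  assumes eig: "eigenfunction V \<mu> \<phi>"
  shows "ac_deriv (\<lambda>x. Re (w * \<phi> x)) (\<lambda>x. Re (w * D \<phi> x))"
    "ac_deriv (\<lambda>x. Re (w * D \<phi> x)) (\<lambda>x. (V x - \<mu>) * Re (w * \<phi> x))"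
proof -
  have diff: "\<phi> differentiable (at x within {0..})" if "0 \<le> x" for x
    using eig that by (auto simp: eigenfunction_def dirichlet_domain_def)
  have ac: "locally_AC \<phi>" "locally_AC (D \<phi>)"
    using eig by (auto simp: eigenfunction_def dirichlet_domain_def)
  have AC: "locally_AC (\<lambda>x. Re (w * f x))" if "locally_AC f" for f
    unfolding locally_AC_def
  proof (intro allI impI)
    fix b :: real assume "0 \<le> b"
    then have "absolutely_continuous_on {0..b} f" using that by (simp add: locally_AC_def)
    then show "absolutely_continuous_on {0..b} (\<lambda>x. Re (w * f x))"
    proof (rule absolutely_continuous_on_dominated[where K = "norm w"])
      show "norm (Re (w * f x) - Re (w * f y)) \<le> norm w * norm (f x - f y)" for x y
      proof -
        have "Re (w * f x) - Re (w * f y) = Re (w * (f x - f y))" by (simp add: algebra_simps)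
        then show ?thesis using abs_Re_le_cmod[of "w * (f x - f y)"] by (simp only: real_norm_def norm_mult)
      qed
    qed
  qed
  have Re_deriv: "((\<lambda>x. Re (w * f x)) has_real_derivative Re (w * f')) (at x)"
    if "(f has_vector_derivative f') (at x)" for f f' x
    using has_vector_derivative_mult_right[OF that, of w] by (simp add: has_vector_derivative_complex_iff)
  show "ac_deriv (\<lambda>x. Re (w * \<phi> x)) (\<lambda>x. Re (w * D \<phi> x))"
  proof (rule ac_derivI[OF AC[OF ac(1)] negligible_empty])
    fix x :: real assume "0 < x"
    then have "(\<phi> has_vector_derivative D \<phi> x) (at x)"
      using diff[of x] at_within_atLeast_interior[of x] vector_derivative_works unfolding D_def by fastforce
    then show "((\<lambda>x. Re (w * \<phi> x)) has_real_derivative Re (w * D \<phi> x)) (at x)" by (rule Re_deriv)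
  qed
  \<comment> \<open>\<open>N\<close> contains the points where \<open>D (D \<phi>)\<close> is not a
    genuine derivative, \<open>N'\<close> below those where the eigenvalue equation fails.\<close>
  obtain N where N: "negligible N" "\<And>x. 0 < x \<Longrightarrow> x \<notin> N \<Longrightarrow> (D \<phi> has_vector_derivative D (D \<phi>) x) (at x)"
    using locally_AC_AE_differentiable[OF ac(2)] by blast
  have "AE x in lebesgue. x \<in> {0<..} \<longrightarrow> schroedinger V \<phi> x = complex_of_real \<mu> * \<phi> x"
    using eig by (subst AE_restrict_space_iff[symmetric]) (auto simp: eigenfunction_def)
  then obtain N' where N': "negligible N'" "\<And>x. 0 < x \<Longrightarrow> x \<notin> N' \<Longrightarrow> schroedinger V \<phi> x = complex_of_real \<mu> * \<phi> x"
    unfolding eventually_ae_filter_negligible by blast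
  show "ac_deriv (\<lambda>x. Re (w * D \<phi> x)) (\<lambda>x. (V x - \<mu>) * Re (w * \<phi> x))"
  proof (rule ac_derivI[OF AC[OF ac(2)], where N = "N \<union> N'"])
    fix x :: real assume x: "0 < x" "x \<notin> N \<union> N'"
    have "D (D \<phi>) x = complex_of_real (V x - \<mu>) * \<phi> x"
      using N'(2)[of x] x by (simp add: schroedinger_def algebra_simps)
    then have "w * D (D \<phi>) x = complex_of_real (V x - \<mu>) * (w * \<phi> x)"
      by (simp only: mult.left_commute)
    moreover have "Re (complex_of_real r * z) = r * Re z" for r z by simp
    ultimately have "Re (w * D (D \<phi>) x) = (V x - \<mu>) * Re (w * \<phi> x)" by (simp only:)
    then show "((\<lambda>x. Re (w * D \<phi> x)) has_real_derivative (V x - \<mu>) * Re (w * \<phi> x)) (at x)"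
      using Re_deriv[OF N(2)[of x]] x by simp
  qed (use N N' in auto)
qed

lemma integrable_half_line_has_integral:
  fixes f :: "real \<Rightarrow> real"
  assumes "integrable half_line f"
  shows "(f has_integral integral\<^sup>L half_line f) {0..}"
proof -
  have "(f has_integral integral\<^sup>L half_line f) {0<..}"
    using assms by (rule has_integral_integral_lebesgue_on) auto
  then show ?thesis
    by (subst has_integral_spike_set_eq[of _ "{0<..}"]) (auto intro: negligible_subset[of "{0}"])
qed

text \<open>An eigenfunction is a complex multiple of a real one, because the imaginary part of
  \<open>inverse c * \<phi> x\<close> solves the equation with zero initial data. Dividing by
  \<open>c\<close> gives slope 1 at 0 and turns the boundary ratio into the reciprocal of a squared
  norm.\<close>

lemma eigenfunction_bound_state:
  assumes V: "V \<in> L2 half_line" and eig: "eigenfunction V \<mu> \<phi>" and \<mu>: "\<mu> < 0"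
  defines "c \<equiv> D \<phi> 0"
  shows "bound_state V (sqrt (- \<mu>)) (\<lambda>x. Re (inverse c * \<phi> x)) (\<lambda>x. Re (inverse c * D \<phi> x))"
    and "(norm c)\<^sup>2 / (L2_norm half_line \<phi>)\<^sup>2 = inverse (integral {0..} (\<lambda>x. (Re (inverse c * \<phi> x))\<^sup>2))"
proof -
  have V2: "(\<lambda>x. (V x)\<^sup>2) integrable_on {0..}"
    using integrable_half_line_has_integral[of "\<lambda>x. (V x)\<^sup>2"] V by (auto simp: L2_def)
  note re = eigenfunction_real_part[OF eig]
  have \<phi>0: "\<phi> 0 = 0" using eig by (auto simp: eigenfunction_def dirichlet_domain_def)
  have unique: "Re (w * \<phi> x) = 0" if "Re (w * c) = 0" "0 \<le> x" for w x
    using schroedinger_unique[OF V2 re(1)[of w] re(2)[of w, unfolded diff_conv_add_uminus] order_refl _ _ that(2)] that \<phi>0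
    by (simp add: c_def)
  have c0: "c \<noteq> 0"
  proof
    assume "c = 0"
    then have "\<phi> x = 0" if "0 \<le> x" for x
      using unique[of 1 x] unique[of "\<i>" x] that by (simp add: complex_eq_iff)
    then have "AE x in half_line. \<phi> x = 0" by (intro AE_I2) auto
    then show False using eig by (simp add: eigenfunction_def)
  qed
  define u where "u x = Re (inverse c * \<phi> x)" for x
  have \<phi>u: "\<phi> x = c * complex_of_real (u x)" if "0 \<le> x" for x
  proof -
    \<comment> \<open>The left side is the imaginary part of \<open>inverse c * \<phi> x\<close>;
      for this \<open>w\<close> the product \<open>w * c\<close> is \<open>- \<i>\<close>, whose
      real part is 0 as \<open>unique\<close> demands.\<close>
    have "Re (- \<i> * inverse c * \<phi> x) = 0" using c0 by (intro unique that) (simp add: mult.assoc)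
    then have "Im (inverse c * \<phi> x) = 0" by (simp add: mult.assoc)
    then have "inverse c * \<phi> x = complex_of_real (u x)" by (simp add: complex_eq_iff u_def)
    then show ?thesis using c0 by (metis mult.left_commute mult_cancel_left1 left_inverse mult.assoc right_inverse mult_1)
  qed
  have "integrable half_line (\<lambda>x. (norm (\<phi> x))\<^sup>2)"
    using eig by (auto simp: eigenfunction_def dirichlet_domain_def L2_def)
  then have "((\<lambda>x. (norm (\<phi> x))\<^sup>2) has_integral (L2_norm half_line \<phi>)\<^sup>2) {0..}"
    using integrable_half_line_has_integral[of "\<lambda>x. (norm (\<phi> x))\<^sup>2"] by (simp add: L2_norm_def)
  then have "((\<lambda>x. (norm (\<phi> x))\<^sup>2 / (norm c)\<^sup>2) has_integral (L2_norm half_line \<phi>)\<^sup>2 / (norm c)\<^sup>2) {0..}"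
    by (rule has_integral_divide)
  then have I: "((\<lambda>x. (u x)\<^sup>2) has_integral (L2_norm half_line \<phi>)\<^sup>2 / (norm c)\<^sup>2) {0..}"
    by (rule has_integral_eq[rotated]) (use c0 \<phi>u in \<open>simp add: norm_mult power_mult_distrib\<close>)
  show "bound_state V (sqrt (- \<mu>)) (\<lambda>x. Re (inverse c * \<phi> x)) (\<lambda>x. Re (inverse c * D \<phi> x))"
  proof
    show "(\<lambda>x. (Re (inverse c * \<phi> x))\<^sup>2) integrable_on {0..}"
      using I[unfolded u_def] by (rule has_integral_integrable)
    show "ac_deriv (\<lambda>x. Re (inverse c * D \<phi> x)) (\<lambda>x. (V x + (sqrt (- \<mu>))\<^sup>2) * Re (inverse c * \<phi> x))"
      using re(2)[of "inverse c"] \<mu> by simp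
    show "Re (inverse c * D \<phi> 0) = 1" using c0 unfolding c_def[symmetric] by simp
    show "ac_deriv (\<lambda>x. Re (inverse c * \<phi> x)) (\<lambda>x. Re (inverse c * D \<phi> x))" by (rule re(1))
  qed (use V2 \<mu> \<phi>0 in simp_all)
  show "(norm c)\<^sup>2 / (L2_norm half_line \<phi>)\<^sup>2 = inverse (integral {0..} (\<lambda>x. (Re (inverse c * \<phi> x))\<^sup>2))"
    unfolding u_def[symmetric] using I by (simp add: has_integral_iff)
qed

section \<open>From finite sums to sums of extended reals, and the conclusion\<close>

lemma infsum_ereal_eq:
  fixes f :: "'a \<Rightarrow> real"
  assumes "f summable_on A"
  shows "(\<Sum>\<^sub>\<infinity>x\<in>A. ereal (f x)) = ereal (infsum f A)"
proof (rule infsumI)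
  have "(sum f \<longlongrightarrow> infsum f A) (finite_subsets_at_top A)"
    using has_sum_infsum[OF assms] by (simp add: has_sum_def)
  then have "((\<lambda>F. ereal (sum f F)) \<longlongrightarrow> ereal (infsum f A)) (finite_subsets_at_top A)" by (rule tendsto_ereal)
  moreover have "sum (\<lambda>x. ereal (f x)) = (\<lambda>F. ereal (sum f F))" by (rule ext) simp
  ultimately show "((\<lambda>x. ereal (f x)) has_sum ereal (infsum f A)) A" by (simp add: has_sum_def)
qed

text \<open>The bound on finite partial sums makes both families summable over the reals. The
  extended sums are then finite, so the subtraction never meets
  \<open>\<infinity> - \<infinity>\<close>.\<close>

lemma ereal_infsum_add_le:
  fixes a b :: "'a \<Rightarrow> real"
  assumes a: "\<And>x. x \<in> A \<Longrightarrow> 0 \<le> a x" and b: "\<And>x. x \<in> A \<Longrightarrow> 0 \<le> b x" and t: "t > 0"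
    and le: "\<And>F. finite F \<Longrightarrow> F \<subseteq> A \<Longrightarrow> (\<Sum>x\<in>F. a x + t * b x) \<le> C"
  shows "(\<Sum>\<^sub>\<infinity>x\<in>A. ereal (a x)) \<le> ereal C - ereal t * (\<Sum>\<^sub>\<infinity>x\<in>A. ereal (b x))"
proof -
  have sa: "a summable_on A"
  proof (rule nonneg_bdd_above_summable_on[OF a])
    have "sum a F \<le> C" if "F \<subseteq> A" "finite F" for F
    proof -
      have "sum a F \<le> (\<Sum>x\<in>F. a x + t * b x)" using that b t by (intro sum_mono) auto
      then show ?thesis using le that by fastforce
    qed
    then show "bdd_above (sum a ` {F. F \<subseteq> A \<and> finite F})" by (auto intro!: bdd_aboveI)
  qed
  have sb: "b summable_on A"
  proof (rule nonneg_bdd_above_summable_on[OF b])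
    have "sum b F \<le> C / t" if "F \<subseteq> A" "finite F" for F
    proof -
      have "t * sum b F \<le> (\<Sum>x\<in>F. a x + t * b x)" unfolding sum_distrib_left using that a by (intro sum_mono) auto
      then have "t * sum b F \<le> C" using le that by fastforce
      then show ?thesis using t by (simp add: field_simps)
    qed
    then show "bdd_above (sum b ` {F. F \<subseteq> A \<and> finite F})" by (auto intro!: bdd_aboveI)
  qed
  have stb: "(\<lambda>x. t * b x) summable_on A" by (rule summable_on_cmult_right[OF sb])
  have "infsum a A + t * infsum b A = (\<Sum>\<^sub>\<infinity>x\<in>A. a x + t * b x)"
    using infsum_add[OF sa stb] infsum_cmult_right[of t b A] sb by simp
  also have "\<dots> \<le> C" by (rule infsum_le_finite_sums[OF summable_on_add[OF sa stb] le])
  finally show ?thesis unfolding infsum_ereal_eq[OF sa] infsum_ereal_eq[OF sb] by simp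
qed

theorem theorem1p3:
  fixes V :: "real \<Rightarrow> real"
    and N :: enat
    and \<mu> :: "nat \<Rightarrow> real"
    and \<phi> :: "nat \<Rightarrow> real \<Rightarrow> complex"
  assumes V_L1: "integrable half_line V"
    and V_L2: "V \<in> L2 half_line"
    and enum: "\<mu> ` indices N = negative_eigenvalues V"
    and increasing: "strict_mono_on (indices N) \<mu>"
    and eigenfunctions: "\<And>j. j \<in> indices N \<Longrightarrow> eigenfunction V (\<mu> j) (\<phi> j)"
  shows "(\<Sum>\<^sub>\<infinity>j\<in>indices N. ereal (\<bar>\<mu> j\<bar> powr (3/2)))
       \<le> ereal (3/16 * (\<integral>x. (V x)\<^sup>2 \<partial>half_line))
         - ereal (3/4) * (\<Sum>\<^sub>\<infinity>j\<in>indices N. ereal ((norm (D (\<phi> j) 0))\<^sup>2 / (L2_norm half_line (\<phi> j))\<^sup>2))"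
proof (rule ereal_infsum_add_le)
  have V2: "((\<lambda>x. (V x)\<^sup>2) has_integral (\<integral>x. (V x)\<^sup>2 \<partial>half_line)) {0..}"
    using integrable_half_line_has_integral[of "\<lambda>x. (V x)\<^sup>2"] V_L2 by (auto simp: L2_def)
  have neg: "\<mu> j < 0" if "j \<in> indices N" for j
  proof -
    have "\<mu> j \<in> negative_eigenvalues V" using enum that by blast
    then show ?thesis by (simp add: negative_eigenvalues_def)
  qed
  fix F assume F: "finite F" "F \<subseteq> indices N"
  define u where "u j x = Re (inverse (D (\<phi> j) 0) * \<phi> j x)" for j x
  note st = eigenfunction_bound_state[OF V_L2 eigenfunctions neg]
  have "(\<Sum>j\<in>F. sqrt (- \<mu> j) ^ 3 + 3/4 * inverse (integral {0..} (\<lambda>x. (u j x)\<^sup>2))) \<le> 3/16 * integral {0..} (\<lambda>x. (V x)\<^sup>2)"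
  proof (rule bound_states_inequality[OF F(1)])
    \<comment> \<open>Distinct eigenvalues have distinct decay rates, as transforming one state
      along another requires.\<close>
    have "inj_on \<mu> F" using increasing F(2) strict_mono_on_imp_inj_on inj_on_subset by blast
    then show "inj_on (\<lambda>j. sqrt (- \<mu> j)) F" by (auto simp: inj_on_def)
    show "bound_state V (sqrt (- \<mu> j)) (u j) (\<lambda>x. Re (inverse (D (\<phi> j) 0) * D (\<phi> j) x))" if "j \<in> F" for j
      using st(1)[of j] that F(2) unfolding u_def[abs_def] by blast
    show "(\<lambda>x. (V x)\<^sup>2) integrable_on {0..}" using V2 by blast
  qed
  moreover have "sqrt (- \<mu> j) ^ 3 = \<bar>\<mu> j\<bar> powr (3/2)" if "j \<in> F" for j
  proof -
    have "\<mu> j < 0" using neg that F(2) by blast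
    then have "\<bar>\<mu> j\<bar> powr (3/2) = (\<bar>\<mu> j\<bar> powr (1/2)) powr 3" by (simp add: powr_powr)
    also have "\<dots> = sqrt (- \<mu> j) ^ 3" using \<open>\<mu> j < 0\<close> by (simp add: powr_half_sqrt)
    finally show ?thesis by simp
  qed
  moreover have "(norm (D (\<phi> j) 0))\<^sup>2 / (L2_norm half_line (\<phi> j))\<^sup>2 = inverse (integral {0..} (\<lambda>x. (u j x)\<^sup>2))" if "j \<in> F" for j
    using st(2)[of j] that F(2) by (auto simp: u_def)
  ultimately show "(\<Sum>j\<in>F. \<bar>\<mu> j\<bar> powr (3/2) + 3/4 * ((norm (D (\<phi> j) 0))\<^sup>2 / (L2_norm half_line (\<phi> j))\<^sup>2))
      \<le> 3/16 * (\<integral>x. (V x)\<^sup>2 \<partial>half_line)"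
    using V2 by (simp add: has_integral_iff cong: sum.cong)
qed auto

end
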